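(* A binary linear code $\mathcal{C}\subseteq GF(2)^n$ has a geometric representation embeddable into $\mathbb{R}^3$ if and only if $\mathcal{C}$ has a 2-basis.
   Context: A binary linear code of length $n$ is a linear subspace $\mathcal{C}\subseteq GF(2)^n$. A basis $B$ of $\mathcal{C}$ is a 2-basis if for every coordinate $i\in\{1,\dots,n\}$ at most two vectors of $B$ have non-zero $i$-th entry. A triangular configuration is a finite two-dimensional simplicial complex (finite set of geometric simplices closed under faces, any two intersecting in a common face or not at all) in which every maximal simplex is a triangle or a segment; $T(\Delta)$ is its set of triangles. Its incidence matrix over $GF(2)$ has rows indexed by edges and columns by triangles, entry $1$ iff the edge is a side of the triangle; $\ker\Delta\subseteq GF(2)^{T(\Delta)}$ is the kernel of this matrix. Puncturing a code $\mathcal{D}\subseteq GF(2)^m$ along a set $S$ of coordinates means deleting the entries indexed by $S$ from every codeword; the result is denoted $\mathcal{D}/S$. The code $\mathcal{C}$ has a geometric representation if there is a triangular configuration $\Delta$ and a set $S\subseteq T(\Delta)$ such that, after identifying the coordinates in $T(\Delta)\setminus S$ with $\{1,\dots,n\}$ by a suitable bijection, $\mathcal{C}=\ker\Delta/S$, and $\dim\mathcal{C}=\dim\ker\Delta$. The representation is embeddable into $\mathbb{R}^k$ if $\Delta$ is isomorphic to a triangular configuration whose simplices lie in $\mathbb{R}^k$. *)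

theory Defs
  imports
    "HOL-Analysis.Analysis"
    "HOL-Analysis.Finite_Function_Topology"
    "HOL-Library.Function_Algebras"
    "HOL-Library.Z2"
begin

section \<open>Vectors and codes over GF(2)\<close>

text \<open>
  GF(2) is the field \<^typ>\<open>bit\<close>. For an index set I, the space of GF(2)-vectors indexed by I is
  encoded as the functions on the whole index type that vanish outside I.
\<close>

global_interpretation gf2: vector_space "\<lambda>(c :: bit) (x :: 'i \<Rightarrow> bit) i. c * x i"
  defines gf2_subspace = gf2.subspace
    and gf2_span = gf2.span
    and gf2_dependent = gf2.dependent
    and gf2_dim = gf2.dim
  by unfold_locales
    (simp_all only: fun_eq_iff plus_fun_apply distrib_left distrib_right mult.assoc mult_1_left simp_thms)

definition gf2_vectors :: "'i set \<Rightarrow> ('i \<Rightarrow> bit) set" where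
  "gf2_vectors I = {x. \<forall>i. i \<notin> I \<longrightarrow> x i = 0}"

definition binary_linear_code :: "nat \<Rightarrow> (nat \<Rightarrow> bit) set \<Rightarrow> bool" where
  "binary_linear_code n C \<longleftrightarrow> C \<subseteq> gf2_vectors {1..n} \<and> gf2_subspace C"

definition two_basis :: "nat \<Rightarrow> (nat \<Rightarrow> bit) set \<Rightarrow> (nat \<Rightarrow> bit) set \<Rightarrow> bool" where
  "two_basis n C B \<longleftrightarrow>
     \<not> gf2_dependent B \<and> gf2_span B = C \<and>
     (\<forall>i\<in>{1..n}. finite {b \<in> B. b i \<noteq> 0} \<and> card {b \<in> B. b i \<noteq> 0} \<le> 2)"

text \<open>
  In this encoding, deleting the entries indexed by S from the vectors indexed by I means passing
  to vectors indexed by \<open>I - S\<close>, that is, overwriting those entries by the filler value 0.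
\<close>

definition puncture :: "('i \<Rightarrow> bit) set \<Rightarrow> 'i set \<Rightarrow> ('i \<Rightarrow> bit) set" where
  "puncture D S = (\<lambda>x i. if i \<in> S then 0 else x i) ` D"


section \<open>Triangular configurations\<close>

text \<open>
  The library's \<^const>\<open>simplex\<close> and \<^const>\<open>simplicial_complex\<close> are restricted to Euclidean spaces.
  The following versions make sense in every real vector space, in particular in the space of
  finitely supported real sequences, which is the union of all the spaces R^m; on Euclidean spaces
  they agree with the library notions. As there, the empty set counts as a simplex
  of dimension \<open>-1\<close> and as a face of every simplex.
\<close>

definition is_simplex :: "int \<Rightarrow> 'a::real_vector set \<Rightarrow> bool" where
  "is_simplex d \<sigma> \<longleftrightarrow>
     (\<exists>V. finite V \<and> \<not> affine_dependent V \<and> int (card V) = d + 1 \<and> \<sigma> = convex hull V)"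

definition geometric_complex :: "'a::real_vector set set \<Rightarrow> bool" where
  "geometric_complex \<Delta> \<longleftrightarrow>
     finite \<Delta> \<and>
     (\<forall>\<sigma>\<in>\<Delta>. \<exists>d. is_simplex d \<sigma>) \<and>
     (\<forall>\<tau> \<sigma>. \<sigma> \<in> \<Delta> \<and> \<tau> face_of \<sigma> \<longrightarrow> \<tau> \<in> \<Delta>) \<and>
     (\<forall>\<sigma> \<tau>. \<sigma> \<in> \<Delta> \<and> \<tau> \<in> \<Delta> \<longrightarrow> (\<sigma> \<inter> \<tau>) face_of \<sigma>)"

lemma is_simplex_iff_simplex: "is_simplex d \<sigma> \<longleftrightarrow> d simplex \<sigma>"
  for \<sigma> :: "'a::euclidean_space set"
  by (simp add: is_simplex_def simplex)

lemma geometric_complex_iff_simplicial_complex: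
  "geometric_complex \<Delta> \<longleftrightarrow> simplicial_complex \<Delta>" for \<Delta> :: "'a::euclidean_space set set"
  by (simp add: geometric_complex_def simplicial_complex_def is_simplex_iff_simplex)

definition triangles :: "'a::real_vector set set \<Rightarrow> 'a set set" where
  "triangles \<Delta> = {\<sigma> \<in> \<Delta>. is_simplex 2 \<sigma>}"

definition edges :: "'a::real_vector set set \<Rightarrow> 'a set set" where
  "edges \<Delta> = {\<sigma> \<in> \<Delta>. is_simplex 1 \<sigma>}"

text \<open>
  Two-dimensionality is read literally: there is at least one triangle, and (by the condition on
  maximal simplices) no simplex of higher dimension.
\<close>

definition triangular_configuration :: "'a::real_vector set set \<Rightarrow> bool" where
  "triangular_configuration \<Delta> \<longleftrightarrow>
     geometric_complex \<Delta> \<and> triangles \<Delta> \<noteq> {} \<and>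
     (\<forall>\<sigma>\<in>\<Delta>. (\<forall>\<tau>\<in>\<Delta>. \<sigma> \<subseteq> \<tau> \<longrightarrow> \<tau> = \<sigma>) \<longrightarrow> is_simplex 1 \<sigma> \<or> is_simplex 2 \<sigma>)"

definition incidence :: "'a::real_vector set \<Rightarrow> 'a set \<Rightarrow> bit" where
  "incidence e t = (if e face_of t then 1 else 0)"

definition config_kernel :: "'a::real_vector set set \<Rightarrow> ('a set \<Rightarrow> bit) set" where
  "config_kernel \<Delta> =
     {x \<in> gf2_vectors (triangles \<Delta>).
        \<forall>e\<in>edges \<Delta>. (\<Sum>t\<in>triangles \<Delta>. incidence e t * x t) = 0}"

text \<open>
  Isomorphism of configurations is isomorphism of the underlying abstract simplicial complexes:
  a bijection of the vertices that carries vertex sets of simplices exactly to vertex sets of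
  simplices.
\<close>

definition abstract_complex :: "'a::real_vector set set \<Rightarrow> 'a set set" where
  "abstract_complex \<Delta> = (\<lambda>\<sigma>. {v. v extreme_point_of \<sigma>}) ` \<Delta>"

definition config_isomorphic :: "'a::real_vector set set \<Rightarrow> 'b::real_vector set set \<Rightarrow> bool" where
  "config_isomorphic \<Delta> \<Delta>' \<longleftrightarrow>
     (\<exists>f. bij_betw f (\<Union>(abstract_complex \<Delta>)) (\<Union>(abstract_complex \<Delta>')) \<and>
          (\<lambda>V. f ` V) ` abstract_complex \<Delta> = abstract_complex \<Delta>')"

definition embeddable_into :: "'b::euclidean_space itself \<Rightarrow> 'a::real_vector set set \<Rightarrow> bool" where
  "embeddable_into (_ :: 'b itself) \<Delta> \<longleftrightarrow>
     (\<exists>\<Delta>' :: 'b set set. triangular_configuration \<Delta>' \<and> config_isomorphic \<Delta> \<Delta>')"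


section \<open>Geometric representations\<close>

definition geometric_representation ::
  "nat \<Rightarrow> (nat \<Rightarrow> bit) set \<Rightarrow> 'a::real_vector set set \<Rightarrow> 'a set set \<Rightarrow> bool" where
  "geometric_representation n C \<Delta> S \<longleftrightarrow>
     triangular_configuration \<Delta> \<and> S \<subseteq> triangles \<Delta> \<and>
     (\<exists>\<phi>. bij_betw \<phi> {1..n} (triangles \<Delta> - S) \<and>
          C = (\<lambda>x i. if i \<in> {1..n} then x (\<phi> i) else 0) ` puncture (config_kernel \<Delta>) S) \<and>
     gf2_dim C = gf2_dim (config_kernel \<Delta>)"

text \<open>
  Configurations live in R^m for an arbitrary m, that is, in the space of finitely supported real
  sequences: a finite set of simplices in this space is contained in some R^m.
\<close>

definition has_geometric_representation_in ::
  "'b::euclidean_space itself \<Rightarrow> nat \<Rightarrow> (nat \<Rightarrow> bit) set \<Rightarrow> bool" where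
  "has_geometric_representation_in (_ :: 'b itself) n C \<longleftrightarrow>
     (\<exists>(\<Delta> :: (nat, real) poly_mapping set set) S.
        geometric_representation n C \<Delta> S \<and> embeddable_into TYPE('b) \<Delta>)"

end

theory Submission
  imports Defs
begin

text \<open>
  Given a configuration in three-space, call a function on the complement of its triangles locally
  constant if it is so off finitely many lines of a generic direction u through the vertices. Such a
  function jumps along each triangle, and the jumps form a cycle: their sum at an edge is the total
  change along a small loop around the edge. Conversely, every cycle consists of the jumps of a
  locally constant function, the parity of the number of its triangles above a point. Hence the
  kernel is spanned by the jumps of the indicator functions of the components of the complement,
  and a triangle separates at most two of them; a basis chosen among them is a 2-basis.

  Given a 2-basis, triangulate a rectangular grid in a plane, put a pyramid below each row strip and a
  pyramid above each column strip, and keep their boundaries. The regions below are the basis vectors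
  (and the exterior), the regions above are the coordinates of the code, and each region below shares
  a square with each region above. Opening a triangle of such a square merges two regions; the other
  triangle of a square becomes the coordinate separating the two basis vectors involved.
\<close>

text \<open>The kernel and the isomorphism depend only on the triples of corners, so everything is
  carried over to \<open>mod2_cycles\<close> of an abstract set of triples. The first half is a form
  of Alexander duality over GF(2), proved without homology. Genericity of u makes every triangle a
  graph over a plane transverse to u, so that above and below are defined. Deleting the lines
  through the vertices leaves the relative interior of every triangle connected, and a point off
  these lines lies below at most one edge of a triangle. Hence only edges have to be examined, and
  there the cycle condition applies.

  In the second half intersections of simplices are never examined pairwise: one family of
  coordinate functions, valid on all tetrahedra that fill the pyramids, shows that they fit
  together. Row 0 stands for the exterior, so a coordinate met by fewer than two basis vectors needs
  no separate treatment. The dimensions agree because restriction to the chosen triangles is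
  injective, which comes from the independence of the basis.\<close>

section \<open>Linear maps between spaces of GF(2)-vectors\<close>

(* these rules turn sums over GF(2) into bit operations *)
declare add_bit_eq_xor [simp del] mult_bit_eq_and [simp del]

lemma bit_add_self [simp]: "a + a = (0::bit)"
  by (cases a) simp_all

lemma bit_add_eq_0_iff: "(a::bit) + b = 0 \<longleftrightarrow> a = b"
  by (cases a; cases b) auto

lemma gf2_sum_apply: "(\<Sum>x\<in>X. f x) i = (\<Sum>x\<in>X. f x i)" for f :: "'k \<Rightarrow> 'i \<Rightarrow> bit"
  by (induction X rule: infinite_finite_induct) auto

text \<open>Passing to corners, relabelling vertices and reading off the coordinates of the code are
  all pullbacks along maps of indices, so one linearity lemma and one composition rule serve them
  all.\<close>

definition pullback :: "'i set \<Rightarrow> ('i \<Rightarrow> 'j) \<Rightarrow> ('j \<Rightarrow> bit) \<Rightarrow> 'i \<Rightarrow> bit" where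
  "pullback I \<psi> z = (\<lambda>i. if i \<in> I then z (\<psi> i) else 0)"

lemma pullback_comp:
  assumes "\<psi> ` I \<subseteq> J"
  shows "pullback I \<psi> (pullback J \<rho> z) = pullback I (\<rho> \<circ> \<psi>) z"
  using assms by (auto simp: pullback_def fun_eq_iff)

lemma gf2_linear_pullback:
  "Vector_Spaces.linear (\<lambda>(c::bit) x i. c * x i) (\<lambda>c x i. c * x i) (pullback I \<psi>)"
proof -
  have "module_hom (\<lambda>(c::bit) x i. c * x i) (\<lambda>c x i. c * x i) (pullback I \<psi>)"
    by unfold_locales (auto simp: pullback_def fun_eq_iff distrib_left distrib_right)
  then show ?thesis
    unfolding Vector_Spaces.linear_def by (intro conjI gf2.vector_space_axioms)
qed

lemma gf2_span_image:
  assumes "Vector_Spaces.linear (\<lambda>(c::bit) x i. c * x i) (\<lambda>c x i. c * x i) f"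
  shows "gf2_span (f ` X) = f ` gf2_span X"
proof -
  have "module_hom (\<lambda>(c::bit) x i. c * x i) (\<lambda>c x i. c * x i) f"
    using assms by (simp only: Vector_Spaces.linear_def)
  from module_hom.span_image[OF this] show ?thesis
    unfolding gf2_span_def .
qed

text \<open>Serves the clause on dimensions in \<open>geometric_representation\<close>: an injective
  linear map takes a basis to a basis.\<close>

lemma gf2_dim_image:
  assumes f: "Vector_Spaces.linear (\<lambda>(c::bit) x i. c * x i) (\<lambda>c x i. c * x i) f"
    and U: "gf2_subspace U" and inj: "inj_on f U"
  shows "gf2_dim (f ` U) = gf2_dim U"
proof -
  obtain B where B: "B \<subseteq> U" "\<not> gf2_dependent B" "U \<subseteq> gf2_span B"
    using gf2.maximal_independent_subset[of U] by blast
  then have span: "gf2_span B = U"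
    using U by (meson gf2.span_minimal subset_antisym)
  have "vector_space_pair (\<lambda>(c::bit) (x::'a\<Rightarrow>bit) i. c * x i) (\<lambda>c (x::'b\<Rightarrow>bit) i. c * x i)"
    unfolding vector_space_pair_def by (intro conjI gf2.vector_space_axioms)
  from vector_space_pair.linear_independent_injective_image[OF this f]
  have indep: "\<not> gf2_dependent (f ` B)"
    using B(2) inj unfolding span[symmetric] gf2_dependent_def gf2_span_def .
  have UU: "gf2_span U = U"
    using U by (simp add: gf2.span_eq_iff)
  have "gf2_dim (f ` U) = card (f ` B)"
    by (rule gf2.dim_eq_card[OF _ indep]) (simp add: gf2_span_image[OF f] span UU)
  also have "\<dots> = card B"
    using inj B(1) by (meson card_image inj_on_subset)
  also have "\<dots> = gf2_dim U"
    by (rule gf2.dim_eq_card[OF _ B(2), symmetric]) (simp add: span UU)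
  finally show ?thesis .
qed

text \<open>A basis can be chosen inside a spanning set, and discarding vectors cannot increase the
  number of those that are nonzero at a coordinate.\<close>

lemma two_basis_of_spanning_set:
  assumes "gf2_span W = C" "finite W" "\<And>i. i \<in> {1..n} \<Longrightarrow> card {w \<in> W. w i \<noteq> 0} \<le> 2"
  shows "\<exists>B. two_basis n C B"
proof -
  obtain B where B: "B \<subseteq> W" "\<not> gf2_dependent B" "W \<subseteq> gf2_span B"
    using gf2.maximal_independent_subset[of W] by blast
  have "gf2_span B = C"
    using gf2.span_mono[OF B(1)] gf2.span_minimal[OF B(3) gf2.subspace_span] assms(1) by blast
  moreover have "finite {b \<in> B. b i \<noteq> 0} \<and> card {b \<in> B. b i \<noteq> 0} \<le> 2" if "i \<in> {1..n}" for i
  proof -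
    have "{b \<in> B. b i \<noteq> 0} \<subseteq> {w \<in> W. w i \<noteq> 0}" using B by auto
    moreover have "finite {w \<in> W. w i \<noteq> 0}" using assms(2) by simp
    ultimately show ?thesis
      using assms(3)[OF that] by (meson card_mono finite_subset le_trans)
  qed
  ultimately have "two_basis n C B"
    using B(2) unfolding two_basis_def by simp
  then show ?thesis by (rule exI)
qed

text \<open>An image that is nonzero at \<open>i\<close> comes from a vector that is nonzero at
  \<open>\<psi> i\<close>, and vectors with equal images are counted only once.\<close>

lemma two_basis_pullback:
  assumes "gf2_span W = D" "finite W" "\<And>V. card {w \<in> W. w V \<noteq> 0} \<le> 2"
  shows "\<exists>B. two_basis n (pullback {1..n} \<psi> ` D) B"
proof (rule two_basis_of_spanning_set)
  let ?L = "pullback {1..n} \<psi>"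
  show "gf2_span (?L ` W) = ?L ` D"
    by (simp only: gf2_span_image[OF gf2_linear_pullback] assms(1))
  show "finite (?L ` W)" using assms(2) by simp
  show "card {w \<in> ?L ` W. w i \<noteq> 0} \<le> 2" if "i \<in> {1..n}" for i
  proof -
    have "{w \<in> ?L ` W. w i \<noteq> 0} \<subseteq> ?L ` {w \<in> W. w (\<psi> i) \<noteq> 0}"
    proof clarify
      fix w assume "w \<in> W" "?L w i \<noteq> 0"
      then have "w (\<psi> i) \<noteq> 0" using that by (simp add: pullback_def)
      then show "?L w \<in> ?L ` {w \<in> W. w (\<psi> i) \<noteq> 0}" using \<open>w \<in> W\<close> by blast
    qed
    then have "card {w \<in> ?L ` W. w i \<noteq> 0} \<le> card {w \<in> W. w (\<psi> i) \<noteq> 0}"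
      using assms(2) by (intro order_trans[OF card_mono card_image_le]) auto
    then show ?thesis using assms(3) le_trans by blast
  qed
qed


section \<open>Simplices and their corners\<close>

lemma affine_independent_coefficients_unique:
  assumes "finite V" "\<not> affine_dependent V"
    and "sum a V = sum b V" "(\<Sum>v\<in>V. a v *\<^sub>R v) = (\<Sum>v\<in>V. b v *\<^sub>R v)" "v \<in> V"
  shows "a v = b v"
proof -
  have "sum (\<lambda>v. a v - b v) V = 0" "(\<Sum>v\<in>V. (a v - b v) *\<^sub>R v) = 0"
    using assms by (simp_all add: sum_subtractf scaleR_diff_left)
  then have "a v - b v = 0"
    using assms affine_dependent_explicit_finite[OF assms(1)] by blast
  then show ?thesis by simp
qed

lemma convex_hull_finite_superset:
  assumes "finite V" "U \<subseteq> V" "x \<in> convex hull U"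
  obtains a where "\<And>v. v \<in> V \<Longrightarrow> 0 \<le> a v" "sum a V = 1" "(\<Sum>v\<in>V. a v *\<^sub>R v) = x"
    "\<And>v. v \<notin> U \<Longrightarrow> a v = 0"
proof -
  have "finite U" using assms finite_subset by blast
  then obtain a where a: "\<forall>v\<in>U. 0 \<le> a v" "sum a U = 1" "(\<Sum>v\<in>U. a v *\<^sub>R v) = x"
    using assms(3) by (auto simp: convex_hull_finite)
  define b where "b = (\<lambda>v. if v \<in> U then a v else 0)"
  have "sum b V = sum b U" "(\<Sum>v\<in>V. b v *\<^sub>R v) = (\<Sum>v\<in>U. b v *\<^sub>R v)"
    by (rule sum.mono_neutral_right; use assms b_def in simp)+
  moreover have "sum b U = sum a U" "(\<Sum>v\<in>U. b v *\<^sub>R v) = (\<Sum>v\<in>U. a v *\<^sub>R v)"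
    by (simp_all add: b_def)
  ultimately show ?thesis
    using a by (intro that[of b]) (auto simp: b_def)
qed

lemma convex_hull_support:
  assumes "finite V" "\<And>v. v \<in> V \<Longrightarrow> 0 \<le> a v" "sum a V = 1" "(\<Sum>v\<in>V. a v *\<^sub>R v) = x"
    and "U \<subseteq> V" "\<And>v. v \<in> V - U \<Longrightarrow> a v = 0"
  shows "x \<in> convex hull U"
proof -
  have "finite U" using assms finite_subset by blast
  moreover have "sum a V = sum a U" "(\<Sum>v\<in>V. a v *\<^sub>R v) = (\<Sum>v\<in>U. a v *\<^sub>R v)"
    by (rule sum.mono_neutral_right; use assms in simp)+
  ultimately show ?thesis
    using assms by (auto simp: convex_hull_finite intro!: exI[of _ a])
qed

text \<open>The library's description of the faces of a simplex is stated for Euclidean spaces only.\<close>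

lemma face_of_simplex_iff:
  assumes "finite V" "\<not> affine_dependent V"
  shows "F face_of convex hull V \<longleftrightarrow> (\<exists>U\<subseteq>V. F = convex hull U)"
proof
  assume F: "F face_of convex hull V"
  have "F = convex hull (F \<inter> V)"
  proof
    show "convex hull (F \<inter> V) \<subseteq> F"
      using face_of_imp_convex[OF F] by (simp add: hull_minimal)
    show "F \<subseteq> convex hull (F \<inter> V)"
    proof
      fix x assume x: "x \<in> F"
      then have "x \<in> convex hull V" using F face_of_imp_subset by blast
      then obtain a where a: "\<forall>v\<in>V. 0 \<le> a v" "sum a V = 1" "(\<Sum>v\<in>V. a v *\<^sub>R v) = x"
        using assms(1) by (auto simp: convex_hull_finite)
      \<comment> \<open>Suppose x in F had positive weight on a vertex v outside F, and let y be the
        weighted mean of the other vertices. Then x is v or lies strictly between v and y, and the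
        face property puts v into F.\<close>
      have "a v = 0" if v: "v \<in> V - F \<inter> V" for v
      proof (rule ccontr)
        assume "a v \<noteq> 0"
        then have pos: "a v > 0" using a v by (metis DiffD1 order_less_le)
        have sums: "sum a V = a v + sum a (V - {v})"
          "(\<Sum>w\<in>V. a w *\<^sub>R w) = a v *\<^sub>R v + (\<Sum>w\<in>V - {v}. a w *\<^sub>R w)"
          using v assms(1) by (simp_all add: sum.remove[of V v])
        have nn: "sum a (V - {v}) \<ge> 0" using a by (intro sum_nonneg) auto
        show False
        proof (cases "sum a (V - {v}) = 0")
          case True
          then have "\<forall>w\<in>V - {v}. a w = 0"
            using a assms(1) sum_nonneg_eq_0_iff[of "V - {v}" a] by auto
          then have "x = v" using sums a True by simp
          then show False using v x by auto
        next
          case False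
          define s where "s = sum a (V - {v})"
          define y where "y = (\<Sum>w\<in>V - {v}. (a w / s) *\<^sub>R w)"
          have s: "s > 0" "a v = 1 - s" using False nn sums a by (auto simp: s_def)
          have y: "y \<in> convex hull V"
          proof -
            have "y \<in> convex hull (V - {v})"
              using assms(1) a s unfolding y_def convex_hull_finite[OF finite_Diff[OF assms(1)]]
              by (auto simp: s_def sum_divide_distrib[symmetric] intro!: exI[of _ "\<lambda>w. a w / s"])
            then show ?thesis by (meson Diff_subset hull_mono subsetD)
          qed
          have xy: "x = (1 - s) *\<^sub>R v + s *\<^sub>R y"
            using sums a s by (simp add: y_def scaleR_sum_right)
          show False
          proof (cases "y = v")
            case True
            then have "x = v" using xy by (simp add: algebra_simps)
            then show False using v x by auto
          next
            case False
            then have "x \<in> open_segment v y"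
              using s pos xy unfolding in_segment by (auto intro!: exI[of _ s])
            then have "v \<in> F"
              using face_ofD[OF F _ hull_inc[of v V] y x] v by blast
            then show False using v by auto
          qed
        qed
      qed
      then show "x \<in> convex hull (F \<inter> V)"
        using a assms by (intro convex_hull_support[of V a]) auto
    qed
  qed
  then show "\<exists>U\<subseteq>V. F = convex hull U" by blast
next
  assume "\<exists>U\<subseteq>V. F = convex hull U"
  then obtain U where U: "U \<subseteq> V" "F = convex hull U" by blast
  have "p \<in> F" if p: "p \<in> convex hull V" "q \<in> convex hull V" and x: "x \<in> F"
    "x \<in> open_segment p q" for p q x
  proof -
    obtain a where a: "\<And>v. v \<in> V \<Longrightarrow> 0 \<le> a v" "sum a V = 1" "(\<Sum>v\<in>V. a v *\<^sub>R v) = p"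
      using convex_hull_finite_superset[of V V p] assms p by blast
    obtain b where b: "\<And>v. v \<in> V \<Longrightarrow> 0 \<le> b v" "sum b V = 1" "(\<Sum>v\<in>V. b v *\<^sub>R v) = q"
      using convex_hull_finite_superset[of V V q] assms p by blast
    obtain c where c: "\<And>v. v \<in> V \<Longrightarrow> 0 \<le> c v" "sum c V = 1" "(\<Sum>v\<in>V. c v *\<^sub>R v) = x"
      "\<And>v. v \<notin> U \<Longrightarrow> c v = 0"
      using convex_hull_finite_superset[of V U x] assms x U by blast
    obtain t where t: "0 < t" "t < 1" "x = (1 - t) *\<^sub>R p + t *\<^sub>R q"
      using x(2) by (auto simp: in_segment)
    \<comment> \<open>By uniqueness of barycentric coordinates. For v outside U the left side is 0
      and the right side is a positive combination of nonnegative numbers, so p has no weight there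
      either.\<close>
    have "c v = (1 - t) * a v + t * b v" if "v \<in> V" for v
    proof (rule affine_independent_coefficients_unique[OF assms])
      show "sum c V = (\<Sum>v\<in>V. (1 - t) * a v + t * b v)"
        using a b c by (simp add: sum.distrib sum_distrib_left[symmetric])
      show "(\<Sum>v\<in>V. c v *\<^sub>R v) = (\<Sum>v\<in>V. ((1 - t) * a v + t * b v) *\<^sub>R v)"
        unfolding c t(3) a(3)[symmetric] b(3)[symmetric]
        by (simp add: scaleR_add_left sum.distrib scaleR_sum_right)
    qed (use that in auto)
    then have "a v = 0" if "v \<in> V - U" for v
      using c(4)[of v] a(1)[of v] b(1)[of v] t that
      by (metis DiffD1 DiffD2 add_nonneg_eq_0_iff diff_gt_0_iff_gt less_eq_real_def mult_eq_0_iff mult_nonneg_nonneg order_less_irrefl)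
    then show ?thesis
      using a assms U by (auto intro!: convex_hull_support[of V a])
  qed
  moreover have "F \<subseteq> convex hull V" "convex F"
    using U by (auto simp: hull_mono convex_convex_hull)
  ultimately show "F face_of convex hull V"
    unfolding face_of_def by (metis open_segment_commute)
qed

definition corners :: "'a::real_vector set \<Rightarrow> 'a set" where
  "corners \<sigma> = {v. v extreme_point_of \<sigma>}"

lemma corners_convex_hull:
  assumes "finite V" "\<not> affine_dependent V"
  shows "corners (convex hull V) = V"
proof
  show "corners (convex hull V) \<subseteq> V"
    using extreme_point_of_convex_hull by (auto simp: corners_def)
  show "V \<subseteq> corners (convex hull V)"
  proof
    fix v assume "v \<in> V"
    then have "{v} face_of convex hull V"
      using face_of_simplex_iff[OF assms] by (metis convex_hull_singleton empty_subsetI insert_subset)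
    then show "v \<in> corners (convex hull V)"
      by (simp add: corners_def face_of_singleton)
  qed
qed

lemma is_simplex_corners:
  assumes "is_simplex d \<sigma>"
  shows "finite (corners \<sigma>)" "\<not> affine_dependent (corners \<sigma>)" "int (card (corners \<sigma>)) = d + 1"
    "convex hull (corners \<sigma>) = \<sigma>"
  using assms corners_convex_hull unfolding is_simplex_def by metis+

lemma is_simplex_convex_hull:
  assumes "finite V" "\<not> affine_dependent V"
  shows "is_simplex d (convex hull V) \<longleftrightarrow> int (card V) = d + 1"
  using assms is_simplex_corners(3) corners_convex_hull unfolding is_simplex_def by metis

lemma abstract_complex_corners: "abstract_complex \<Delta> = corners ` \<Delta>"
  by (simp add: abstract_complex_def corners_def)

lemma geometric_complex_corners:
  assumes "geometric_complex \<Delta>" "\<sigma> \<in> \<Delta>"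
  shows "finite (corners \<sigma>)" "\<not> affine_dependent (corners \<sigma>)" "convex hull (corners \<sigma>) = \<sigma>"
  using assms is_simplex_corners unfolding geometric_complex_def by metis+

lemma corners_inj_on: "geometric_complex \<Delta> \<Longrightarrow> inj_on corners \<Delta>"
  by (metis geometric_complex_corners(3) inj_onI)

lemma triangles_iff_corners:
  assumes "geometric_complex \<Delta>"
  shows "\<sigma> \<in> triangles \<Delta> \<longleftrightarrow> \<sigma> \<in> \<Delta> \<and> card (corners \<sigma>) = 3"
  using is_simplex_convex_hull[of "corners \<sigma>" 2] geometric_complex_corners[OF assms, of \<sigma>]
  unfolding triangles_def by auto

lemma edges_iff_corners:
  assumes "geometric_complex \<Delta>"
  shows "\<sigma> \<in> edges \<Delta> \<longleftrightarrow> \<sigma> \<in> \<Delta> \<and> card (corners \<sigma>) = 2"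
  using is_simplex_convex_hull[of "corners \<sigma>" 1] geometric_complex_corners[OF assms, of \<sigma>]
  unfolding edges_def by auto

lemma geometric_complex_face_iff:
  assumes "geometric_complex \<Delta>" "\<sigma> \<in> \<Delta>" "\<tau> \<in> \<Delta>"
  shows "\<tau> face_of \<sigma> \<longleftrightarrow> corners \<tau> \<subseteq> corners \<sigma>"
proof -
  note s = geometric_complex_corners[OF assms(1,2)] and t = geometric_complex_corners[OF assms(1,3)]
  have "\<tau> face_of \<sigma> \<longleftrightarrow> (\<exists>U\<subseteq>corners \<sigma>. \<tau> = convex hull U)"
    using face_of_simplex_iff[OF s(1,2), of \<tau>] s(3) by simp
  also have "\<dots> \<longleftrightarrow> corners \<tau> \<subseteq> corners \<sigma>"
  proof
    assume "\<exists>U\<subseteq>corners \<sigma>. \<tau> = convex hull U"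
    then obtain U where U: "U \<subseteq> corners \<sigma>" "\<tau> = convex hull U" by blast
    then have "corners \<tau> = U"
      using corners_convex_hull[of U] affine_dependent_subset[of U] finite_subset[of U] s by blast
    then show "corners \<tau> \<subseteq> corners \<sigma>" using U by simp
  next
    assume "corners \<tau> \<subseteq> corners \<sigma>"
    then show "\<exists>U\<subseteq>corners \<sigma>. \<tau> = convex hull U" using t(3) by metis
  qed
  finally show ?thesis .
qed


section \<open>Cycles of abstract two-dimensional complexes\<close>

text \<open>No separate set of edges is kept: a pair contained in no member of \<open>T\<close>
  gives an empty sum. Coordinates are indexed by vertex sets, so an isomorphism of complexes acts by
  mere relabelling.\<close>

definition mod2_cycles :: "'v set set \<Rightarrow> ('v set \<Rightarrow> bit) set" where
  "mod2_cycles T = {z \<in> gf2_vectors T. \<forall>E. card E = 2 \<longrightarrow> (\<Sum>V\<in>{V \<in> T. E \<subseteq> V}. z V) = 0}"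

lemma mod2_cycles_subspace: "gf2_subspace (mod2_cycles T)"
  by (rule gf2.subspaceI)
    (auto simp: mod2_cycles_def gf2_vectors_def sum.distrib sum_distrib_left[symmetric])

lemma mod2_cyclesD: "z \<in> mod2_cycles T \<Longrightarrow> card E = 2 \<Longrightarrow> (\<Sum>V\<in>{V \<in> T. E \<subseteq> V}. z V) = 0"
  by (simp add: mod2_cycles_def)

text \<open>The common core of passing from triangles to their corners and of relabelling vertices.
  Only nonempty stars have to correspond; a pair with empty star imposes no condition on either
  side.\<close>

lemma pullback_mod2_cycles:
  fixes P :: "'e set \<Rightarrow> 't \<Rightarrow> bool"
  assumes bij: "bij_betw \<psi> T T'"
    and E: "\<And>E. card E = 2 \<Longrightarrow> {t \<in> T. P E t} = {} \<or> (\<exists>E'. card E' = 2 \<and> \<psi> ` {t \<in> T. P E t} = {V \<in> T'. E' \<subseteq> V})"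
    and E': "\<And>E'. card E' = 2 \<Longrightarrow> {V \<in> T'. E' \<subseteq> V} = {} \<or> (\<exists>E. card E = 2 \<and> \<psi> ` {t \<in> T. P E t} = {V \<in> T'. E' \<subseteq> V})"
  shows "{x \<in> gf2_vectors T. \<forall>E. card E = 2 \<longrightarrow> (\<Sum>t\<in>{t \<in> T. P E t}. x t) = 0}
    = pullback T \<psi> ` mod2_cycles T'" (is "?K = _")
proof
  have inj: "inj_on \<psi> T" and im: "\<psi> ` T = T'"
    using bij by (auto simp: bij_betw_def)
  have sums: "(\<Sum>V\<in>\<psi> ` {t \<in> T. P E t}. z V) = (\<Sum>t\<in>{t \<in> T. P E t}. pullback T \<psi> z t)" for z :: "_ \<Rightarrow> bit" and E
  proof -
    have "inj_on \<psi> {t \<in> T. P E t}" by (rule inj_on_subset[OF inj]) simp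
    then show ?thesis by (simp add: sum.reindex pullback_def)
  qed
  show "pullback T \<psi> ` mod2_cycles T' \<subseteq> ?K"
  proof (clarify, intro conjI allI impI)
    fix z assume z: "z \<in> mod2_cycles T'"
    show "pullback T \<psi> z \<in> gf2_vectors T" by (auto simp: pullback_def gf2_vectors_def)
    fix E :: "'e set" assume "card E = 2"
    from E[OF this] show "(\<Sum>t\<in>{t \<in> T. P E t}. pullback T \<psi> z t) = 0"
    proof
      assume "{t \<in> T. P E t} = {}" then show ?thesis by (simp only: sum.empty)
    next
      assume "\<exists>E'. card E' = 2 \<and> \<psi> ` {t \<in> T. P E t} = {V \<in> T'. E' \<subseteq> V}"
      then obtain E' where "card E' = 2" and im: "\<psi> ` {t \<in> T. P E t} = {V \<in> T'. E' \<subseteq> V}"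
        by blast
      then have "(\<Sum>V\<in>{V \<in> T'. E' \<subseteq> V}. z V) = 0"
        using z by (simp add: mod2_cycles_def)
      then show ?thesis using sums[of z E] by (simp only: im)
    qed
  qed
  show "?K \<subseteq> pullback T \<psi> ` mod2_cycles T'"
  proof
    fix x assume x: "x \<in> ?K"
    define z where "z = pullback T' (inv_into T \<psi>) x"
    have xz: "x = pullback T \<psi> z"
    proof
      fix t
      have "x t = 0" if "t \<notin> T"
        using x that by (simp add: gf2_vectors_def)
      moreover have "\<psi> t \<in> T'" "inv_into T \<psi> (\<psi> t) = t" if "t \<in> T"
        using that im inj by auto
      ultimately show "x t = pullback T \<psi> z t"
        by (simp add: z_def pullback_def)
    qed
    have "(\<Sum>V\<in>{V \<in> T'. E' \<subseteq> V}. z V) = 0" if "card E' = 2" for E'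
      using E'[OF that]
    proof
      assume "{V \<in> T'. E' \<subseteq> V} = {}" then show ?thesis by (simp only: sum.empty)
    next
      assume "\<exists>E. card E = 2 \<and> \<psi> ` {t \<in> T. P E t} = {V \<in> T'. E' \<subseteq> V}"
      then obtain E where "card E = 2" and im: "\<psi> ` {t \<in> T. P E t} = {V \<in> T'. E' \<subseteq> V}"
        by blast
      then have "(\<Sum>t\<in>{t \<in> T. P E t}. x t) = 0"
        using x by simp
      then show ?thesis using sums[of z E] by (simp only: im xz)
    qed
    moreover have "z \<in> gf2_vectors T'" by (simp add: gf2_vectors_def z_def pullback_def)
    ultimately have "z \<in> mod2_cycles T'" by (simp add: mod2_cycles_def)
    then show "x \<in> pullback T \<psi> ` mod2_cycles T'" using xz by blast
  qed
qed

lemma mod2_cycles_relabel: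
  assumes inj: "inj_on f (\<Union>T)" and fin: "\<And>V. V \<in> T \<Longrightarrow> finite V"
  shows "mod2_cycles T = pullback T ((`) f) ` mod2_cycles ((`) f ` T)"
proof -
  have inj': "inj_on ((`) f) (Pow (\<Union>T))"
    using inj by (simp add: inj_on_image_Pow)
  show ?thesis unfolding mod2_cycles_def[of T]
  proof (rule pullback_mod2_cycles)
    show "bij_betw ((`) f) T ((`) f ` T)"
      unfolding bij_betw_def by (rule conjI[OF inj_on_subset[OF inj']]) auto
    have im: "(`) f ` {V \<in> T. E \<subseteq> V} = {V \<in> (`) f ` T. f ` E \<subseteq> V}" if "E \<subseteq> \<Union>T" for E
    proof -
      have "E \<subseteq> V \<longleftrightarrow> f ` E \<subseteq> f ` V" if "V \<in> T" for V
        using inj_on_image_subset_iff[OF inj \<open>E \<subseteq> \<Union>T\<close>, of V] that by blast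
      then show ?thesis by blast
    qed
    show "{V \<in> T. E \<subseteq> V} = {} \<or> (\<exists>E'. card E' = 2 \<and> (`) f ` {V \<in> T. E \<subseteq> V} = {V \<in> (`) f ` T. E' \<subseteq> V})"
      if "card E = 2" for E
    proof (cases "E \<subseteq> \<Union>T")
      case True
      then have "card (f ` E) = 2"
        using that card_image[OF inj_on_subset[OF inj]] by simp
      then show ?thesis using im[OF True] by blast
    qed blast
    show "{V \<in> (`) f ` T. E' \<subseteq> V} = {} \<or> (\<exists>E. card E = 2 \<and> (`) f ` {V \<in> T. E \<subseteq> V} = {V \<in> (`) f ` T. E' \<subseteq> V})"
      if "card E' = 2" for E'
    proof (cases "{V \<in> (`) f ` T. E' \<subseteq> V} = {}")
      case False
      then obtain V where "V \<in> T" "E' \<subseteq> f ` V" by auto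
      then obtain E where E: "E \<subseteq> V" "E' = f ` E" by (metis subset_imageE)
      then have "E \<subseteq> \<Union>T" using \<open>V \<in> T\<close> by blast
      moreover from this have "card E = 2"
        using that card_image[OF inj_on_subset[OF inj]] E(2) by simp
      ultimately show ?thesis using im[of E] E(2) by blast
    qed simp
  qed
qed

text \<open>A complex is closed under faces, so any two corners of a triangle span one of its edges.
  Quantifying over \<open>edges\<close> or over all pairs of points therefore gives the same
  conditions.\<close>

lemma config_kernel_eq_pullback:
  assumes \<Delta>: "geometric_complex \<Delta>"
  shows "config_kernel \<Delta> = pullback (triangles \<Delta>) corners ` mod2_cycles (corners ` triangles \<Delta>)"
proof -
  have fin: "finite (triangles \<Delta>)"
    using \<Delta> by (auto simp: triangles_def geometric_complex_def)
  have eq: "(\<Sum>t\<in>triangles \<Delta>. incidence e t * x t) = (\<Sum>t\<in>{t \<in> triangles \<Delta>. corners e \<subseteq> corners t}. x t)"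
    if "e \<in> edges \<Delta>" for e x
  proof -
    have "incidence e t * x t = (if corners e \<subseteq> corners t then x t else 0)" if "t \<in> triangles \<Delta>" for t
      using geometric_complex_face_iff[OF \<Delta>, of t e] that \<open>e \<in> edges \<Delta>\<close>
      by (auto simp: incidence_def triangles_def edges_def)
    then show ?thesis
      using fin by (simp add: sum.inter_filter cong: sum.cong)
  qed
  have edge: "\<exists>e\<in>edges \<Delta>. corners e = E" if "card E = 2" "t \<in> triangles \<Delta>" "E \<subseteq> corners t" for E t
  proof -
    have t: "t \<in> \<Delta>" using that by (simp add: triangles_def)
    note c = geometric_complex_corners[OF \<Delta> t]
    have "finite E" "\<not> affine_dependent E"
      using c that finite_subset affine_dependent_subset by blast+
    then have "corners (convex hull E) = E" by (rule corners_convex_hull)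
    moreover have "convex hull E face_of t"
      using face_of_simplex_iff[OF c(1,2), of "convex hull E"] that c(3) by auto
    then have "convex hull E \<in> \<Delta>"
      using \<Delta> t unfolding geometric_complex_def by blast
    ultimately show ?thesis
      using edges_iff_corners[OF \<Delta>] that by metis
  qed
  have "config_kernel \<Delta> = {x \<in> gf2_vectors (triangles \<Delta>).
      \<forall>E. card E = 2 \<longrightarrow> (\<Sum>t\<in>{t \<in> triangles \<Delta>. E \<subseteq> corners t}. x t) = 0}" (is "_ = ?K")
  proof (intro set_eqI iffI)
    fix x assume x: "x \<in> config_kernel \<Delta>"
    have "(\<Sum>t\<in>{t \<in> triangles \<Delta>. E \<subseteq> corners t}. x t) = 0" if "card E = 2" for E
    proof (cases "\<exists>e\<in>edges \<Delta>. corners e = E")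
      case True
      then show ?thesis using x eq unfolding config_kernel_def by auto
    next
      case False
      then have "{t \<in> triangles \<Delta>. E \<subseteq> corners t} = {}" using edge that by blast
      then show ?thesis by (simp only: sum.empty)
    qed
    then show "x \<in> ?K" using x by (auto simp: config_kernel_def)
  next
    fix x assume "x \<in> ?K"
    then show "x \<in> config_kernel \<Delta>"
      using eq edges_iff_corners[OF \<Delta>] by (auto simp: config_kernel_def)
  qed
  also have "\<dots> = pullback (triangles \<Delta>) corners ` mod2_cycles (corners ` triangles \<Delta>)"
  proof (rule pullback_mod2_cycles)
    show "bij_betw corners (triangles \<Delta>) (corners ` triangles \<Delta>)"
      unfolding bij_betw_def triangles_def
      by (rule conjI[OF inj_on_subset[OF corners_inj_on[OF \<Delta>]]]) auto
    have im: "corners ` {t \<in> triangles \<Delta>. E \<subseteq> corners t} = {V \<in> corners ` triangles \<Delta>. E \<subseteq> V}" for E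
      by auto
    then show "{t \<in> triangles \<Delta>. E \<subseteq> corners t} = {} \<or>
        (\<exists>E'. card E' = 2 \<and> corners ` {t \<in> triangles \<Delta>. E \<subseteq> corners t} = {V \<in> corners ` triangles \<Delta>. E' \<subseteq> V})"
      "{V \<in> corners ` triangles \<Delta>. E \<subseteq> V} = {} \<or>
        (\<exists>E'. card E' = 2 \<and> corners ` {t \<in> triangles \<Delta>. E' \<subseteq> corners t} = {V \<in> corners ` triangles \<Delta>. E \<subseteq> V})"
      if "card E = 2" for E
      using that im[of E] by blast+
  qed
  finally show ?thesis .
qed


section \<open>Jumps of a locally constant function on an interval\<close>

lemma eventually_same_order_finite:
  fixes x :: real
  assumes "finite P"
  shows "\<forall>\<^sub>F y in nhds x. \<forall>p\<in>P - {x}. y \<noteq> p \<and> (p < y \<longleftrightarrow> p < x)"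
proof (rule eventually_ball_finite)
  show "\<forall>p\<in>P - {x}. \<forall>\<^sub>F y in nhds x. y \<noteq> p \<and> (p < y \<longleftrightarrow> p < x)"
  proof
    fix p assume "p \<in> P - {x}"
    then consider "p < x" | "x < p" by fastforce
    then show "\<forall>\<^sub>F y in nhds x. y \<noteq> p \<and> (p < y \<longleftrightarrow> p < x)"
    proof cases
      case 1
      have "\<forall>\<^sub>F y in nhds x. y \<in> {p<..}"
        using 1 by (intro eventually_nhds_in_open) auto
      then show ?thesis by eventually_elim (use 1 in auto)
    next
      case 2
      have "\<forall>\<^sub>F y in nhds x. y \<in> {..<p}"
        using 2 by (intro eventually_nhds_in_open) auto
      then show ?thesis by eventually_elim (use 2 in auto)
    qed
  qed
qed (use assms in simp)

text \<open>\<open>l s\<close> and \<open>r s\<close> are the one-sided values at \<open>s\<close>.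
  Between consecutive points of \<open>P\<close> the function keeps its value, so the sum
  telescopes; over GF(2) a sum of two values is their difference.\<close>

lemma sum_jumps:
  fixes g l r :: "real \<Rightarrow> bit"
  assumes "finite P" "P \<subseteq> {a<..<b}" "a \<le> b"
    and const: "\<And>s. s \<in> {a..b} - P \<Longrightarrow> \<forall>\<^sub>F x in at s within {a..b}. g x = g s"
    and jump: "\<And>s. s \<in> P \<Longrightarrow> \<forall>\<^sub>F x in at s. (x < s \<longrightarrow> g x = l s) \<and> (s < x \<longrightarrow> g x = r s)"
  shows "(\<Sum>s\<in>P. l s + r s) = g a + g b"
proof -
  \<comment> \<open>\<open>K\<close> is \<open>g\<close> with all jumps to the left of
    \<open>x\<close> undone and with the left value substituted at a jump, hence locally constant on
    the whole interval. At \<open>a\<close> nothing is undone, at \<open>b\<close> everything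
    is.\<close>
  define K where "K = (\<lambda>x. (if x \<in> P then l x else g x) + (\<Sum>p\<in>{p \<in> P. p < x}. l p + r p))"
  have "K a = K b"
  proof (rule connected_local_const[of "{a..b}"])
    show "\<forall>x\<in>{a..b}. \<forall>\<^sub>F y in at x within {a..b}. K x = K y"
    proof
      fix x assume x: "x \<in> {a..b}"
      have near: "\<forall>\<^sub>F y in at x within {a..b}. y \<noteq> x \<and> (\<forall>p\<in>P - {x}. y \<noteq> p \<and> (p < y \<longleftrightarrow> p < x))"
        using eventually_same_order_finite[OF assms(1), of x]
        unfolding eventually_at_filter by eventually_elim auto
      show "\<forall>\<^sub>F y in at x within {a..b}. K x = K y"
      proof (cases "x \<in> P")
        case False
        have "\<forall>\<^sub>F y in at x within {a..b}. g y = g x"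
          using const x False by simp
        then show ?thesis using near
        proof eventually_elim
          case (elim y)
          then have "{p \<in> P. p < y} = {p \<in> P. p < x}" "y \<notin> P" using False by auto
          then show ?case using elim False by (simp add: K_def)
        qed
      next
        case True
        have "\<forall>\<^sub>F y in at x within {a..b}. (y < x \<longrightarrow> g y = l x) \<and> (x < y \<longrightarrow> g y = r x)"
          using jump[OF True] by (meson UNIV_I at_le filter_leD subset_UNIV)
        then show ?thesis using near
        proof eventually_elim
          case (elim y)
          have y: "y \<notin> P" using elim by auto
          show ?case
          proof (cases "y < x")
            case less: True
            have "{p \<in> P. p < y} = {p \<in> P. p < x}"
            proof -
              have "p < y \<longleftrightarrow> p < x" if "p \<in> P" for p
                using elim less that by (cases "p = x") auto
              then show ?thesis by blast
            qed
            then show ?thesis using elim less y True by (simp add: K_def)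
          next
            case False
            then have xy: "x < y" using elim by simp
            have "{p \<in> P. p < y} = insert x {p \<in> P. p < x}"
            proof -
              have "p < y \<longleftrightarrow> p = x \<or> p < x" if "p \<in> P" for p
                using elim xy that by (cases "p = x") auto
              then show ?thesis using True by blast
            qed
            then have "(\<Sum>p\<in>{p \<in> P. p < y}. l p + r p) = l x + r x + (\<Sum>p\<in>{p \<in> P. p < x}. l p + r p)"
              using assms(1) by simp
            moreover have "g y = r x" using elim xy by simp
            ultimately show ?thesis using y True
              by (simp add: K_def)
          qed
        qed
      qed
    qed
  qed (use assms(3) in auto)
  moreover have "K a = g a"
  proof -
    have "{p \<in> P. p < a} = {}" "a \<notin> P" using assms(2) by auto
    then show ?thesis unfolding K_def by (simp only: sum.empty if_False add_0_right)
  qed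
  moreover have "K b = g b + (\<Sum>s\<in>P. l s + r s)"
  proof -
    have "{p \<in> P. p < b} = P" "b \<notin> P" using assms(2) by auto
    then show ?thesis unfolding K_def by (simp only: if_False)
  qed
  ultimately have "g a + g b = g b + (\<Sum>s\<in>P. l s + r s) + g b" by simp
  also have "\<dots> = (\<Sum>s\<in>P. l s + r s)"
    by (cases "g b"; cases "\<Sum>s\<in>P. l s + r s") simp_all
  finally show ?thesis by simp
qed


section \<open>Families of triangles in three-space\<close>

text \<open>The members of \<open>T\<close> are corner sets. \<open>transversal\<close> says that
  \<open>u\<close> is parallel to no plane of a triangle, so that the position of a point relative
  to such a plane can be measured along \<open>u\<close>.\<close>

locale triangle_family =
  fixes T :: "(real ^ 3) set set" and u :: "real ^ 3"
  assumes finite_T: "finite T"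
    and card_T: "V \<in> T \<Longrightarrow> card V = 3"
    and independent_T: "V \<in> T \<Longrightarrow> \<not> affine_dependent V"
    and Int_T: "V \<in> T \<Longrightarrow> W \<in> T \<Longrightarrow> convex hull V \<inter> convex hull W = convex hull (V \<inter> W)"
    and transversal: "V \<in> T \<Longrightarrow> a \<in> V \<Longrightarrow> u \<notin> span ((\<lambda>v. v - a) ` V)"
begin

lemma finite_V: "V \<in> T \<Longrightarrow> finite V"
  using card_T by (metis card.infinite zero_neq_numeral)

text \<open>Affine coordinates of a point: the barycentric coordinates of its projection to the plane of V
  along u, and the signed distance to that plane measured in multiples of u.\<close>

lemma coords_exist:
  assumes "V \<in> T"
  shows "\<exists>\<beta> h. sum \<beta> V = 1 \<and> p = (\<Sum>v\<in>V. \<beta> v *\<^sub>R v) - h *\<^sub>R u"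
proof -
  obtain a b c where V: "V = {a, b, c}" "a \<noteq> b" "a \<noteq> c" "b \<noteq> c"
    using card_T[OF assms] by (auto simp: card_3_iff)
  have indep: "independent {b - a, c - a}"
  proof -
    have "\<not> affine_dependent (insert a {b, c})" using independent_T[OF assms] V by simp
    then have "independent ((\<lambda>x. -a + x) ` {b, c})"
      using affine_dependent_iff_dependent[of a "{b,c}"] V by simp
    then show ?thesis by simp
  qed
  have u: "u \<notin> span {b - a, c - a}"
  proof -
    have "{b - a, c - a} \<subseteq> (\<lambda>v. v - a) ` V" using V by auto
    from span_mono[OF this] show ?thesis using transversal[OF assms, of a] V(1) by auto
  qed
  have ne: "b - a \<noteq> c - a" using V by simp
  have "independent {u, b - a, c - a}"
    by (rule independent_insertI[OF u indep])
  moreover have "card {u, b - a, c - a} = 3"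
  proof -
    have "u \<notin> {b - a, c - a}" using u span_base by blast
    then show ?thesis using ne by simp
  qed
  ultimately have "UNIV \<subseteq> span {u, b - a, c - a}"
    by (intro card_ge_dim_independent) simp_all
  then have "p - a \<in> span {u, b - a, c - a}" by blast
  then obtain k where "p - a - k *\<^sub>R u \<in> span {b - a, c - a}"
    using span_breakdown_eq by blast
  then obtain s where "p - a - k *\<^sub>R u - s *\<^sub>R (b - a) \<in> span {c - a}"
    using span_breakdown_eq by blast
  then obtain t where "p - a - k *\<^sub>R u - s *\<^sub>R (b - a) = t *\<^sub>R (c - a)"
    by (auto simp: span_singleton)
  then have p: "p = (1 - s - t) *\<^sub>R a + s *\<^sub>R b + t *\<^sub>R c - (- k) *\<^sub>R u"
    by (simp add: algebra_simps)
  define \<beta> where "\<beta> = (\<lambda>v. if v = a then 1 - s - t else if v = b then s else t)"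
  have "sum \<beta> V = 1" "(\<Sum>v\<in>V. \<beta> v *\<^sub>R v) = (1 - s - t) *\<^sub>R a + s *\<^sub>R b + t *\<^sub>R c"
    using V by (simp_all add: \<beta>_def)
  then have "sum \<beta> V = 1 \<and> p = (\<Sum>v\<in>V. \<beta> v *\<^sub>R v) - (- k) *\<^sub>R u"
    using p by (simp only: simp_thms)
  then show ?thesis by (intro exI)
qed

text \<open>Unequal heights would place a multiple of \<open>u\<close> in the direction space of the
  plane of \<open>V\<close>, against \<open>transversal\<close>; the rest is affine
  independence.\<close>

lemma coords_unique:
  assumes V: "V \<in> T" and sums: "sum \<beta> V = sum \<gamma> V"
    and eq: "(\<Sum>v\<in>V. \<beta> v *\<^sub>R v) - h *\<^sub>R u = (\<Sum>v\<in>V. \<gamma> v *\<^sub>R v) - k *\<^sub>R u"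
  shows "h = k" "v \<in> V \<Longrightarrow> \<beta> v = \<gamma> v"
proof -
  obtain a where a: "a \<in> V" using card_T[OF V] by fastforce
  show hk: "h = k"
  proof (rule ccontr)
    assume "h \<noteq> k"
    have "(h - k) *\<^sub>R u = (\<Sum>v\<in>V. \<beta> v *\<^sub>R v) - (\<Sum>v\<in>V. \<gamma> v *\<^sub>R v)"
      using eq by (simp add: algebra_simps)
    also have "\<dots> = (\<Sum>v\<in>V. (\<beta> v - \<gamma> v) *\<^sub>R v) - (\<Sum>v\<in>V. \<beta> v - \<gamma> v) *\<^sub>R a"
      using sums by (simp add: sum_subtractf scaleR_diff_left)
    also have "\<dots> = (\<Sum>v\<in>V. (\<beta> v - \<gamma> v) *\<^sub>R (v - a))"
      unfolding scaleR_diff_right sum_subtractf[of "\<lambda>v. (\<beta> v - \<gamma> v) *\<^sub>R v"] scaleR_sum_left ..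
    also have "\<dots> \<in> span ((\<lambda>v. v - a) ` V)"
      by (intro span_sum span_scale span_base) auto
    finally have "(1 / (h - k)) *\<^sub>R (h - k) *\<^sub>R u \<in> span ((\<lambda>v. v - a) ` V)"
      by (rule span_scale)
    then show False using \<open>h \<noteq> k\<close> transversal[OF V a] by simp
  qed
  show "\<beta> v = \<gamma> v" if "v \<in> V"
    using affine_independent_coefficients_unique[OF finite_V[OF V] independent_T[OF V] sums _ that] eq hk
    by simp
qed

section \<open>Barycentric coordinates and heights\<close>

definition coords :: "(real ^ 3) set \<Rightarrow> real ^ 3 \<Rightarrow> (real ^ 3 \<Rightarrow> real) \<times> real" where
  "coords V p = (SOME (\<beta>, h). sum \<beta> V = 1 \<and> p = (\<Sum>v\<in>V. \<beta> v *\<^sub>R v) - h *\<^sub>R u)"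

definition bary :: "(real ^ 3) set \<Rightarrow> real ^ 3 \<Rightarrow> real ^ 3 \<Rightarrow> real" where
  "bary V v p = fst (coords V p) v"

text \<open>Positive where the plane of \<open>V\<close> is reached by moving in direction
  \<open>u\<close>, that is, below \<open>V\<close>; moving a point along \<open>u\<close> lowers
  its height.\<close>

definition height :: "(real ^ 3) set \<Rightarrow> real ^ 3 \<Rightarrow> real" where
  "height V p = snd (coords V p)"

lemma
  assumes "V \<in> T"
  shows sum_bary: "(\<Sum>v\<in>V. bary V v p) = 1"
    and bary_expansion: "p = (\<Sum>v\<in>V. bary V v p *\<^sub>R v) - height V p *\<^sub>R u"
proof -
  obtain \<beta> h where "sum \<beta> V = 1 \<and> p = (\<Sum>v\<in>V. \<beta> v *\<^sub>R v) - h *\<^sub>R u"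
    using coords_exist[OF assms] by blast
  then have "case (\<beta>, h) of (\<beta>, h) \<Rightarrow> sum \<beta> V = 1 \<and> p = (\<Sum>v\<in>V. \<beta> v *\<^sub>R v) - h *\<^sub>R u"
    by simp
  from someI[of "\<lambda>(\<beta>, h). sum \<beta> V = 1 \<and> p = (\<Sum>v\<in>V. \<beta> v *\<^sub>R v) - h *\<^sub>R u", OF this]
  show "(\<Sum>v\<in>V. bary V v p) = 1" "p = (\<Sum>v\<in>V. bary V v p *\<^sub>R v) - height V p *\<^sub>R u"
    by (auto simp: bary_def height_def coords_def case_prod_unfold)
qed

lemma sum_bary_scaled: "V \<in> T \<Longrightarrow> (\<Sum>v\<in>V. bary V v p *\<^sub>R v) = p + height V p *\<^sub>R u"
  using bary_expansion[unfolded eq_diff_eq] by (rule sym)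

lemma
  assumes "V \<in> T" "sum \<beta> V = 1" "p = (\<Sum>v\<in>V. \<beta> v *\<^sub>R v) - h *\<^sub>R u"
  shows height_eqI: "height V p = h" and bary_eqI: "v \<in> V \<Longrightarrow> bary V v p = \<beta> v"
proof -
  have sums: "(\<Sum>v\<in>V. bary V v p) = sum \<beta> V" using sum_bary[OF assms(1)] assms(2) by simp
  have eq: "(\<Sum>v\<in>V. bary V v p *\<^sub>R v) - height V p *\<^sub>R u = (\<Sum>v\<in>V. \<beta> v *\<^sub>R v) - h *\<^sub>R u"
    unfolding assms(3)[symmetric] by (rule bary_expansion[OF assms(1), symmetric])
  show "height V p = h" by (rule coords_unique(1)[OF assms(1) sums eq])
  show "bary V v p = \<beta> v" if "v \<in> V" by (rule coords_unique(2)[OF assms(1) sums eq that])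
qed

lemma
  assumes V: "V \<in> T" and I: "finite I" "sum c I = 1"
  shows height_affine: "height V (\<Sum>i\<in>I. c i *\<^sub>R q i) = (\<Sum>i\<in>I. c i * height V (q i))"
    and bary_affine: "v \<in> V \<Longrightarrow> bary V v (\<Sum>i\<in>I. c i *\<^sub>R q i) = (\<Sum>i\<in>I. c i * bary V v (q i))"
proof -
  have sums: "(\<Sum>v\<in>V. \<Sum>i\<in>I. c i * bary V v (q i)) = 1"
    by (subst sum.swap) (simp add: sum_distrib_left[symmetric] sum_bary[OF V] I)
  have "(\<Sum>i\<in>I. c i *\<^sub>R q i) = (\<Sum>i\<in>I. c i *\<^sub>R ((\<Sum>v\<in>V. bary V v (q i) *\<^sub>R v) - height V (q i) *\<^sub>R u))"
    by (simp add: sum_bary_scaled[OF V])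
  also have "\<dots> = (\<Sum>i\<in>I. \<Sum>v\<in>V. (c i * bary V v (q i)) *\<^sub>R v) - (\<Sum>i\<in>I. c i * height V (q i)) *\<^sub>R u"
    by (simp add: scaleR_diff_right sum_subtractf scaleR_sum_right scaleR_sum_left)
  also have "(\<Sum>i\<in>I. \<Sum>v\<in>V. (c i * bary V v (q i)) *\<^sub>R v) = (\<Sum>v\<in>V. (\<Sum>i\<in>I. c i * bary V v (q i)) *\<^sub>R v)"
    by (subst sum.swap) (simp add: scaleR_sum_left)
  finally have eq: "(\<Sum>i\<in>I. c i *\<^sub>R q i) = (\<Sum>v\<in>V. (\<Sum>i\<in>I. c i * bary V v (q i)) *\<^sub>R v)
    - (\<Sum>i\<in>I. c i * height V (q i)) *\<^sub>R u" .
  show "height V (\<Sum>i\<in>I. c i *\<^sub>R q i) = (\<Sum>i\<in>I. c i * height V (q i))"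
    by (rule height_eqI[OF V sums eq])
  show "bary V v (\<Sum>i\<in>I. c i *\<^sub>R q i) = (\<Sum>i\<in>I. c i * bary V v (q i))" if "v \<in> V"
    by (rule bary_eqI[OF V sums eq that])
qed

lemma
  assumes V: "V \<in> T"
  shows height_shift: "height V (p + s *\<^sub>R u) = height V p - s"
    and bary_shift: "v \<in> V \<Longrightarrow> bary V v (p + s *\<^sub>R u) = bary V v p"
proof -
  have eq: "p + s *\<^sub>R u = (\<Sum>v\<in>V. bary V v p *\<^sub>R v) - (height V p - s) *\<^sub>R u"
    by (simp add: sum_bary_scaled[OF V] algebra_simps)
  show "height V (p + s *\<^sub>R u) = height V p - s"
    by (rule height_eqI[OF V sum_bary[OF V, of p] eq])
  show "bary V v (p + s *\<^sub>R u) = bary V v p" if "v \<in> V"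
    by (rule bary_eqI[OF V sum_bary[OF V, of p] eq that])
qed

lemma bary_vertex:
  assumes V: "V \<in> T" and w: "w \<in> V" and v: "v \<in> V"
  shows "bary V v w = (if v = w then 1 else 0)"
proof -
  have sums: "(\<Sum>v\<in>V. if v = w then 1 else 0 :: real) = 1"
    using finite_V[OF V] w by simp
  have "(\<Sum>v\<in>V. (if v = w then 1 else 0 :: real) *\<^sub>R v) = (\<Sum>v\<in>V. if v = w then v else 0)"
    by (rule sum.cong) auto
  also have "\<dots> = w"
    using finite_V[OF V] w by simp
  finally have eq: "w = (\<Sum>v\<in>V. (if v = w then 1 else 0 :: real) *\<^sub>R v) - 0 *\<^sub>R u" by simp
  show ?thesis by (rule bary_eqI[OF V sums eq v])
qed

lemma affine_functional_continuous:
  fixes f :: "real ^ 3 \<Rightarrow> real"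
  assumes "\<And>(I :: nat set) c q. finite I \<Longrightarrow> sum c I = 1 \<Longrightarrow> f (\<Sum>i\<in>I. c i *\<^sub>R q i) = (\<Sum>i\<in>I. c i * f (q i))"
  shows "continuous_on UNIV f"
proof -
  have "linear (\<lambda>p. f p - f 0)"
  proof (rule linearI)
    fix p q :: "real ^ 3" and r :: real
    \<comment> \<open>\<open>p + q\<close> is the affine combination of \<open>p\<close>,
      \<open>q\<close> and \<open>0\<close> with weights 1, 1 and -1. Likewise
      \<open>r *\<^sub>R p\<close> is one of \<open>p\<close> and \<open>0\<close> with weights
      \<open>r\<close> and \<open>1 - r\<close>.\<close>
    show "f (p + q) - f 0 = f p - f 0 + (f q - f 0)"
      using assms[of "{0,1,2}" "\<lambda>i. if i = 2 then -1 else 1" "\<lambda>i. if i = 0 then p else if i = 1 then q else 0"]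
      by simp
    show "f (r *\<^sub>R p) - f 0 = r *\<^sub>R (f p - f 0)"
      using assms[of "{0,1}" "\<lambda>i. if i = 0 then r else 1 - r" "\<lambda>i. if i = 0 then p else 0"]
      by (simp add: algebra_simps)
  qed
  then have "continuous_on UNIV (\<lambda>p. (f p - f 0) + f 0)"
    unfolding linear_conv_bounded_linear by (intro continuous_on_add linear_continuous_on continuous_on_const)
  then show ?thesis by simp
qed

lemma continuous_height: "V \<in> T \<Longrightarrow> continuous_on UNIV (height V)"
  by (rule affine_functional_continuous) (rule height_affine)

lemma continuous_bary: "V \<in> T \<Longrightarrow> v \<in> V \<Longrightarrow> continuous_on UNIV (bary V v)"
  by (rule affine_functional_continuous) (rule bary_affine)

lemma
  fixes f :: "real ^ 3 \<Rightarrow> real"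
  assumes "continuous_on UNIV f"
  shows eventually_pos: "0 < f p \<Longrightarrow> \<forall>\<^sub>F q in nhds p. 0 < f q"
    and eventually_neg: "f p < 0 \<Longrightarrow> \<forall>\<^sub>F q in nhds p. f q < 0"
proof -
  have "f \<midarrow>p\<rightarrow> f p" using assms by (simp add: continuous_on_def)
  then have lim: "(f \<longlongrightarrow> f p) (nhds p)" by (simp add: tendsto_at_iff_tendsto_nhds)
  show "\<forall>\<^sub>F q in nhds p. 0 < f q" if "0 < f p" using order_tendstoD(1)[OF lim that] .
  show "\<forall>\<^sub>F q in nhds p. f q < 0" if "f p < 0" using order_tendstoD(2)[OF lim that] .
qed

lemma mem_convex_hull_iff:
  assumes V: "V \<in> T"
  shows "p \<in> convex hull V \<longleftrightarrow> height V p = 0 \<and> (\<forall>v\<in>V. 0 \<le> bary V v p)"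
proof
  assume "p \<in> convex hull V"
  then obtain \<beta> where \<beta>: "\<forall>v\<in>V. 0 \<le> \<beta> v" "sum \<beta> V = 1" "(\<Sum>v\<in>V. \<beta> v *\<^sub>R v) = p"
    using finite_V[OF V] by (auto simp: convex_hull_finite)
  then have eq: "p = (\<Sum>v\<in>V. \<beta> v *\<^sub>R v) - 0 *\<^sub>R u" by simp
  show "height V p = 0 \<and> (\<forall>v\<in>V. 0 \<le> bary V v p)"
    using height_eqI[OF V \<beta>(2) eq] bary_eqI[OF V \<beta>(2) eq] \<beta>(1) by simp
next
  assume "height V p = 0 \<and> (\<forall>v\<in>V. 0 \<le> bary V v p)"
  moreover from this have "(\<Sum>v\<in>V. bary V v p *\<^sub>R v) = p"
    by (simp add: sum_bary_scaled[OF V])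
  ultimately show "p \<in> convex hull V"
    using sum_bary[OF V, of p] unfolding convex_hull_finite[OF finite_V[OF V]]
    by (intro CollectI exI[of _ "\<lambda>v. bary V v p"]) simp
qed

lemma bary_convex_hull_subset:
  assumes V: "V \<in> T" and U: "U \<subseteq> V" "p \<in> convex hull U" and v: "v \<in> V - U"
  shows "bary V v p = 0"
proof -
  obtain a where a: "sum a V = 1" "(\<Sum>v\<in>V. a v *\<^sub>R v) = p" "\<And>v. v \<notin> U \<Longrightarrow> a v = 0"
    using convex_hull_finite_superset[OF finite_V[OF V] U] by blast
  then have "bary V v p = a v"
    using bary_eqI[OF V a(1), of p 0 v] v by simp
  then show ?thesis using a(3) v by simp
qed

section \<open>Relative interiors and the free space\<close>

definition inner :: "(real ^ 3) set \<Rightarrow> (real ^ 3) set" where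
  "inner V = {p. height V p = 0 \<and> (\<forall>v\<in>V. 0 < bary V v p)}"

lemma inner_eq_rel_interior:
  assumes V: "V \<in> T"
  shows "inner V = rel_interior (convex hull V)"
proof -
  have "inner V = {y. \<exists>\<beta>. (\<forall>x\<in>V. 0 < \<beta> x) \<and> sum \<beta> V = 1 \<and> (\<Sum>x\<in>V. \<beta> x *\<^sub>R x) = y}" (is "_ = ?R")
  proof
    show "inner V \<subseteq> ?R"
    proof
      fix y assume y: "y \<in> inner V"
      then have "y = (\<Sum>v\<in>V. bary V v y *\<^sub>R v)"
        by (simp add: sum_bary_scaled[OF V] inner_def)
      then show "y \<in> ?R"
        using y sum_bary[OF V, of y] by (auto simp: inner_def intro!: exI[of _ "\<lambda>v. bary V v y"])
    qed
    show "?R \<subseteq> inner V"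
    proof
      fix y assume "y \<in> ?R"
      then obtain \<beta> where \<beta>: "\<forall>x\<in>V. 0 < \<beta> x" "sum \<beta> V = 1" "(\<Sum>x\<in>V. \<beta> x *\<^sub>R x) = y" by blast
      then have eq: "y = (\<Sum>v\<in>V. \<beta> v *\<^sub>R v) - 0 *\<^sub>R u" by simp
      show "y \<in> inner V"
        using height_eqI[OF V \<beta>(2) eq] bary_eqI[OF V \<beta>(2) eq] \<beta>(1) by (simp add: inner_def)
    qed
  qed
  then show ?thesis
    using rel_interior_convex_hull_explicit[OF independent_T[OF V]] by simp
qed

lemma inner_subset: "V \<in> T \<Longrightarrow> inner V \<subseteq> convex hull V"
  using mem_convex_hull_iff by (auto simp: inner_def less_imp_le)

text \<open>A point of the hull of \<open>V \<inter> W\<close> has coordinate 0 at every vertex of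
  \<open>V\<close> outside \<open>W\<close>. As no coordinate of \<open>p\<close> vanishes,
  \<open>V\<close> is contained in \<open>W\<close>, and both have three elements.\<close>

lemma inner_disjoint:
  assumes "V \<in> T" "W \<in> T" "p \<in> inner V" "p \<in> convex hull W"
  shows "V = W"
proof -
  have "p \<in> convex hull (V \<inter> W)"
    using Int_T[OF assms(1,2)] inner_subset[OF assms(1)] assms(3,4) by blast
  then have "V - V \<inter> W = {}"
    using bary_convex_hull_subset[OF assms(1), of "V \<inter> W" p] assms(3) by (fastforce simp: inner_def)
  then show ?thesis
    using card_T assms card_subset_eq[of W V] finite_V by auto
qed

text \<open>Off these lines a point directly below the boundary of a triangle is below the relative
  interior of a single edge. The lines are thin enough to be removed: each meets a triangle in at
  most one point.\<close>

definition vertex_lines :: "(real ^ 3) set" where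
  "vertex_lines = {v + s *\<^sub>R u | v s. v \<in> \<Union>T}"

lemma finite_vertices: "finite (\<Union>T)"
  using finite_T finite_V by auto

lemma closed_vertex_lines: "closed vertex_lines"
proof -
  have "vertex_lines = (\<Union>v\<in>\<Union>T. (+) v ` span {u})"
    unfolding vertex_lines_def span_singleton image_image by blast
  moreover have "closed (\<Union>v\<in>\<Union>T. (+) v ` span {u})"
    using finite_vertices by (intro closed_UN) (auto intro: closed_translation)
  ultimately show ?thesis by simp
qed

text \<open>By transversality a line in direction \<open>u\<close> meets the plane of
  \<open>V\<close> exactly once.\<close>

lemma finite_inner_vertex_lines:
  assumes V: "V \<in> T"
  shows "finite (inner V \<inter> vertex_lines)"
proof (rule finite_subset)
  show "inner V \<inter> vertex_lines \<subseteq> (\<lambda>v. v + height V v *\<^sub>R u) ` \<Union>T"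
    using height_shift[OF V] by (force simp: inner_def vertex_lines_def)
qed (use finite_vertices in simp)

text \<open>Removing finitely many points does not disconnect a convex set of dimension 2.
  Connectedness later makes the one-sided values of a locally constant function the same along all
  of \<open>V\<close>.\<close>

lemma connected_inner: 
  assumes V: "V \<in> T"
  shows "connected (inner V - vertex_lines)" "inner V - vertex_lines \<noteq> {}"
proof -
  have "aff_dim (inner V) = aff_dim (convex hull V)"
    unfolding inner_eq_rel_interior[OF V]
    by (metis aff_dim_affine_hull convex_convex_hull rel_interior_same_affine_hull)
  also have "\<dots> = 2"
    using aff_dim_affine_independent[OF independent_T[OF V]] card_T[OF V] by (simp add: aff_dim_convex_hull)
  finally have dim: "\<not> collinear (inner V)" by (simp add: collinear_aff_dim)
  have conv: "convex (inner V)"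
    using inner_eq_rel_interior[OF V] convex_rel_interior[OF convex_convex_hull] by simp
  have eq: "inner V - vertex_lines = inner V - inner V \<inter> vertex_lines" by blast
  show "connected (inner V - vertex_lines)"
    unfolding eq
    by (rule connected_convex_diff_countable[OF conv dim countable_finite[OF finite_inner_vertex_lines[OF V]]])
  show "inner V - vertex_lines \<noteq> {}"
  proof
    assume "inner V - vertex_lines = {}"
    then have "inner V = inner V \<inter> vertex_lines" by blast
    then have fin: "finite (inner V)" using finite_inner_vertex_lines[OF V] by simp
    have "connected (inner V)" using conv by (rule convex_connected)
    then have "inner V = {} \<or> (\<exists>x. inner V = {x})"
      using fin connected_finite_iff_sing by blast
    then show False using dim by auto
  qed
qed

text \<open>An open set, so \<open>locally_const\<close> restricts only the values taken here; those
  on the triangles and the vertex lines are arbitrary.\<close>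

definition free_space :: "(real ^ 3) set" where
  "free_space = - (\<Union>V\<in>T. convex hull V) - vertex_lines"

lemma open_free_space: "open free_space"
proof -
  have "closed (\<Union>V\<in>T. convex hull V)"
    using finite_T finite_V by (intro closed_UN) (auto intro!: compact_imp_closed finite_imp_compact_convex_hull)
  then show ?thesis
    unfolding free_space_def by (intro open_Diff closed_vertex_lines open_Compl)
qed

section \<open>Locally constant functions on the two sides of a triangle\<close>

definition locally_const :: "(real ^ 3 \<Rightarrow> bit) \<Rightarrow> bool" where
  "locally_const G \<longleftrightarrow> (\<forall>p\<in>free_space. \<forall>\<^sub>F q in nhds p. G q = G p)"

lemma locally_const_connected:
  assumes "locally_const G" "connected S" "S \<subseteq> free_space" "p \<in> S" "q \<in> S"
  shows "G p = G q"
proof (rule connected_local_const[OF assms(2,4,5)])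
  show "\<forall>a\<in>S. \<forall>\<^sub>F b in at a within S. G a = G b"
  proof
    fix a assume "a \<in> S"
    then have "\<forall>\<^sub>F q in nhds a. G q = G a" using assms by (auto simp: locally_const_def)
    then show "\<forall>\<^sub>F b in at a within S. G a = G b"
      unfolding eventually_at_filter by eventually_elim simp
  qed
qed

lemma eventually_avoid:
  assumes "W \<in> T" "p \<notin> convex hull W"
  shows "\<forall>\<^sub>F q in nhds p. q \<notin> convex hull W"
proof -
  have "closed (convex hull W)"
    using finite_V[OF assms(1)] finite_imp_compact_convex_hull compact_imp_closed by blast
  then show ?thesis
    using eventually_nhds_in_open[OF open_Compl, of "convex hull W" p] assms(2) by simp
qed

lemma eventually_avoid_lines:
  "p \<notin> vertex_lines \<Longrightarrow> \<forall>\<^sub>F q in nhds p. q \<notin> vertex_lines"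
  using eventually_nhds_in_open[OF open_Compl[OF closed_vertex_lines], of p] by simp

lemma eventually_near_inner:
  assumes V: "V \<in> T" and x: "x \<in> inner V" "x \<notin> vertex_lines"
  shows "\<forall>\<^sub>F q in nhds x. q \<notin> vertex_lines \<and> (\<forall>W\<in>T - {V}. q \<notin> convex hull W) \<and> (\<forall>v\<in>V. 0 < bary V v q)"
proof (intro eventually_conj eventually_ball_finite ballI)
  show "\<forall>\<^sub>F q in nhds x. q \<notin> vertex_lines" by (rule eventually_avoid_lines[OF x(2)])
  show "\<forall>\<^sub>F q in nhds x. q \<notin> convex hull W" if "W \<in> T - {V}" for W
    using eventually_avoid[of W x] inner_disjoint[OF V _ x(1), of W] that by blast
  show "\<forall>\<^sub>F q in nhds x. 0 < bary V v q" if "v \<in> V" for v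
    using eventually_pos[OF continuous_bary[OF V that]] x that by (simp add: inner_def)
qed (use finite_T finite_V[OF V] in auto)

lemma convex_height:
  assumes "V \<in> T"
  shows "convex {q. 0 < height V q}" "convex {q. height V q < 0}"
proof -
  have aff: "height V (a *\<^sub>R p + b *\<^sub>R q) = a * height V p + b * height V q" if "a + b = 1" for a b p q
    using height_affine[OF assms, of "{0,1::nat}" "\<lambda>i. if i = 0 then a else b" "\<lambda>i. if i = 0 then p else q"] that
    by simp
  show "convex {q. 0 < height V q}"
    unfolding convex_alt
  proof clarsimp
    fix p q t assume "0 < height V p" "0 < height V q" "0 \<le> t" "t \<le> (1::real)"
    then show "0 < height V ((1 - t) *\<^sub>R p + t *\<^sub>R q)"
      by (cases "t = 0") (auto simp: aff intro!: add_nonneg_pos)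
  qed
  show "convex {q. height V q < 0}"
    unfolding convex_def by (simp add: aff convex_bound_lt)
qed

text \<open>Near \<open>x\<close> there is no other triangle and no vertex line, so both halves of a
  small ball are convex subsets of \<open>free_space\<close>. The radius is chosen before
  \<open>G\<close>.\<close>

lemma half_balls:
  assumes V: "V \<in> T" and x: "x \<in> inner V" "x \<notin> vertex_lines"
  obtains e where "0 < e"
    "\<And>G p q. locally_const G \<Longrightarrow> p \<in> ball x e \<Longrightarrow> q \<in> ball x e \<Longrightarrow> 0 < height V p \<Longrightarrow> 0 < height V q \<Longrightarrow> G p = G q"
    "\<And>G p q. locally_const G \<Longrightarrow> p \<in> ball x e \<Longrightarrow> q \<in> ball x e \<Longrightarrow> height V p < 0 \<Longrightarrow> height V q < 0 \<Longrightarrow> G p = G q"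
    "\<And>q. q \<in> ball x e \<Longrightarrow> height V q \<noteq> 0 \<Longrightarrow> q \<in> free_space"
proof -
  obtain e where e: "0 < e" "\<And>q. dist q x < e \<Longrightarrow> q \<notin> vertex_lines \<and> (\<forall>W\<in>T - {V}. q \<notin> convex hull W)"
    using eventually_near_inner[OF assms] unfolding eventually_nhds_metric by blast
  have free: "q \<in> free_space" if "q \<in> ball x e" "height V q \<noteq> 0" for q
    using e(2)[of q] that mem_convex_hull_iff[OF V, of q]
    by (auto simp: free_space_def dist_commute)
  show ?thesis
  proof (rule that[OF e(1)])
    fix G p q assume G: "locally_const G" and pq: "p \<in> ball x e" "q \<in> ball x e"
    show "G p = G q" if "0 < height V p" "0 < height V q"
      by (rule locally_const_connected[OF G, of "ball x e \<inter> {q. 0 < height V q}"])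
        (use pq that free in \<open>auto intro!: convex_connected convex_Int convex_height[OF V]\<close>)
    show "G p = G q" if "height V p < 0" "height V q < 0"
      by (rule locally_const_connected[OF G, of "ball x e \<inter> {q. height V q < 0}"])
        (use pq that free in \<open>auto intro!: convex_connected convex_Int convex_height[OF V]\<close>)
  qed (rule free)
qed

lemma small_shift:
  fixes x :: "real ^ 3"
  assumes "0 < e"
  obtains s where "0 < s" "x + s *\<^sub>R u \<in> ball x e" "x - s *\<^sub>R u \<in> ball x e"
proof -
  define s where "s = e / (1 + norm u)"
  have "0 < 1 + norm u" by (simp add: add_pos_nonneg)
  then have "0 < s" "s * norm u < e" using assms by (auto simp: s_def field_simps)
  then show ?thesis by (intro that[of s]) (auto simp: dist_norm)
qed

text \<open>The points \<open>p\<close> and \<open>q\<close> are the same for all \<open>G\<close>,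
  so a jump can be read off by evaluation at two fixed points. They are taken next to one inner
  point, and connectedness of the punctured triangle transports the two values to all
  others.\<close>

lemma sides:
  assumes V: "V \<in> T"
  obtains p q where "p \<in> free_space" "q \<in> free_space"
    "\<And>G x. locally_const G \<Longrightarrow> x \<in> inner V - vertex_lines \<Longrightarrow>
      \<forall>\<^sub>F y in nhds x. (0 < height V y \<longrightarrow> G y = G p) \<and> (height V y < 0 \<longrightarrow> G y = G q)"
proof -
  define N where "N = inner V - vertex_lines"
  obtain x0 where x0: "x0 \<in> N" using connected_inner(2)[OF V] unfolding N_def by blast
  have x0': "x0 \<in> inner V" "x0 \<notin> vertex_lines" using x0 by (auto simp: N_def)
  obtain e where e: "0 < e"
    "\<And>G p q. locally_const G \<Longrightarrow> p \<in> ball x0 e \<Longrightarrow> q \<in> ball x0 e \<Longrightarrow> 0 < height V p \<Longrightarrow> 0 < height V q \<Longrightarrow> G p = G q"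
    "\<And>G p q. locally_const G \<Longrightarrow> p \<in> ball x0 e \<Longrightarrow> q \<in> ball x0 e \<Longrightarrow> height V p < 0 \<Longrightarrow> height V q < 0 \<Longrightarrow> G p = G q"
    "\<And>q. q \<in> ball x0 e \<Longrightarrow> height V q \<noteq> 0 \<Longrightarrow> q \<in> free_space"
    by (rule half_balls[OF V x0']) blast
  obtain s where s: "0 < s" "x0 + s *\<^sub>R u \<in> ball x0 e" "x0 - s *\<^sub>R u \<in> ball x0 e"
    using small_shift[OF e(1)] by blast
  define p q where "p = x0 - s *\<^sub>R u" and "q = x0 + s *\<^sub>R u"
  have h: "height V p = s" "height V q = - s"
    using height_shift[OF V, of x0 "- s"] height_shift[OF V, of x0 s] x0 by (auto simp: p_def q_def N_def inner_def)
  show ?thesis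
  proof (rule that[of p q])
    show "p \<in> free_space" "q \<in> free_space" using e(4) s h by (auto simp: p_def q_def)
    fix G x assume G: "locally_const G" and x: "x \<in> inner V - vertex_lines"
    \<comment> \<open>\<open>Q x g h\<close> says that near \<open>x\<close> the function
      \<open>G\<close> has the value \<open>g\<close> on one side of the plane and \<open>h\<close>
      on the other. On the punctured triangle such a pair exists, is unique and depends on
      \<open>x\<close> in a locally constant way.\<close>
    define Q where "Q = (\<lambda>x g h. \<forall>\<^sub>F y in nhds x. (0 < height V y \<longrightarrow> G y = g) \<and> (height V y < 0 \<longrightarrow> G y = h))"
    have ex: "\<exists>g h. Q y g h" if y: "y \<in> N" for y
    proof -
      have y': "y \<in> inner V" "y \<notin> vertex_lines" using y by (auto simp: N_def)
      obtain d where d: "0 < d"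
        "\<And>G p q. locally_const G \<Longrightarrow> p \<in> ball y d \<Longrightarrow> q \<in> ball y d \<Longrightarrow> 0 < height V p \<Longrightarrow> 0 < height V q \<Longrightarrow> G p = G q"
        "\<And>G p q. locally_const G \<Longrightarrow> p \<in> ball y d \<Longrightarrow> q \<in> ball y d \<Longrightarrow> height V p < 0 \<Longrightarrow> height V q < 0 \<Longrightarrow> G p = G q"
        by (rule half_balls[OF V y']) blast
      obtain t where t: "0 < t" "y + t *\<^sub>R u \<in> ball y d" "y - t *\<^sub>R u \<in> ball y d"
        using small_shift[OF d(1)] by blast
      have h: "0 < height V (y - t *\<^sub>R u)" "height V (y + t *\<^sub>R u) < 0"
        using height_shift[OF V, of y "- t"] height_shift[OF V, of y t] y t(1) by (auto simp: N_def inner_def)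
      have "\<forall>\<^sub>F z in nhds y. z \<in> ball y d" using d(1) by (intro eventually_nhds_in_open) auto
      then have "Q y (G (y - t *\<^sub>R u)) (G (y + t *\<^sub>R u))"
        unfolding Q_def
        by eventually_elim (use d(2)[OF G _ t(3) _ h(1)] d(3)[OF G _ t(2) _ h(2)] in blast)
      then show ?thesis by blast
    qed
    have unique: "g = g' \<and> h = h'" if "Q y g h" "Q y g' h'" "y \<in> N" for y g h g' h'
    proof -
      have "\<forall>\<^sub>F y in nhds y. (0 < height V y \<longrightarrow> G y = g \<and> G y = g') \<and> (height V y < 0 \<longrightarrow> G y = h \<and> G y = h')"
        using that(1,2) unfolding Q_def by eventually_elim auto
      then obtain d where d: "0 < d" "\<And>z. z \<in> ball y d \<Longrightarrow>
          (0 < height V z \<longrightarrow> G z = g \<and> G z = g') \<and> (height V z < 0 \<longrightarrow> G z = h \<and> G z = h')"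
        unfolding eventually_nhds_metric by (auto simp: dist_commute)
      obtain t where t: "0 < t" "y + t *\<^sub>R u \<in> ball y d" "y - t *\<^sub>R u \<in> ball y d"
        using small_shift[OF d(1)] by blast
      have h: "0 < height V (y - t *\<^sub>R u)" "height V (y + t *\<^sub>R u) < 0"
        using height_shift[OF V, of y "- t"] height_shift[OF V, of y t] that(3) t(1) by (auto simp: N_def inner_def)
      show ?thesis using d(2)[OF t(2)] d(2)[OF t(3)] h by auto
    qed
    define f where "f = (\<lambda>y. SOME gh. Q y (fst gh) (snd gh))"
    have f: "Q y (fst (f y)) (snd (f y))" if y: "y \<in> N" for y
    proof -
      obtain g h where "Q y g h" using ex[OF y] by blast
      then have "Q y (fst (g, h)) (snd (g, h))" by simp
      then show ?thesis unfolding f_def by (rule someI)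
    qed
    have "f x = f x0"
    proof (rule connected_local_const[of N])
      show "connected N" using connected_inner(1)[OF V] by (simp add: N_def)
      show "x \<in> N" "x0 \<in> N" using x x0 by (auto simp: N_def)
      show "\<forall>a\<in>N. \<forall>\<^sub>F b in at a within N. f a = f b"
      proof
        fix a assume a: "a \<in> N"
        have "\<forall>\<^sub>F b in nhds a. Q b (fst (f a)) (snd (f a))"
          using f[OF a] unfolding Q_def by (simp add: eventually_eventually)
        then show "\<forall>\<^sub>F b in at a within N. f a = f b"
          unfolding eventually_at_filter
        proof eventually_elim
          case (elim b)
          show ?case
          proof (intro impI)
            assume "b \<in> N"
            from unique[OF elim f[OF this] this] show "f a = f b" by (simp add: prod_eq_iff)
          qed
        qed
      qed
    qed
    moreover have "Q x0 (G p) (G q)"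
    proof -
      have near: "\<forall>\<^sub>F z in nhds x0. z \<in> ball x0 e" using e(1) by (intro eventually_nhds_in_open) auto
      have pq: "p \<in> ball x0 e" "q \<in> ball x0 e" using s by (auto simp: p_def q_def)
      have "0 < height V p" "height V q < 0" using h s(1) by simp_all
      note rules = e(2)[OF G _ pq(1) _ this(1)] e(3)[OF G _ pq(2) _ this(2)]
      show ?thesis
        using near unfolding Q_def by eventually_elim (use rules in blast)
    qed
    then have "fst (f x0) = G p \<and> snd (f x0) = G q"
      using unique[OF f[OF x0] _ x0] by blast
    ultimately show "\<forall>\<^sub>F y in nhds x. (0 < height V y \<longrightarrow> G y = G p) \<and> (height V y < 0 \<longrightarrow> G y = G q)"
      using f[of x] x unfolding Q_def N_def by simp
  qed
qed

end


context triangle_family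
begin

section \<open>Jumps of locally constant functions are cycles\<close>

text \<open>Both coordinates are affine, unchanged along \<open>u\<close> and zero on
  \<open>E\<close>. They vanish on the plane through \<open>E\<close> parallel to \<open>u\<close>
  and are therefore proportional.\<close>

lemma
  assumes V: "V \<in> T" and W: "W \<in> T" and E: "V = insert c E" "W = insert d E" "c \<notin> E" "d \<notin> E"
  shows bary_opposite: "bary W d q = bary V c q * bary W d c"
    and bary_opposite_nonzero: "bary W d c \<noteq> 0"
proof -
  have fE: "finite E" using finite_V[OF V] E by simp
  have *: "bary W d q = bary V c q * bary W d c" for q
  proof -
    have q: "q = (\<Sum>v\<in>V. bary V v q *\<^sub>R v) + (- height V q) *\<^sub>R u"
      by (simp add: sum_bary_scaled[OF V])
    have "bary W d q = bary W d (\<Sum>v\<in>V. bary V v q *\<^sub>R v)"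
      by (subst q, subst bary_shift[OF W]) (use E in simp_all)
    also have "\<dots> = (\<Sum>v\<in>V. bary V v q * bary W d v)"
      by (rule bary_affine[OF W finite_V[OF V] sum_bary[OF V]]) (use E in simp)
    also have "\<dots> = bary V c q * bary W d c + (\<Sum>v\<in>E. bary V v q * bary W d v)"
      using E fE by simp
    also have "(\<Sum>v\<in>E. bary V v q * bary W d v) = 0"
    proof (intro sum.neutral ballI)
      fix v assume "v \<in> E"
      then have "bary W d v = 0" using bary_vertex[OF W, of v d] E by auto
      then show "bary V v q * bary W d v = 0" by simp
    qed
    finally show ?thesis by simp
  qed
  show "bary W d q = bary V c q * bary W d c" by (rule *)
  show "bary W d c \<noteq> 0"
    using *[of d] bary_vertex[OF W, of d d] E by auto
qed

text \<open>The cycle condition at an edge E is checked on a thin rectangle around a point m of E whose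
  long sides are parallel to u: each triangle at E crosses exactly one of the two long sides.\<close>

lemma edge_jump_sum:
  assumes G: "locally_const G"
    and p: "\<And>V x. V \<in> T \<Longrightarrow> x \<in> inner V - vertex_lines \<Longrightarrow>
      \<forall>\<^sub>F y in nhds x. (0 < height V y \<longrightarrow> G y = g V) \<and> (height V y < 0 \<longrightarrow> G y = h V)"
    and E: "card E = 2" "{V \<in> T. E \<subseteq> V} \<noteq> {}"
  shows "(\<Sum>V\<in>{V \<in> T. E \<subseteq> V}. g V + h V) = 0"
proof -
  obtain V0 where V0: "V0 \<in> T" "E \<subseteq> V0" using E(2) by blast
  have finE: "finite E" using E(1) by (metis card.infinite zero_neq_numeral)
  have third: "\<exists>c. V = insert c E \<and> c \<notin> E" if V: "V \<in> T" "E \<subseteq> V" for V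
  proof -
    have "card (V - E) = 1" using card_Diff_subset[OF finE V(2)] E(1) card_T[OF V(1)] by simp
    then obtain c where "V - E = {c}" by (auto simp: card_1_singleton_iff)
    then show ?thesis using V(2) by blast
  qed
  define opp where "opp = (\<lambda>V. SOME c. V = insert c E \<and> c \<notin> E)"
  have opp: "V = insert (opp V) E" "opp V \<notin> E" if "V \<in> T" "E \<subseteq> V" for V
    using someI_ex[OF third[OF that]] unfolding opp_def by blast+
  define c0 where "c0 = opp V0"
  have c0: "V0 = insert c0 E" "c0 \<notin> E" using opp[OF V0] by (auto simp: c0_def)
  obtain a b where ab: "E = {a, b}" "a \<noteq> b" using E(1) by (auto simp: card_2_iff)
  define mid where "mid = (\<lambda>t. (1 - t) *\<^sub>R a + t *\<^sub>R b)"
  have mid_coords: "height V (mid t) = 0" "bary V a (mid t) = 1 - t" "bary V b (mid t) = t"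
    "v \<in> V - E \<Longrightarrow> bary V v (mid t) = 0"
    if V: "V \<in> T" "E \<subseteq> V" for V t v
  proof -
    define \<beta> where "\<beta> = (\<lambda>v. if v = a then 1 - t else if v = b then t else 0)"
    have "sum \<beta> E = 1" "(\<Sum>v\<in>E. \<beta> v *\<^sub>R v) = mid t"
      using ab(2) by (simp_all add: ab(1) \<beta>_def mid_def)
    moreover have "sum \<beta> V = sum \<beta> E" "(\<Sum>v\<in>V. \<beta> v *\<^sub>R v) = (\<Sum>v\<in>E. \<beta> v *\<^sub>R v)"
      by (rule sum.mono_neutral_right; use V(2) ab(1) finite_V[OF V(1)] in \<open>simp add: \<beta>_def\<close>)+
    ultimately have s: "sum \<beta> V = 1" and eq: "mid t = (\<Sum>v\<in>V. \<beta> v *\<^sub>R v) - 0 *\<^sub>R u" by simp_all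
    show "height V (mid t) = 0" by (rule height_eqI[OF V(1) s eq])
    show "bary V a (mid t) = 1 - t" "bary V b (mid t) = t" "v \<in> V - E \<Longrightarrow> bary V v (mid t) = 0"
      using bary_eqI[OF V(1) s eq, of a] bary_eqI[OF V(1) s eq, of b] bary_eqI[OF V(1) s eq, of v] ab V(2)
      by (simp_all add: \<beta>_def)
  qed
  \<comment> \<open>The coordinate of \<open>b\<close> relative to \<open>V0\<close> is constant
    along \<open>u\<close>, so a vertex line contains \<open>mid t\<close> only if \<open>t\<close>
    is the coordinate of its vertex. This excludes finitely many \<open>t\<close>.\<close>
  obtain t where t: "0 < t" "t < 1" "mid t \<notin> vertex_lines"
  proof -
    have "finite ((\<lambda>v. bary V0 b v) ` \<Union>T)" using finite_vertices by simp
    moreover have "infinite {0<..<1::real}" by simp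
    ultimately obtain t where t: "t \<in> {0<..<1::real}" "t \<notin> (\<lambda>v. bary V0 b v) ` \<Union>T"
      by (meson finite_subset subsetI)
    have "mid t \<notin> vertex_lines"
    proof
      assume "mid t \<in> vertex_lines"
      then obtain v s where v: "v \<in> \<Union>T" "mid t = v + s *\<^sub>R u" by (auto simp: vertex_lines_def)
      have "t = bary V0 b v"
        using mid_coords(3)[OF V0, of t] bary_shift[OF V0(1), of b v s] v ab V0(2) by auto
      then show False using v t by blast
    qed
    then show thesis using that t by auto
  qed
  define m where "m = mid t"
  note m = mid_coords[where t = t, folded m_def]
  define w where "w = c0 - m"
  \<comment> \<open>The rectangle: \<open>\<eta>\<close> runs across the plane through
    \<open>E\<close> and \<open>u\<close>, towards \<open>V0\<close> for positive values, and
    \<open>s\<close> runs along \<open>u\<close>.\<close>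
  define R where "R = (\<lambda>\<eta> s. m + \<eta> *\<^sub>R w + s *\<^sub>R u)"
  have R_eq: "R \<eta> s = (1 - \<eta>) *\<^sub>R m + \<eta> *\<^sub>R c0 + s *\<^sub>R u" for \<eta> s
    by (simp add: R_def w_def algebra_simps)
  have R_height: "height V (R \<eta> s) = \<eta> * height V c0 - s" if V: "V \<in> T" "E \<subseteq> V" for V \<eta> s
  proof -
    have "height V ((1 - \<eta>) *\<^sub>R m + \<eta> *\<^sub>R c0) = (1 - \<eta>) * height V m + \<eta> * height V c0"
      using height_affine[OF V(1), of "{0,1::nat}" "\<lambda>i. if i = 0 then 1 - \<eta> else \<eta>" "\<lambda>i. if i = 0 then m else c0"]
      by simp
    then show ?thesis using m(1)[OF V] height_shift[OF V(1)] by (simp add: R_eq)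
  qed
  \<comment> \<open>The sign of \<open>k V\<close> tells on which side of the plane through
    \<open>E\<close> and \<open>u\<close> the triangle \<open>V\<close> lies.\<close>
  define k where "k = (\<lambda>V. bary V (opp V) c0)"
  have k: "k V \<noteq> 0" if V: "V \<in> T" "E \<subseteq> V" for V
    unfolding k_def using bary_opposite_nonzero[OF V0(1) V(1) c0(1) opp(1)[OF V] c0(2) opp(2)[OF V]] .
  have R_bary: "bary V (opp V) (R \<eta> s) = \<eta> * k V" if V: "V \<in> T" "E \<subseteq> V" for V \<eta> s
  proof -
    have oV: "opp V \<in> V" using opp(1)[OF V] by blast
    have "bary V (opp V) ((1 - \<eta>) *\<^sub>R m + \<eta> *\<^sub>R c0) = (1 - \<eta>) * bary V (opp V) m + \<eta> * k V"
      using bary_affine[OF V(1) _ _ oV, of "{0,1::nat}" "\<lambda>i. if i = 0 then 1 - \<eta> else \<eta>" "\<lambda>i. if i = 0 then m else c0"]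
      by (simp add: k_def)
    moreover have "bary V (opp V) m = 0" using m(4)[OF V] oV opp(2)[OF V] by simp
    ultimately show ?thesis using bary_shift[OF V(1) oV] by (simp add: R_eq)
  qed
  \<comment> \<open>Close to \<open>m\<close> only triangles containing \<open>E\<close> occur, and
    among their coordinates only the one opposite to \<open>E\<close> can fail to be
    positive.\<close>
  define near where "near = (\<lambda>q. q \<notin> vertex_lines \<and> (\<forall>V\<in>T. E \<subseteq> V \<longrightarrow> 0 < bary V a q \<and> 0 < bary V b q)
    \<and> (\<forall>V\<in>T. \<not> E \<subseteq> V \<longrightarrow> q \<notin> convex hull V))"
  have "\<forall>\<^sub>F q in nhds m. near q"
    unfolding near_def
  proof (intro eventually_conj eventually_ball_finite ballI finite_T)
    show "\<forall>\<^sub>F q in nhds m. q \<notin> vertex_lines"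
      using eventually_avoid_lines t by (simp add: m_def)
    fix V assume V: "V \<in> T"
    show "\<forall>\<^sub>F q in nhds m. E \<subseteq> V \<longrightarrow> 0 < bary V a q \<and> 0 < bary V b q"
    proof (cases "E \<subseteq> V")
      case True
      then have "a \<in> V" "b \<in> V" using ab by auto
      then have "\<forall>\<^sub>F q in nhds m. 0 < bary V a q" "\<forall>\<^sub>F q in nhds m. 0 < bary V b q"
        using eventually_pos[OF continuous_bary[OF V]] m(2,3)[OF V True] t by auto
      then show ?thesis by eventually_elim simp
    qed simp
    show "\<forall>\<^sub>F q in nhds m. \<not> E \<subseteq> V \<longrightarrow> q \<notin> convex hull V"
    proof (cases "E \<subseteq> V")
      case False
      have "m \<notin> convex hull V"
      proof
        assume mV: "m \<in> convex hull V"
        have "0 \<le> bary V0 v m" if "v \<in> V0" for v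
          using m(2,3,4)[OF V0] t that ab(1) by (cases "v \<in> E") auto
        then have "m \<in> convex hull V0"
          using m(1)[OF V0] mem_convex_hull_iff[OF V0(1)] by simp
        then have mI: "m \<in> convex hull (V0 \<inter> V)" using Int_T[OF V0(1) V] mV by blast
        obtain e where "e \<in> E" "e \<notin> V" using False by blast
        then have "bary V0 e m = 0"
          using bary_convex_hull_subset[OF V0(1) _ mI, of e] V0(2) by auto
        then show False using m(2,3)[OF V0] t \<open>e \<in> E\<close> ab(1) by auto
      qed
      from eventually_avoid[OF V this] show ?thesis by eventually_elim simp
    qed simp
  qed
  then obtain e where e: "0 < e" "\<And>q. dist q m < e \<Longrightarrow> near q"
    unfolding eventually_nhds_metric by blast
  \<comment> \<open>Small enough for the whole rectangle to consist of points that are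
    \<open>near\<close>.\<close>
  define \<delta> where "\<delta> = e / (1 + norm w + norm u)"
  have pos: "0 < 1 + norm w + norm u" by (simp add: add_pos_nonneg)
  have \<delta>: "0 < \<delta>" using e(1) pos by (simp add: \<delta>_def)
  have R_near: "near (R \<eta> s)" if "\<bar>\<eta>\<bar> \<le> \<delta>" "\<bar>s\<bar> \<le> \<delta>" for \<eta> s
  proof (rule e(2))
    have "dist (R \<eta> s) m = norm (\<eta> *\<^sub>R w + s *\<^sub>R u)" by (simp add: R_def dist_norm)
    also have "\<dots> \<le> \<bar>\<eta>\<bar> * norm w + \<bar>s\<bar> * norm u" by (metis norm_scaleR norm_triangle_ineq)
    also have "\<dots> \<le> \<delta> * norm w + \<delta> * norm u" using that by (intro add_mono mult_right_mono) auto
    also have "\<dots> < \<delta> * (1 + norm w + norm u)" using \<delta> by (simp add: algebra_simps)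
    also have "\<dots> = e" using pos by (simp add: \<delta>_def)
    finally show "dist (R \<eta> s) m < e" .
  qed
  define M where "M = (\<Sum>V\<in>T. \<bar>height V c0\<bar>)"
  have M: "\<bar>height V c0\<bar> \<le> M" if "V \<in> T" for V
    unfolding M_def by (rule member_le_sum) (use that finite_T in auto)
  have M0: "0 \<le> M" by (simp add: M_def sum_nonneg)
  \<comment> \<open>Makes the rectangle so narrow that the planes of the triangles at
    \<open>E\<close> cross it only at parameters \<open>s\<close> of absolute value less than
    \<open>\<delta>\<close>, hence away from the short sides.\<close>
  define \<epsilon> where "\<epsilon> = \<delta> / (1 + M)"
  have \<epsilon>: "0 < \<epsilon>" "\<epsilon> \<le> \<delta>" "\<epsilon> * M < \<delta>"
    using \<delta> M0 by (auto simp: \<epsilon>_def field_simps)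
  have small: "\<bar>\<eta> * height V c0\<bar> < \<delta>" if "\<bar>\<eta>\<bar> \<le> \<epsilon>" "V \<in> T" for \<eta> V
  proof -
    have "\<bar>\<eta> * height V c0\<bar> \<le> \<epsilon> * M"
      unfolding abs_mult using that M[OF that(2)] \<epsilon>(1) by (intro mult_mono) auto
    then show ?thesis using \<epsilon>(3) by simp
  qed
  have R_mem: "R \<eta> s \<in> convex hull V \<longleftrightarrow> E \<subseteq> V \<and> 0 \<le> \<eta> * k V \<and> s = \<eta> * height V c0"
    if "\<bar>\<eta>\<bar> \<le> \<epsilon>" "\<bar>s\<bar> \<le> \<delta>" "V \<in> T" for \<eta> s V
  proof (cases "E \<subseteq> V")
    case True
    have n: "near (R \<eta> s)" using R_near that \<epsilon>(2) by simp
    have "(\<forall>v\<in>V. 0 \<le> bary V v (R \<eta> s)) \<longleftrightarrow> 0 \<le> \<eta> * k V"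
      using opp(1)[OF that(3) True] R_bary[OF that(3) True] n True that(3) ab(1)
      unfolding near_def by (metis insert_iff less_imp_le empty_iff)
    then show ?thesis
      using mem_convex_hull_iff[OF that(3)] R_height[OF that(3) True] True by auto
  next
    case False
    then show ?thesis using R_near[of \<eta> s] that \<epsilon>(2) by (simp add: near_def)
  qed
  have R_free: "R \<eta> s \<in> free_space" if "\<bar>\<eta>\<bar> \<le> \<epsilon>" "\<bar>s\<bar> \<le> \<delta>"
    "\<And>V. V \<in> T \<Longrightarrow> E \<subseteq> V \<Longrightarrow> 0 \<le> \<eta> * k V \<Longrightarrow> s \<noteq> \<eta> * height V c0" for \<eta> s
    using R_mem[OF that(1,2)] R_near[of \<eta> s] that \<epsilon>(2) by (auto simp: free_space_def near_def)
  have cont_R: "continuous_on A (\<lambda>x. R (f x) (f' x))" if "continuous_on A f" "continuous_on A f'"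
    for A :: "real set" and f f'
    unfolding R_def using that by (intro continuous_intros)
  define A where "A = (\<lambda>\<eta>. {V \<in> T. E \<subseteq> V \<and> 0 < \<eta> * k V})"
  \<comment> \<open>Along the long side at \<open>\<eta>\<close> the triangles of
    \<open>A \<eta>\<close> are crossed at distinct parameters \<open>cr V\<close>, each from
    positive to negative height, so \<open>sum_jumps\<close> applies.\<close>
  have side: "(\<Sum>V\<in>A \<eta>. g V + h V) = G (R \<eta> (- \<delta>)) + G (R \<eta> \<delta>)" if \<eta>: "\<bar>\<eta>\<bar> = \<epsilon>" for \<eta>
  proof -
    have \<eta>0: "\<eta> \<noteq> 0" "\<bar>\<eta>\<bar> \<le> \<epsilon>" using \<eta> \<epsilon>(1) by auto
    define cr where "cr = (\<lambda>V. \<eta> * height V c0)"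
    have le_iff: "0 \<le> \<eta> * k V \<longleftrightarrow> 0 < \<eta> * k V" if "V \<in> T" "E \<subseteq> V" for V
      using \<eta>0(1) k[OF that] by (auto simp: less_le)
    have cross: "R \<eta> (cr V) \<in> inner V - vertex_lines" "\<bar>cr V\<bar> < \<delta>" if V: "V \<in> A \<eta>" for V
    proof -
      have VT: "V \<in> T" "E \<subseteq> V" "0 < \<eta> * k V" using V by (auto simp: A_def)
      show cs: "\<bar>cr V\<bar> < \<delta>" unfolding cr_def by (rule small[OF \<eta>0(2) VT(1)])
      have n: "near (R \<eta> (cr V))" using R_near \<eta>0(2) \<epsilon>(2) cs by simp
      have "0 < bary V v (R \<eta> (cr V))" if "v \<in> V" for v
        using that opp(1)[OF VT(1,2)] R_bary[OF VT(1,2)] n VT ab(1)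
        unfolding near_def by (metis insert_iff empty_iff)
      then show "R \<eta> (cr V) \<in> inner V - vertex_lines"
        using n R_height[OF VT(1,2)] by (simp add: near_def inner_def cr_def)
    qed
    have inj: "inj_on cr (A \<eta>)"
    proof (rule inj_onI)
      fix V W assume VW: "V \<in> A \<eta>" "W \<in> A \<eta>" "cr V = cr W"
      have "R \<eta> (cr V) \<in> inner V" "R \<eta> (cr V) \<in> inner W"
        using cross(1)[OF VW(1)] cross(1)[OF VW(2)] VW(3) by auto
      moreover have "V \<in> T" "W \<in> T" using VW by (auto simp: A_def)
      ultimately show "V = W" using inner_disjoint inner_subset by blast
    qed
    have finA: "finite (A \<eta>)" using finite_T by (simp add: A_def)
    define inv where "inv = inv_into (A \<eta>) cr"
    have inv: "inv (cr V) = V" if "V \<in> A \<eta>" for V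
      unfolding inv_def using inj that by (rule inv_into_f_f)
    have "(\<Sum>s\<in>cr ` A \<eta>. g (inv s) + h (inv s)) = G (R \<eta> (- \<delta>)) + G (R \<eta> \<delta>)"
    proof (rule sum_jumps)
      show "finite (cr ` A \<eta>)" using finA by simp
      show "cr ` A \<eta> \<subseteq> {- \<delta><..<\<delta>}" using cross(2) by (force simp: abs_less_iff)
      show "- \<delta> \<le> \<delta>" using \<delta> by simp
      have lim: "filterlim (\<lambda>x. R \<eta> x) (nhds (R \<eta> s)) (at s)" for s
      proof -
        have "continuous_on UNIV (\<lambda>x. R \<eta> x)" by (intro cont_R continuous_intros)
        then show ?thesis by (simp add: continuous_on_def)
      qed
      show "\<forall>\<^sub>F x in at s within {- \<delta>..\<delta>}. G (R \<eta> x) = G (R \<eta> s)" if s: "s \<in> {- \<delta>..\<delta>} - cr ` A \<eta>" for s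
      proof -
        have "R \<eta> s \<in> free_space"
        proof (rule R_free[OF \<eta>0(2)])
          show "\<bar>s\<bar> \<le> \<delta>" using s by auto
          show "s \<noteq> \<eta> * height V c0" if "V \<in> T" "E \<subseteq> V" "0 \<le> \<eta> * k V" for V
            using s that le_iff[OF that(1,2)] by (auto simp: A_def cr_def)
        qed
        then have "\<forall>\<^sub>F y in nhds (R \<eta> s). G y = G (R \<eta> s)" using G by (simp add: locally_const_def)
        then have "\<forall>\<^sub>F x in at s. G (R \<eta> x) = G (R \<eta> s)"
          using lim[of s] by (rule eventually_compose_filterlim)
        then show ?thesis by (rule filter_leD[OF at_le[OF subset_UNIV]])
      qed
      show "\<forall>\<^sub>F x in at s. (x < s \<longrightarrow> G (R \<eta> x) = g (inv s)) \<and> (s < x \<longrightarrow> G (R \<eta> x) = h (inv s))"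
        if s: "s \<in> cr ` A \<eta>" for s
      proof -
        obtain V where V: "V \<in> A \<eta>" "s = cr V" using s by blast
        have VT: "V \<in> T" "E \<subseteq> V" using V by (auto simp: A_def)
        have "\<forall>\<^sub>F y in nhds (R \<eta> s). (0 < height V y \<longrightarrow> G y = g V) \<and> (height V y < 0 \<longrightarrow> G y = h V)"
          unfolding V(2) by (rule p[OF VT(1) cross(1)[OF V(1)]])
        then have "\<forall>\<^sub>F x in at s. (0 < height V (R \<eta> x) \<longrightarrow> G (R \<eta> x) = g V) \<and> (height V (R \<eta> x) < 0 \<longrightarrow> G (R \<eta> x) = h V)"
          using lim[of s] by (rule eventually_compose_filterlim)
        then show ?thesis
          unfolding R_height[OF VT] V(2) inv[OF V(1)] by (simp add: cr_def)
      qed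
    qed
    then show ?thesis by (simp add: sum.reindex[OF inj] inv)
  qed
  have ends: "G (R \<epsilon> s) = G (R (- \<epsilon>) s)" if s: "\<bar>s\<bar> = \<delta>" for s
  proof (rule locally_const_connected[OF G])
    show "connected ((\<lambda>\<eta>. R \<eta> s) ` {- \<epsilon>..\<epsilon>})"
      by (intro connected_continuous_image cont_R continuous_intros connected_Icc)
    show "R \<epsilon> s \<in> (\<lambda>\<eta>. R \<eta> s) ` {- \<epsilon>..\<epsilon>}" "R (- \<epsilon>) s \<in> (\<lambda>\<eta>. R \<eta> s) ` {- \<epsilon>..\<epsilon>}"
      using \<epsilon>(1) by auto
    show "(\<lambda>\<eta>. R \<eta> s) ` {- \<epsilon>..\<epsilon>} \<subseteq> free_space"
    proof clarify
      fix \<eta> assume "\<eta> \<in> {- \<epsilon>..\<epsilon>}"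
      then have "\<bar>\<eta>\<bar> \<le> \<epsilon>" by auto
      then show "R \<eta> s \<in> free_space"
        using small[of \<eta>] s by (intro R_free) auto
    qed
  qed
  \<comment> \<open>Each triangle at \<open>E\<close> crosses exactly one of the two long sides. The
    four values at the corners of the rectangle cancel, because the short sides lie in
    \<open>free_space\<close>.\<close>
  have "{V \<in> T. E \<subseteq> V} = A \<epsilon> \<union> A (- \<epsilon>)" "A \<epsilon> \<inter> A (- \<epsilon>) = {}"
    using k \<epsilon>(1) by (auto simp: A_def zero_less_mult_iff mult_less_0_iff) (meson linorder_neqE_linordered_idom)
  then have "(\<Sum>V\<in>{V \<in> T. E \<subseteq> V}. g V + h V) = (\<Sum>V\<in>A \<epsilon>. g V + h V) + (\<Sum>V\<in>A (- \<epsilon>). g V + h V)"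
    using finite_T by (simp add: sum.union_disjoint A_def)
  also have "\<dots> = G (R \<epsilon> (- \<delta>)) + G (R \<epsilon> \<delta>) + (G (R (- \<epsilon>) (- \<delta>)) + G (R (- \<epsilon>) \<delta>))"
    using side[of \<epsilon>] side[of "- \<epsilon>"] \<epsilon>(1) by simp
  also have "\<dots> = 0"
    using ends[of \<delta>] ends[of "- \<delta>"] \<delta> by simp
  finally show ?thesis .
qed

end


context triangle_family
begin

section \<open>Every cycle is the jump of a locally constant function\<close>

text \<open>The prism below a triangle V consists of the points whose ray in direction u meets V. Its
  lateral facets lie in the planes spanned by u and the edges; which of its two sides such a plane
  belongs to is decided once for every edge. Thanks to this half-open convention the parity of the
  triangles of a cycle above a point is locally constant also in these planes.\<close>

definition side_form :: "(real ^ 3) set \<Rightarrow> real ^ 3 \<Rightarrow> real" where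
  "side_form E = (SOME f. \<exists>V c. V \<in> T \<and> V = insert c E \<and> c \<notin> E \<and> f = bary V c)"

definition side :: "(real ^ 3) set \<Rightarrow> real ^ 3 \<Rightarrow> bool" where
  "side E q \<longleftrightarrow> 0 \<le> side_form E q"

definition in_prism :: "(real ^ 3) set \<Rightarrow> real ^ 3 \<Rightarrow> bool" where
  "in_prism V q \<longleftrightarrow> (\<forall>c\<in>V. side (V - {c}) q = side (V - {c}) c) \<and> 0 < height V q"

text \<open>The point is below the relative interior of the simplex on \<open>E\<close>. The weights
  refer to \<open>E\<close> alone, so that one condition serves all triangles containing
  \<open>E\<close>; \<open>below_facet_iff\<close> expresses it in the coordinates of any of
  them.\<close>

definition below :: "(real ^ 3) set \<Rightarrow> real ^ 3 \<Rightarrow> bool" where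
  "below E p \<longleftrightarrow> (\<exists>s>0. \<exists>l. (\<forall>v\<in>E. 0 < l v) \<and> sum l E = 1 \<and> p + s *\<^sub>R u = (\<Sum>v\<in>E. l v *\<^sub>R v))"

text \<open>By \<open>bary_opposite\<close> the form chosen for the edge is a fixed nonzero multiple
  of \<open>bary V c\<close>, whatever triangle it was taken from. Points with coordinate 0 are left
  to the convention in \<open>side\<close>.\<close>

lemma side_iff:
  assumes V: "V \<in> T" "c \<in> V"
  shows "0 < bary V c q \<Longrightarrow> side (V - {c}) q = side (V - {c}) c"
    and "bary V c q < 0 \<Longrightarrow> side (V - {c}) q \<noteq> side (V - {c}) c"
proof -
  define E where "E = V - {c}"
  have "V = insert c E" "c \<notin> E" using V by (auto simp: E_def)
  then have "\<exists>f W d. W \<in> T \<and> W = insert d E \<and> d \<notin> E \<and> f = bary W d" using V(1) by blast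
  from someI_ex[OF this] obtain W d where
    W: "W \<in> T" "W = insert d E" "d \<notin> E" "side_form E = bary W d"
    unfolding side_form_def by blast
  define k where "k = side_form E c"
  have k: "k \<noteq> 0" "side_form E q = bary V c q * k" for q
    unfolding k_def W(4)
    using bary_opposite[OF V(1) W(1) _ W(2) _ W(3), of c] bary_opposite_nonzero[OF V(1) W(1) _ W(2) _ W(3), of c]
      \<open>V = insert c E\<close> \<open>c \<notin> E\<close> by blast+
  have "side E q \<longleftrightarrow> 0 \<le> bary V c q * k" by (simp only: side_def k(2))
  moreover have "side E c \<longleftrightarrow> 0 \<le> k" by (simp only: side_def k_def)
  ultimately show "0 < bary V c q \<Longrightarrow> side (V - {c}) q = side (V - {c}) c"
    "bary V c q < 0 \<Longrightarrow> side (V - {c}) q \<noteq> side (V - {c}) c"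
    using k(1) by (auto simp: E_def zero_le_mult_iff)
qed

lemma below_facet_iff:
  assumes V: "V \<in> T" "E \<subseteq> V"
  shows "below E p \<longleftrightarrow> 0 < height V p \<and> (\<forall>v\<in>E. 0 < bary V v p) \<and> (\<forall>v\<in>V - E. bary V v p = 0)"
proof
  assume "below E p"
  then obtain s l where sl: "0 < s" "\<forall>v\<in>E. 0 < l v" "sum l E = 1" "p + s *\<^sub>R u = (\<Sum>v\<in>E. l v *\<^sub>R v)"
    unfolding below_def by blast
  define \<beta> where "\<beta> = (\<lambda>v. if v \<in> E then l v else 0)"
  have "sum \<beta> V = sum \<beta> E" "(\<Sum>v\<in>V. \<beta> v *\<^sub>R v) = (\<Sum>v\<in>E. \<beta> v *\<^sub>R v)"
    by (rule sum.mono_neutral_right; use V(2) finite_V[OF V(1)] in \<open>simp add: \<beta>_def\<close>)+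
  moreover have "sum \<beta> E = sum l E" "(\<Sum>v\<in>E. \<beta> v *\<^sub>R v) = (\<Sum>v\<in>E. l v *\<^sub>R v)"
    by (simp_all add: \<beta>_def)
  ultimately have s: "sum \<beta> V = 1" and eq: "p = (\<Sum>v\<in>V. \<beta> v *\<^sub>R v) - s *\<^sub>R u"
    using sl(3) by (simp_all add: sl(4)[symmetric])
  have "height V p = s" by (rule height_eqI[OF V(1) s eq])
  moreover have "bary V v p = \<beta> v" if "v \<in> V" for v by (rule bary_eqI[OF V(1) s eq that])
  ultimately show "0 < height V p \<and> (\<forall>v\<in>E. 0 < bary V v p) \<and> (\<forall>v\<in>V - E. bary V v p = 0)"
    using sl(1,2) V(2) by (auto simp: \<beta>_def)
next
  assume *: "0 < height V p \<and> (\<forall>v\<in>E. 0 < bary V v p) \<and> (\<forall>v\<in>V - E. bary V v p = 0)"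
  have "(\<Sum>v\<in>V. bary V v p) = (\<Sum>v\<in>E. bary V v p)" "(\<Sum>v\<in>V. bary V v p *\<^sub>R v) = (\<Sum>v\<in>E. bary V v p *\<^sub>R v)"
    by (rule sum.mono_neutral_right; use V(2) finite_V[OF V(1)] * in simp)+
  then have "sum (\<lambda>v. bary V v p) E = 1" "p + height V p *\<^sub>R u = (\<Sum>v\<in>E. bary V v p *\<^sub>R v)"
    using sum_bary[OF V(1), of p] sum_bary_scaled[OF V(1), of p] by simp_all
  then show "below E p"
    unfolding below_def using * by (intro exI[of _ "height V p"] exI[of _ "\<lambda>v. bary V v p"] conjI) auto
qed

text \<open>The left side records whether membership in the prism changes between \<open>p\<close>
  and \<open>q\<close>. It can change only if \<open>p\<close> is on a lateral facet, which is then
  unique, since off the vertex lines two coordinates cannot vanish together; and it changes exactly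
  when \<open>q\<close> is assigned to the other side of this facet.\<close>

lemma eventually_in_prism:
  assumes V: "V \<in> T" and p: "p \<notin> convex hull V" "p \<notin> vertex_lines"
  shows "\<forall>\<^sub>F q in nhds p. (of_bool (in_prism V q) + of_bool (in_prism V p) :: bit) =
    (\<Sum>c\<in>V. of_bool (below (V - {c}) p \<and> side (V - {c}) q \<noteq> side (V - {c}) p))"
proof -
  note fin = finite_V[OF V]
  have bw: "below (V - {c}) p \<longleftrightarrow> 0 < height V p \<and> (\<forall>v\<in>V - {c}. 0 < bary V v p) \<and> bary V c p = 0"
    if "c \<in> V" for c
    using below_facet_iff[OF V, of "V - {c}" p] that by auto
  show ?thesis
  proof (cases "0 < height V p \<and> (\<forall>c\<in>V. 0 \<le> bary V c p)")
    case False
    then have nb: "\<not> below (V - {c}) p" if "c \<in> V" for c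
      using bw[OF that] by (metis DiffI less_imp_le order_refl singletonD)
    \<comment> \<open>Height 0 with all coordinates nonnegative would place \<open>p\<close> on the
      triangle.\<close>
    have "\<exists>c\<in>V. bary V c p < 0" if "\<not> height V p < 0"
    proof (rule ccontr)
      assume "\<not> (\<exists>c\<in>V. bary V c p < 0)"
      then have "\<forall>c\<in>V. 0 \<le> bary V c p" by (auto simp: not_less)
      then show False using False that p(1) mem_convex_hull_iff[OF V, of p] by force
    qed
    then consider "height V p < 0" | c where "c \<in> V" "bary V c p < 0" by blast
    then have "\<not> in_prism V p \<and> (\<forall>\<^sub>F q in nhds p. \<not> in_prism V q)"
    proof cases
      case 1
      have "\<forall>\<^sub>F q in nhds p. height V q < 0" by (rule eventually_neg[OF continuous_height[OF V] 1])
      then have "\<forall>\<^sub>F q in nhds p. \<not> in_prism V q" by eventually_elim (simp add: in_prism_def)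
      then show ?thesis using 1 by (simp add: in_prism_def)
    next
      case 2
      have "\<forall>\<^sub>F q in nhds p. bary V c q < 0" by (rule eventually_neg[OF continuous_bary[OF V 2(1)] 2(2)])
      then have "\<forall>\<^sub>F q in nhds p. \<not> in_prism V q"
        by eventually_elim (use side_iff(2)[OF V 2(1)] 2(1) in \<open>auto simp: in_prism_def\<close>)
      then show ?thesis using side_iff(2)[OF V 2(1)] 2 by (auto simp: in_prism_def)
    qed
    then have np: "\<not> in_prism V p" and nq: "\<forall>\<^sub>F q in nhds p. \<not> in_prism V q" by blast+
    from nq show ?thesis by eventually_elim (simp add: np nb)
  next
    case True
    have hq: "\<forall>\<^sub>F q in nhds p. 0 < height V q"
      using True by (intro eventually_pos[OF continuous_height[OF V]]) simp
    show ?thesis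
    proof (cases "\<exists>c\<in>V. bary V c p = 0")
      case False
      then have pos: "0 < bary V c p" if "c \<in> V" for c
        using True that by (metis order_le_less)
      then have nb: "\<not> below (V - {c}) p" if "c \<in> V" for c
        using bw[OF that] that by (metis less_irrefl)
      have "in_prism V p" using side_iff(1)[OF V] pos True by (simp add: in_prism_def)
      moreover have "\<forall>\<^sub>F q in nhds p. \<forall>c\<in>V. 0 < bary V c q"
        by (intro eventually_ball_finite fin ballI eventually_pos[OF continuous_bary[OF V]] pos)
      then have "\<forall>\<^sub>F q in nhds p. in_prism V q"
        using hq by eventually_elim (use side_iff(1)[OF V] in \<open>simp add: in_prism_def\<close>)
      ultimately show ?thesis
        by (elim eventually_mono) (simp add: nb)
    next
      case ex: True
      then obtain c where c: "c \<in> V" "bary V c p = 0" by blast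
      \<comment> \<open>With a second vanishing coordinate, the line through \<open>p\<close> in
        direction \<open>u\<close> would pass through the remaining vertex \<open>e\<close>.\<close>
      have pos: "0 < bary V d p" if d: "d \<in> V - {c}" for d
      proof (rule ccontr)
        assume "\<not> 0 < bary V d p"
        then have d0: "bary V d p = 0" using True d by force
        have "card (V - {c} - {d}) = 1" using c d card_T[OF V] fin by simp
        then obtain e where e: "V - {c} - {d} = {e}" by (auto simp: card_1_singleton_iff)
        then have Ve: "V = insert c (insert d {e})" using c(1) d by blast
        have dist: "c \<noteq> d" "c \<noteq> e" "d \<noteq> e" using e d by blast+
        have "bary V e p = 1" using sum_bary[OF V, of p] c(2) d0 dist by (simp add: Ve)
        moreover have "p + height V p *\<^sub>R u = (\<Sum>v\<in>V. bary V v p *\<^sub>R v)" by (simp add: sum_bary_scaled[OF V])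
        ultimately have "p + height V p *\<^sub>R u = e"
          using c(2) d0 dist by (simp add: Ve)
        then have "p = e + (- height V p) *\<^sub>R u" by (simp add: algebra_simps)
        moreover have "e \<in> \<Union>T" using V Ve by blast
        ultimately show False using p(2) unfolding vertex_lines_def by blast
      qed
      have bc: "below (V - {c}) p" using bw[OF c(1)] True c(2) pos by blast
      have nb: "\<not> below (V - {d}) p" if "d \<in> V - {c}" for d
        using bw[of d] pos[OF that] that by auto
      have sum: "(\<Sum>d\<in>V. of_bool (below (V - {d}) p \<and> side (V - {d}) q \<noteq> side (V - {d}) p) :: bit)
        = of_bool (side (V - {c}) q \<noteq> side (V - {c}) p)" for q
      proof -
        have "(\<Sum>d\<in>V - {c}. of_bool (below (V - {d}) p \<and> side (V - {d}) q \<noteq> side (V - {d}) p) :: bit) = 0"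
          by (intro sum.neutral ballI) (use nb in simp)
        then show ?thesis using bc by (simp only: sum.remove[OF fin c(1)] add_0_right simp_thms)
      qed
      have ip: "in_prism V q \<longleftrightarrow> side (V - {c}) q = side (V - {c}) c"
        if "0 < height V q" "\<forall>d\<in>V - {c}. 0 < bary V d q" for q
        unfolding in_prism_def using that side_iff(1)[OF V] c(1) by (metis DiffI singletonD)
      have "\<forall>\<^sub>F q in nhds p. \<forall>d\<in>V - {c}. 0 < bary V d q"
        using fin by (intro eventually_ball_finite ballI eventually_pos[OF continuous_bary[OF V]] pos) auto
      then show ?thesis
        using hq
      proof eventually_elim
        case (elim q)
        have "in_prism V p \<longleftrightarrow> side (V - {c}) p = side (V - {c}) c"
          using ip[of p] True pos by blast
        then show ?case unfolding sum ip[OF elim(2,1)] by auto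
      qed
    qed
  qed
qed

text \<open>The number mod 2, weighted by \<open>z\<close>, of the triangles of \<open>T'\<close>
  above \<open>q\<close>. It is taken over \<open>T\<close> for the function itself and over
  \<open>T - {V}\<close> to isolate the jump across \<open>V\<close>.\<close>

definition parity :: "(real ^ 3) set set \<Rightarrow> ((real ^ 3) set \<Rightarrow> bit) \<Rightarrow> real ^ 3 \<Rightarrow> bit" where
  "parity T' z q = (\<Sum>V\<in>T'. z V * of_bool (in_prism V q))"

lemma sum_facets:
  fixes f :: "(real ^ 3) set \<Rightarrow> bit"
  assumes V: "V \<in> T"
  shows "(\<Sum>c\<in>V. f (V - {c})) = (\<Sum>E\<in>{E. E \<subseteq> V \<and> card E = 2}. f E)"
proof (rule sum.reindex_bij_betw)
  note fin = finite_V[OF V]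
  have "inj_on (\<lambda>c. V - {c}) V" by (rule inj_onI) blast
  moreover have "(\<lambda>c. V - {c}) ` V = {E. E \<subseteq> V \<and> card E = 2}"
  proof
    show "(\<lambda>c. V - {c}) ` V \<subseteq> {E. E \<subseteq> V \<and> card E = 2}"
      using fin card_T[OF V] by auto
    show "{E. E \<subseteq> V \<and> card E = 2} \<subseteq> (\<lambda>c. V - {c}) ` V"
    proof clarify
      fix E assume E: "E \<subseteq> V" "card E = 2"
      then have "card (V - E) = 1"
        using card_Diff_subset[OF finite_subset[OF E(1) fin] E(1)] card_T[OF V] by simp
      then obtain c where "V - E = {c}" by (auto simp: card_1_singleton_iff)
      then have "c \<in> V" "E = V - {c}" using E(1) by blast+
      then show "E \<in> (\<lambda>c. V - {c}) ` V" by blast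
    qed
  qed
  ultimately show "bij_betw (\<lambda>c. V - {c}) V {E. E \<subseteq> V \<and> card E = 2}" by (simp add: bij_betw_def)
qed

text \<open>Exchanging sums collects the changes of membership by edges. The change at
  \<open>E\<close> is multiplied by the sum of \<open>z\<close> over the triangles at
  \<open>E\<close>, which the cycle condition makes 0; by \<open>closed\<close>, no triangle at an
  edge above \<open>p\<close> is missing from \<open>T'\<close>.\<close>

lemma eventually_parity:
  assumes z: "z \<in> mod2_cycles T" and T': "T' \<subseteq> T"
    and p: "\<And>V. V \<in> T' \<Longrightarrow> p \<notin> convex hull V" "p \<notin> vertex_lines"
    and closed: "\<And>V E. V \<in> T \<Longrightarrow> E \<subseteq> V \<Longrightarrow> below E p \<Longrightarrow> V \<in> T'"
  shows "\<forall>\<^sub>F q in nhds p. parity T' z q = parity T' z p"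
proof -
  have fin: "finite T'" using finite_T T' finite_subset by blast
  define D where "D = {E. E \<subseteq> \<Union>T \<and> card E = 2}"
  have finD: "finite D" using finite_vertices by (auto simp: D_def)
  have "\<forall>\<^sub>F q in nhds p. \<forall>V\<in>T'. (of_bool (in_prism V q) + of_bool (in_prism V p) :: bit) =
    (\<Sum>c\<in>V. of_bool (below (V - {c}) p \<and> side (V - {c}) q \<noteq> side (V - {c}) p))"
    by (intro eventually_ball_finite fin ballI eventually_in_prism p) (use T' in blast)+
  then show ?thesis
  proof eventually_elim
    case (elim q)
    define f where "f = (\<lambda>E. of_bool (below E p \<and> side E q \<noteq> side E p) :: bit)"
    have f: "of_bool (in_prism V q) + of_bool (in_prism V p) = (\<Sum>E\<in>{E \<in> D. E \<subseteq> V}. f E)" if "V \<in> T'" for V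
    proof -
      have V: "V \<in> T" using that T' by blast
      have "{E. E \<subseteq> V \<and> card E = 2} = {E \<in> D. E \<subseteq> V}" using V by (auto simp: D_def)
      then show ?thesis using elim that sum_facets[OF V, of f] by (simp add: f_def)
    qed
    have "parity T' z q + parity T' z p = (\<Sum>V\<in>T'. z V * (of_bool (in_prism V q) + of_bool (in_prism V p)))"
      by (simp add: parity_def sum.distrib distrib_left)
    also have "\<dots> = (\<Sum>V\<in>T'. \<Sum>E\<in>{E \<in> D. E \<subseteq> V}. z V * f E)"
      by (intro sum.cong refl) (simp only: f sum_distrib_left)
    also have "\<dots> = (\<Sum>E\<in>D. \<Sum>V\<in>{V \<in> T'. E \<subseteq> V}. z V * f E)"
      by (rule sum.swap_restrict[OF fin finD])
    also have "\<dots> = (\<Sum>E\<in>D. (\<Sum>V\<in>{V \<in> T'. E \<subseteq> V}. z V) * f E)"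
      by (simp only: sum_distrib_right)
    also have "\<dots> = 0"
    proof (intro sum.neutral ballI)
      fix E assume E: "E \<in> D"
      show "(\<Sum>V\<in>{V \<in> T'. E \<subseteq> V}. z V) * f E = 0"
      proof (cases "below E p")
        case True
        then have eq: "{V \<in> T'. E \<subseteq> V} = {V \<in> T. E \<subseteq> V}" using closed T' by blast
        have "(\<Sum>V\<in>{V \<in> T. E \<subseteq> V}. z V) = 0" using z E by (simp add: mod2_cycles_def D_def)
        then show ?thesis by (simp only: eq mult_zero_left)
      qed (simp add: f_def)
    qed
    finally show ?case by (simp only: bit_add_eq_0_iff)
  qed
qed

lemma locally_const_parity:
  assumes "z \<in> mod2_cycles T"
  shows "locally_const (parity T z)"
  unfolding locally_const_def
proof
  fix p assume "p \<in> free_space"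
  then show "\<forall>\<^sub>F q in nhds p. parity T z q = parity T z p"
    by (intro eventually_parity[OF assms]) (auto simp: free_space_def)
qed

text \<open>Since \<open>x\<close> has height 0 relative to \<open>V\<close>, it is below no face of
  \<open>V\<close>, and the parity without \<open>V\<close> is constant near \<open>x\<close>. The
  prism of \<open>V\<close> contributes \<open>z V\<close> exactly on the side of positive
  height.\<close>

lemma parity_jump:
  assumes z: "z \<in> mod2_cycles T" and V: "V \<in> T" and x: "x \<in> inner V - vertex_lines"
  shows "\<exists>c. \<forall>\<^sub>F y in nhds x. (0 < height V y \<longrightarrow> parity T z y = c + z V) \<and> (height V y < 0 \<longrightarrow> parity T z y = c)"
proof -
  have "\<forall>\<^sub>F q in nhds x. parity (T - {V}) z q = parity (T - {V}) z x"
  proof (rule eventually_parity[OF z])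
    show "x \<notin> convex hull W" if "W \<in> T - {V}" for W
      using inner_disjoint[OF V, of W x] x that by blast
    show "W \<in> T - {V}" if W: "W \<in> T" "E \<subseteq> W" "below E x" for W E
    proof -
      have "W \<noteq> V" using below_facet_iff[OF W(1,2), of x] W(3) x by (auto simp: inner_def)
      then show ?thesis using W by blast
    qed
  qed (use x in auto)
  moreover have "\<forall>\<^sub>F y in nhds x. \<forall>v\<in>V. 0 < bary V v y"
    by (rule eventually_mono[OF eventually_near_inner[OF V, of x]]) (use x in auto)
  ultimately have "\<forall>\<^sub>F y in nhds x. (0 < height V y \<longrightarrow> parity T z y = parity (T - {V}) z x + z V)
      \<and> (height V y < 0 \<longrightarrow> parity T z y = parity (T - {V}) z x)"
  proof eventually_elim
    case (elim y)
    have "parity T z y = z V * of_bool (in_prism V y) + parity (T - {V}) z y"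
      unfolding parity_def using finite_T V by (rule sum.remove)
    moreover have "side (V - {c}) y = side (V - {c}) c" if "c \<in> V" for c
      by (rule side_iff(1)[OF V that]) (use elim(2) that in blast)
    then have "in_prism V y \<longleftrightarrow> 0 < height V y" by (simp add: in_prism_def)
    ultimately show ?case using elim(1) by (cases "0 < height V y") (simp_all add: add.commute)
  qed
  then show ?thesis by blast
qed


section \<open>A spanning set of cycles\<close>

lemma spanning_cycles:
  "\<exists>W. gf2_span W = mod2_cycles T \<and> finite W \<and> (\<forall>V. card {w \<in> W. w V \<noteq> 0} \<le> 2)"
proof -
  define R where "R = (\<lambda>V p q. p \<in> free_space \<and> q \<in> free_space \<and>
    (\<forall>G x. locally_const G \<longrightarrow> x \<in> inner V - vertex_lines \<longrightarrow>
      (\<forall>\<^sub>F y in nhds x. (0 < height V y \<longrightarrow> G y = G p) \<and> (height V y < 0 \<longrightarrow> G y = G q))))"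
  have "\<exists>p q. R V p q" if V: "V \<in> T" for V
  proof (rule sides[OF V])
    fix p q assume "p \<in> free_space" "q \<in> free_space"
      "\<And>G x. locally_const G \<Longrightarrow> x \<in> inner V - vertex_lines \<Longrightarrow>
        \<forall>\<^sub>F y in nhds x. (0 < height V y \<longrightarrow> G y = G p) \<and> (height V y < 0 \<longrightarrow> G y = G q)"
    then have "R V p q" unfolding R_def by (intro conjI allI impI)
    then show ?thesis by blast
  qed
  then have "\<forall>V\<in>T. \<exists>p q. R V p q" by blast
  then obtain P Q where R: "\<And>V. V \<in> T \<Longrightarrow> R V (P V) (Q V)"
    by metis
  have PQ: "P V \<in> free_space" "Q V \<in> free_space"
    "\<And>G x. locally_const G \<Longrightarrow> x \<in> inner V - vertex_lines \<Longrightarrow>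
      \<forall>\<^sub>F y in nhds x. (0 < height V y \<longrightarrow> G y = G (P V)) \<and> (height V y < 0 \<longrightarrow> G y = G (Q V))"
    if "V \<in> T" for V
    using R[OF that] unfolding R_def by simp_all
  define jump where "jump = (\<lambda>G V. if V \<in> T then G (P V) + G (Q V) else (0::bit))"
  have cycle: "jump G \<in> mod2_cycles T" if G: "locally_const G" for G
  proof -
    have "(\<Sum>V\<in>{V \<in> T. E \<subseteq> V}. jump G V) = 0" if E: "card E = 2" for E
    proof (cases "{V \<in> T. E \<subseteq> V} = {}")
      case False
      have "(\<Sum>V\<in>{V \<in> T. E \<subseteq> V}. G (P V) + G (Q V)) = 0"
        by (rule edge_jump_sum[OF G _ E False]) (rule PQ(3)[OF _ G])
      moreover have "(\<Sum>V\<in>{V \<in> T. E \<subseteq> V}. jump G V) = (\<Sum>V\<in>{V \<in> T. E \<subseteq> V}. G (P V) + G (Q V))"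
        by (intro sum.cong) (auto simp: jump_def)
      ultimately show ?thesis by simp
    next
      case True
      then show ?thesis by (simp only: sum.empty)
    qed
    then show ?thesis by (simp add: mod2_cycles_def gf2_vectors_def jump_def)
  qed
  have all_cycles: "jump (parity T z) = z" if z: "z \<in> mod2_cycles T" for z
  proof
    fix V
    show "jump (parity T z) V = z V"
    proof (cases "V \<in> T")
      case V: True
      obtain x where x: "x \<in> inner V - vertex_lines" using connected_inner(2)[OF V] by blast
      obtain c where c: "\<forall>\<^sub>F y in nhds x. (0 < height V y \<longrightarrow> parity T z y = c + z V) \<and> (height V y < 0 \<longrightarrow> parity T z y = c)"
        using parity_jump[OF z V x] by blast
      have "\<forall>\<^sub>F y in nhds x. (0 < height V y \<longrightarrow> parity T z (P V) = c + z V) \<and> (height V y < 0 \<longrightarrow> parity T z (Q V) = c)"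
        using c PQ(3)[OF V locally_const_parity[OF z] x] by eventually_elim auto
      then obtain e where e: "0 < e" "\<And>y. dist y x < e \<Longrightarrow>
          (0 < height V y \<longrightarrow> parity T z (P V) = c + z V) \<and> (height V y < 0 \<longrightarrow> parity T z (Q V) = c)"
        unfolding eventually_nhds_metric by blast
      obtain s where s: "0 < s" "x + s *\<^sub>R u \<in> ball x e" "x - s *\<^sub>R u \<in> ball x e"
        using small_shift[OF e(1)] by blast
      have "0 < height V (x - s *\<^sub>R u)" "height V (x + s *\<^sub>R u) < 0"
        using height_shift[OF V, of x "- s"] height_shift[OF V, of x s] x s(1) by (auto simp: inner_def)
      then have "parity T z (P V) = c + z V" "parity T z (Q V) = c"
        using e(2)[of "x - s *\<^sub>R u"] e(2)[of "x + s *\<^sub>R u"] s by (auto simp: dist_commute)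
      then show ?thesis using V by (cases c; cases "z V") (simp_all add: jump_def)
    next
      case False
      then show ?thesis using z by (simp add: jump_def mod2_cycles_def gf2_vectors_def)
    qed
  qed
  define region where "region = (\<lambda>p q. of_bool (q \<in> connected_component_set free_space p) :: bit)"
  have region: "locally_const (region p)" for p
    unfolding locally_const_def
  proof
    fix x assume x: "x \<in> free_space"
    let ?C = "connected_component_set free_space x"
    have "\<forall>\<^sub>F q in nhds x. q \<in> ?C"
      using open_free_space x by (intro eventually_nhds_in_open open_connected_component) auto
    then show "\<forall>\<^sub>F q in nhds x. region p q = region p x"
    proof eventually_elim
      case (elim q)
      then have "connected_component free_space x q" by simp
      then have "connected_component free_space p q \<longleftrightarrow> connected_component free_space p x"
        by (metis connected_component_sym connected_component_trans)
      then show ?case by (simp add: region_def)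
    qed
  qed
  have region_eq: "G p = G q" if "locally_const G" "connected_component free_space p q" for G p q
  proof -
    obtain S where "connected S" "S \<subseteq> free_space" "p \<in> S" "q \<in> S"
      using \<open>connected_component free_space p q\<close> unfolding connected_component_def by blast
    with locally_const_connected[OF that(1)] show ?thesis by blast
  qed
  \<comment> \<open>\<open>jump G\<close> depends only on the values of \<open>G\<close> at these
    finitely many points, so their components yield enough generators.\<close>
  define X where "X = P ` T \<union> Q ` T"
  have finX: "finite X" using finite_T by (simp add: X_def)
  have X_free: "X \<subseteq> free_space" using PQ by (auto simp: X_def)
  define W where "W = (\<lambda>p. jump (region p)) ` X"
  have region_cong: "region p = region q" if "connected_component free_space p q" for p q
    unfolding region_def using connected_component_eq[of q free_space p] that by simp
  have "gf2_span W = mod2_cycles T"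
  proof
    show "gf2_span W \<subseteq> mod2_cycles T"
      using cycle region mod2_cycles_subspace by (intro gf2.span_minimal) (auto simp: W_def)
    show "mod2_cycles T \<subseteq> gf2_span W"
    proof
      fix z assume z: "z \<in> mod2_cycles T"
      let ?F = "parity T z"
      \<comment> \<open>Points of one component have the same \<open>region\<close>, so a sum over
        \<open>Y\<close> takes each component once.\<close>
      define Y where "Y = region ` X"
      have finY: "finite Y" using finX by (simp add: Y_def)
      \<comment> \<open>On \<open>X\<close> the parity is the sum of the indicator functions of the
        components where it is 1.\<close>
      have F: "?F x = (\<Sum>G\<in>Y. of_bool (\<exists>p\<in>X. region p = G \<and> ?F p = 1) * G x)"
        if x: "x \<in> X" for x
      proof -
        have self: "region x x = 1" using subsetD[OF X_free x] by (simp add: region_def)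
        have others: "G x = 0" if "G \<in> Y" "G \<noteq> region x" for G
        proof (rule ccontr)
          assume "G x \<noteq> 0"
          moreover obtain p where p: "G = region p" using \<open>G \<in> Y\<close> by (auto simp: Y_def)
          ultimately have "connected_component free_space p x" by (simp add: region_def split: if_splits)
          then show False using region_cong p that by blast
        qed
        have "(\<exists>p\<in>X. region p = region x \<and> ?F p = 1) \<longleftrightarrow> ?F x = 1"
        proof
          assume "\<exists>p\<in>X. region p = region x \<and> ?F p = 1"
          then obtain p where p: "p \<in> X" "region p = region x" "?F p = 1" by blast
          have "region p x = 1" using self p(2) by simp
          then have "connected_component free_space p x" by (simp add: region_def)
          then show "?F x = 1" using region_eq[OF locally_const_parity[OF z]] p(3) by metis
        qed (use x in blast)
        moreover have "(\<Sum>G\<in>Y. of_bool (\<exists>p\<in>X. region p = G \<and> ?F p = 1) * G x) =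
            of_bool (\<exists>p\<in>X. region p = region x \<and> ?F p = 1) * region x x"
          using finY x others by (subst sum.remove[of Y "region x"]) (auto simp: Y_def intro!: sum.neutral)
        ultimately show ?thesis using self by (cases "?F x") simp_all
      qed
      define c where "c = (\<lambda>G. of_bool (\<exists>p\<in>X. region p = G \<and> ?F p = 1) :: bit)"
      have Fc: "?F x = (\<Sum>G\<in>Y. c G * G x)" if "x \<in> X" for x
        using F[OF that] by (simp add: c_def)
      have "z = (\<Sum>G\<in>Y. (\<lambda>V. c G * jump G V))"
      proof
        fix V
        show "z V = (\<Sum>G\<in>Y. (\<lambda>V. c G * jump G V)) V"
        proof (cases "V \<in> T")
          case True
          then have "z V = ?F (P V) + ?F (Q V)" using all_cycles[OF z] by (metis jump_def)
          also have "\<dots> = (\<Sum>G\<in>Y. c G * G (P V)) + (\<Sum>G\<in>Y. c G * G (Q V))"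
            using Fc True by (simp add: X_def)
          finally show ?thesis using True
            by (simp add: gf2_sum_apply jump_def sum.distrib distrib_left)
        next
          case False
          then show ?thesis using z by (simp add: gf2_sum_apply jump_def mod2_cycles_def gf2_vectors_def)
        qed
      qed
      also have "\<dots> \<in> gf2_span W"
        by (intro gf2.span_sum gf2.span_scale gf2.span_base) (auto simp: W_def Y_def)
      finally show "z \<in> gf2_span W" .
    qed
  qed
  moreover have "finite W" using finX by (simp add: W_def)
  moreover have "card {w \<in> W. w V \<noteq> 0} \<le> 2" for V
  proof -
    \<comment> \<open>A generator is nonzero at \<open>V\<close> only if its component contains one
      of the two points beside \<open>V\<close>, and then it is the generator of that point.\<close>
    have "{w \<in> W. w V \<noteq> 0} \<subseteq> {jump (region (P V)), jump (region (Q V))}"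
    proof
      fix w assume "w \<in> {w \<in> W. w V \<noteq> 0}"
      then have w: "w \<in> W" "w V \<noteq> 0" by simp_all
      obtain p where p: "w = jump (region p)" using w(1) by (auto simp: W_def)
      then have "region p (P V) = 1 \<or> region p (Q V) = 1"
        using w(2) by (auto simp: jump_def split: if_splits)
      then have "connected_component free_space p (P V) \<or> connected_component free_space p (Q V)"
        by (simp add: region_def split: if_splits)
      then show "w \<in> {jump (region (P V)), jump (region (Q V))}" using region_cong[of p] p by auto
    qed
    then have "card {w \<in> W. w V \<noteq> 0} \<le> card {jump (region (P V)), jump (region (Q V))}"
      by (intro card_mono) auto
    also have "\<dots> \<le> 2" by (simp add: card_insert_if)
    finally show ?thesis .
  qed
  ultimately show ?thesis by blast
qed

end


section \<open>From representations to 2-bases\<close>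

lemma exists_transversal:
  fixes T :: "(real ^ 3) set set"
  assumes fin: "finite T" and card: "\<And>V. V \<in> T \<Longrightarrow> card V = 3"
  shows "\<exists>u. \<forall>V\<in>T. \<forall>a\<in>V. u \<notin> span ((\<lambda>v. v - a) ` V)"
proof -
  define N where "N = (\<Union>V\<in>T. \<Union>a\<in>V. span ((\<lambda>v. v - a) ` V))"
  have finV: "finite V" if "V \<in> T" for V
    using card[OF that] by (metis card.infinite zero_neq_numeral)
  \<comment> \<open>The direction space of a triangle has dimension at most 2 and is a null set, so
    finitely many of them do not exhaust the space.\<close>
  have "negligible (span ((\<lambda>v. v - a) ` V))" if V: "V \<in> T" "a \<in> V" for V a
  proof (rule negligible_lowdim)
    have fin': "finite ((\<lambda>v. v - a) ` (V - {a}))" using finV[OF V(1)] by simp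
    have "(\<lambda>v. v - a) ` V \<subseteq> span ((\<lambda>v. v - a) ` (V - {a}))"
    proof clarify
      fix v assume "v \<in> V"
      then show "v - a \<in> span ((\<lambda>v. v - a) ` (V - {a}))"
        by (cases "v = a") (auto intro: span_base span_zero)
    qed
    then have "dim ((\<lambda>v. v - a) ` V) \<le> card ((\<lambda>v. v - a) ` (V - {a}))"
      using fin' by (rule dim_le_card)
    also have "\<dots> \<le> card (V - {a})" using finV[OF V(1)] by (intro card_image_le) simp
    also have "\<dots> = 2" using finV[OF V(1)] V card[OF V(1)] by simp
    finally show "dim (span ((\<lambda>v. v - a) ` V)) < DIM(real ^ 3)" by simp
  qed
  then have "negligible N"
    unfolding N_def using fin finV by (intro negligible_Union) auto
  then have "N \<noteq> UNIV" using non_negligible_UNIV by metis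
  then show ?thesis unfolding N_def by blast
qed

text \<open>Two simplices of a complex meet in a common face, whose corners are corners of both;
  this yields the intersection condition of the locale.\<close>

lemma spanning_cycles_in_space:
  fixes \<Delta> :: "(real ^ 3) set set"
  assumes \<Delta>: "geometric_complex \<Delta>"
  shows "\<exists>W. gf2_span W = mod2_cycles (corners ` triangles \<Delta>) \<and> finite W \<and> (\<forall>V. card {w \<in> W. w V \<noteq> 0} \<le> 2)"
proof -
  let ?T = "corners ` triangles \<Delta>"
  have fin: "finite ?T" using \<Delta> by (auto simp: geometric_complex_def triangles_def)
  have tri: "\<sigma> \<in> \<Delta>" "card (corners \<sigma>) = 3" if "\<sigma> \<in> triangles \<Delta>" for \<sigma>
    using triangles_iff_corners[OF \<Delta>] that by blast+
  have card: "card V = 3" if "V \<in> ?T" for V using that tri by blast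
  obtain u where u: "\<forall>V\<in>?T. \<forall>a\<in>V. u \<notin> span ((\<lambda>v. v - a) ` V)"
    using exists_transversal[OF fin card] by blast
  have Int: "convex hull (corners \<sigma>) \<inter> convex hull (corners \<tau>) = convex hull (corners \<sigma> \<inter> corners \<tau>)"
    if \<sigma>\<tau>: "\<sigma> \<in> \<Delta>" "\<tau> \<in> \<Delta>" for \<sigma> \<tau>
  proof
    note s = geometric_complex_corners[OF \<Delta> \<sigma>\<tau>(1)] and t = geometric_complex_corners[OF \<Delta> \<sigma>\<tau>(2)]
    have faces: "\<sigma> \<inter> \<tau> face_of \<sigma>" "\<sigma> \<inter> \<tau> face_of \<tau>"
      using \<Delta> \<sigma>\<tau> unfolding geometric_complex_def by (blast, metis Int_commute)
    then have I: "\<sigma> \<inter> \<tau> \<in> \<Delta>" using \<Delta> \<sigma>\<tau>(1) unfolding geometric_complex_def by blast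
    have "corners (\<sigma> \<inter> \<tau>) \<subseteq> corners \<sigma> \<inter> corners \<tau>"
      using geometric_complex_face_iff[OF \<Delta> _ I] \<sigma>\<tau> faces by blast
    then show "convex hull (corners \<sigma>) \<inter> convex hull (corners \<tau>) \<subseteq> convex hull (corners \<sigma> \<inter> corners \<tau>)"
      using geometric_complex_corners(3)[OF \<Delta> I] s(3) t(3) by (metis hull_mono)
  qed (simp add: hull_mono)
  interpret triangle_family ?T u
  proof
    show "\<not> affine_dependent V" if "V \<in> ?T" for V
      using that tri(1) geometric_complex_corners(2)[OF \<Delta>] by blast
    show "convex hull V \<inter> convex hull W = convex hull (V \<inter> W)" if "V \<in> ?T" "W \<in> ?T" for V W
      using that tri(1) Int by blast
    show "u \<notin> span ((\<lambda>v. v - a) ` V)" if "V \<in> ?T" "a \<in> V" for V a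
      using that u by blast
  qed (rule fin, rule card)
  show ?thesis by (rule spanning_cycles)
qed

text \<open>\<open>\<phi>\<close> takes its values outside \<open>S\<close>, so the entries
  overwritten by puncturing are never read.\<close>

lemma geometric_representation_code:
  assumes "geometric_representation n C \<Delta> S"
  shows "\<exists>\<phi>. \<phi> ` {1..n} \<subseteq> triangles \<Delta> \<and> C = pullback {1..n} (corners \<circ> \<phi>) ` mod2_cycles (corners ` triangles \<Delta>)"
proof -
  obtain \<phi> where \<Delta>: "triangular_configuration \<Delta>" and bij: "bij_betw \<phi> {1..n} (triangles \<Delta> - S)"
    and C: "C = (\<lambda>x i. if i \<in> {1..n} then x (\<phi> i) else 0) ` puncture (config_kernel \<Delta>) S"
    using assms unfolding geometric_representation_def by blast
  have im: "\<phi> ` {1..n} = triangles \<Delta> - S" using bij by (simp add: bij_betw_def)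
  have "C = (\<lambda>x. pullback {1..n} \<phi> (\<lambda>i. if i \<in> S then 0 else x i)) ` config_kernel \<Delta>"
    unfolding C puncture_def image_image pullback_def ..
  also have "\<dots> = (\<lambda>x. pullback {1..n} \<phi> x) ` config_kernel \<Delta>"
  proof (rule image_cong[OF refl])
    fix x
    have "\<phi> i \<notin> S" if "i \<in> {1..n}" for i using im that by blast
    then show "pullback {1..n} \<phi> (\<lambda>i. if i \<in> S then 0 else x i) = pullback {1..n} \<phi> x"
      by (auto simp: pullback_def fun_eq_iff)
  qed
  also have "\<dots> = (\<lambda>z. pullback {1..n} \<phi> (pullback (triangles \<Delta>) corners z)) ` mod2_cycles (corners ` triangles \<Delta>)"
    using \<Delta> by (simp add: config_kernel_eq_pullback triangular_configuration_def image_image)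
  also have "\<dots> = pullback {1..n} (corners \<circ> \<phi>) ` mod2_cycles (corners ` triangles \<Delta>)"
    using im by (intro image_cong refl pullback_comp) blast
  finally show ?thesis using im by blast
qed

lemma corners_triangles_iff:
  assumes "geometric_complex \<Delta>"
  shows "corners ` triangles \<Delta> = {V \<in> abstract_complex \<Delta>. card V = 3}"
  using triangles_iff_corners[OF assms] by (auto simp: abstract_complex_corners)

lemma config_isomorphic_triangles:
  assumes "geometric_complex \<Delta>" "geometric_complex \<Delta>'" "config_isomorphic \<Delta> \<Delta>'"
  shows "\<exists>f. inj_on f (\<Union>(corners ` triangles \<Delta>)) \<and> (`) f ` corners ` triangles \<Delta> = corners ` triangles \<Delta>'"
proof -
  obtain f where bij: "bij_betw f (\<Union>(abstract_complex \<Delta>)) (\<Union>(abstract_complex \<Delta>'))"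
    and im: "(`) f ` abstract_complex \<Delta> = abstract_complex \<Delta>'"
    using assms(3) unfolding config_isomorphic_def by blast
  have inj: "inj_on f (\<Union>(abstract_complex \<Delta>))" using bij by (simp add: bij_betw_def)
  have card: "card (f ` V) = card V" if "V \<in> abstract_complex \<Delta>" for V
    by (rule card_image[OF inj_on_subset[OF inj]]) (use that in blast)
  have "(`) f ` {V \<in> abstract_complex \<Delta>. card V = 3} = {V \<in> abstract_complex \<Delta>'. card V = 3}"
    using card unfolding im[symmetric] by auto
  moreover have "inj_on f (\<Union>{V \<in> abstract_complex \<Delta>. card V = 3})"
    by (rule inj_on_subset[OF inj]) blast
  ultimately show ?thesis unfolding corners_triangles_iff[OF assms(1)] corners_triangles_iff[OF assms(2)]
    by blast
qed

text \<open>Composing pullbacks expresses the code through the cycles of the isomorphic copy in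
  three-space, where a suitable spanning set is known.\<close>

lemma two_basis_if_representation:
  assumes "has_geometric_representation_in TYPE(real ^ 3) n C"
  shows "\<exists>B. two_basis n C B"
proof -
  obtain \<Delta> :: "(nat \<Rightarrow>\<^sub>0 real) set set" and S and \<Delta>' :: "(real ^ 3) set set" where
    rep: "geometric_representation n C \<Delta> S" and \<Delta>': "triangular_configuration \<Delta>'" "config_isomorphic \<Delta> \<Delta>'"
    using assms unfolding has_geometric_representation_in_def embeddable_into_def by blast
  have gc: "geometric_complex \<Delta>" "geometric_complex \<Delta>'"
    using rep \<Delta>'(1) by (simp_all add: geometric_representation_def triangular_configuration_def)
  let ?T = "corners ` triangles \<Delta>" and ?T' = "corners ` triangles \<Delta>'"
  obtain \<phi> where \<phi>: "\<phi> ` {1..n} \<subseteq> triangles \<Delta>" and C: "C = pullback {1..n} (corners \<circ> \<phi>) ` mod2_cycles ?T"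
    using geometric_representation_code[OF rep] by blast
  obtain f where f: "inj_on f (\<Union>?T)" "(`) f ` ?T = ?T'"
    using config_isomorphic_triangles[OF gc \<Delta>'(2)] by blast
  have fin: "finite V" if "V \<in> ?T" for V
    using that geometric_complex_corners(1)[OF gc(1)] by (force simp: triangles_def)
  have "mod2_cycles ?T = pullback ?T ((`) f) ` mod2_cycles ?T'"
    by (rule mod2_cycles_relabel[OF f(1), unfolded f(2)]) (rule fin)
  then have "C = (\<lambda>z. pullback {1..n} (corners \<circ> \<phi>) (pullback ?T ((`) f) z)) ` mod2_cycles ?T'"
    by (simp add: C image_image)
  also have "\<dots> = pullback {1..n} ((`) f \<circ> (corners \<circ> \<phi>)) ` mod2_cycles ?T'"
    using \<phi> by (intro image_cong refl pullback_comp) auto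
  finally have C': "C = pullback {1..n} ((`) f \<circ> (corners \<circ> \<phi>)) ` mod2_cycles ?T'" .
  obtain W where W: "gf2_span W = mod2_cycles ?T'" "finite W" "\<And>V. card {w \<in> W. w V \<noteq> 0} \<le> 2"
    using spanning_cycles_in_space[OF gc(2)] by blast
  show ?thesis
    unfolding C' by (rule two_basis_pullback[OF W])
qed


section \<open>Geometric realizations of abstract complexes\<close>

text \<open>The functions coord give the barycentric coordinates of a point with respect to whichever
  simplex of Ws it lies in; their existence says that Ws is embedded by pos.\<close>

locale realization =
  fixes Ws T :: "'v set set" and pos :: "'v \<Rightarrow> 'a::real_vector" and coord :: "'v \<Rightarrow> 'a \<Rightarrow> real"
  assumes finite_T: "finite T" and nonempty_T: "T \<noteq> {}" and card_T: "V \<in> T \<Longrightarrow> card V = 3"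
    and T_subset: "V \<in> T \<Longrightarrow> \<exists>W\<in>Ws. V \<subseteq> W"
    and finite_W: "W \<in> Ws \<Longrightarrow> finite W"
    and coord_W: "W \<in> Ws \<Longrightarrow> (\<And>v. v \<in> W \<Longrightarrow> 0 \<le> a v) \<Longrightarrow> sum a W = 1 \<Longrightarrow>
      coord w (\<Sum>v\<in>W. a v *\<^sub>R pos v) = (if w \<in> W then a w else 0)"
begin

text \<open>Contains the empty set, in accordance with the convention that it is a face of every
  simplex.\<close>

definition faces :: "'v set set" where
  "faces = {V. \<exists>F\<in>T. V \<subseteq> F}"

definition hull_of :: "'v set \<Rightarrow> 'a set" where
  "hull_of V = convex hull (pos ` V)"

definition complex :: "'a set set" where
  "complex = hull_of ` faces"

lemma finite_T_mem: "V \<in> T \<Longrightarrow> finite V"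
  using card_T by (metis card.infinite zero_neq_numeral)

lemma face_in_W:
  assumes "V \<in> faces"
  obtains W where "W \<in> Ws" "V \<subseteq> W" "finite V"
proof -
  obtain F where "F \<in> T" "V \<subseteq> F" using assms by (auto simp: faces_def)
  moreover obtain W where "W \<in> Ws" "F \<subseteq> W" using T_subset \<open>F \<in> T\<close> by blast
  ultimately show ?thesis using that finite_subset finite_W by (meson subset_trans)
qed

lemma coord_sum:
  assumes V: "V \<in> faces" and a: "\<And>v. v \<in> V \<Longrightarrow> 0 \<le> a v" "sum a V = 1"
  shows "coord w (\<Sum>v\<in>V. a v *\<^sub>R pos v) = (if w \<in> V then a w else 0)"
proof -
  obtain W where W: "W \<in> Ws" "V \<subseteq> W" "finite V" using face_in_W[OF V] .
  define b where "b = (\<lambda>v. if v \<in> V then a v else 0)"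
  have "sum b W = sum b V" "(\<Sum>v\<in>W. b v *\<^sub>R pos v) = (\<Sum>v\<in>V. b v *\<^sub>R pos v)"
    by (rule sum.mono_neutral_right; use W(2) finite_W[OF W(1)] in \<open>simp add: b_def\<close>)+
  moreover have "sum b V = sum a V" "(\<Sum>v\<in>V. b v *\<^sub>R pos v) = (\<Sum>v\<in>V. a v *\<^sub>R pos v)"
    by (simp_all add: b_def)
  moreover have "coord w (\<Sum>v\<in>W. b v *\<^sub>R pos v) = (if w \<in> W then b w else 0)" if "sum b W = 1"
    by (rule coord_W[OF W(1) _ that]) (simp add: b_def a(1))
  ultimately show ?thesis using a(2) W(2) by (auto simp: b_def)
qed

lemma coord_pos:
  assumes "{v} \<in> faces"
  shows "coord w (pos v) = (if w = v then 1 else 0)"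
  using coord_sum[OF assms, of "\<lambda>_. 1" w] by simp

lemma vertex_face: "v \<in> \<Union>faces \<Longrightarrow> {v} \<in> faces"
  unfolding faces_def by blast

lemma inj_pos: "inj_on pos (\<Union>faces)"
proof (rule inj_onI)
  fix v w assume "v \<in> \<Union>faces" "w \<in> \<Union>faces" "pos v = pos w"
  then show "v = w"
    using coord_pos[OF vertex_face, of v v] coord_pos[OF vertex_face, of w v] by (auto split: if_splits)
qed

lemma inj_pos_face: "V \<in> faces \<Longrightarrow> inj_on pos V"
  by (rule inj_on_subset[OF inj_pos]) blast

lemma mem_hull_of:
  assumes V: "V \<in> faces"
  shows "x \<in> hull_of V \<longleftrightarrow> (\<exists>a. (\<forall>v\<in>V. 0 \<le> a v) \<and> sum a V = 1 \<and> x = (\<Sum>v\<in>V. a v *\<^sub>R pos v))"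
proof -
  have fin: "finite V" using face_in_W[OF V] by blast
  note re = sum.reindex[OF inj_pos_face[OF V], unfolded o_def]
  show ?thesis
  proof
    assume "x \<in> hull_of V"
    then obtain c where c: "\<forall>p\<in>pos ` V. 0 \<le> c p" "sum c (pos ` V) = 1" "(\<Sum>p\<in>pos ` V. c p *\<^sub>R p) = x"
      using fin by (auto simp: hull_of_def convex_hull_finite)
    then show "\<exists>a. (\<forall>v\<in>V. 0 \<le> a v) \<and> sum a V = 1 \<and> x = (\<Sum>v\<in>V. a v *\<^sub>R pos v)"
      by (intro exI[of _ "\<lambda>v. c (pos v)"]) (simp add: re)
  next
    assume "\<exists>a. (\<forall>v\<in>V. 0 \<le> a v) \<and> sum a V = 1 \<and> x = (\<Sum>v\<in>V. a v *\<^sub>R pos v)"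
    then obtain a where a: "\<forall>v\<in>V. 0 \<le> a v" "sum a V = 1" "x = (\<Sum>v\<in>V. a v *\<^sub>R pos v)" by blast
    have "(\<Sum>v\<in>V. a v *\<^sub>R pos v) \<in> convex hull (pos ` V)"
      using fin a by (intro convex_sum convex_convex_hull) (auto intro: hull_inc)
    then show "x \<in> hull_of V" by (simp add: a(3) hull_of_def)
  qed
qed

text \<open>A dependency, scaled down and added to the weights of the barycentre, would give a
  second set of nonnegative weights for the same point, but \<open>coord\<close> recovers the
  weights from the point.\<close>

lemma independent_pos:
  assumes V: "V \<in> faces"
  shows "\<not> affine_dependent (pos ` V)"
proof
  assume "affine_dependent (pos ` V)"
  have fin: "finite V" using face_in_W[OF V] by blast
  note re = sum.reindex[OF inj_pos_face[OF V], unfolded o_def]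
  obtain U p where U: "sum U (pos ` V) = 0" "p \<in> pos ` V" "U p \<noteq> 0" "(\<Sum>v\<in>pos ` V. U v *\<^sub>R v) = 0"
    using \<open>affine_dependent (pos ` V)\<close> fin by (auto simp: affine_dependent_explicit_finite)
  define c where "c = (\<lambda>v. U (pos v))"
  obtain w where w: "w \<in> V" "c w \<noteq> 0" using U by (auto simp: c_def)
  have c: "sum c V = 0" "(\<Sum>v\<in>V. c v *\<^sub>R pos v) = 0" using U by (simp_all add: re c_def)
  define k where "k = real (card V)"
  \<comment> \<open>\<open>M\<close> exceeds every \<open>\<bar>c v\<bar>\<close>, which keeps the
    perturbed weights nonnegative.\<close>
  define M where "M = 1 + (\<Sum>v\<in>V. \<bar>c v\<bar>)"
  have k: "0 < k" using w fin by (auto simp: k_def card_gt_0_iff)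
  have M: "0 < M" unfolding M_def by (simp add: add_pos_nonneg sum_nonneg)
  define a where "a = (\<lambda>v. 1 / k + c v / (k * M))"
  have nonneg: "0 \<le> a v" if "v \<in> V" for v
  proof -
    have "\<bar>c v\<bar> \<le> (\<Sum>v\<in>V. \<bar>c v\<bar>)" by (rule member_le_sum) (use that fin in auto)
    then have "- c v \<le> M" unfolding M_def by linarith
    then have "0 \<le> (M + c v) / (k * M)" using k M by simp
    then show ?thesis using k M by (simp add: a_def field_simps)
  qed
  have "sum a V = (\<Sum>v\<in>V. 1 / k) + sum c V / (k * M)"
    by (simp add: a_def sum.distrib sum_divide_distrib)
  then have a1: "sum a V = 1" using k c(1) by (simp add: k_def)
  have "(\<Sum>v\<in>V. a v *\<^sub>R pos v) = (\<Sum>v\<in>V. (1 / k) *\<^sub>R pos v) + (1 / (k * M)) *\<^sub>R (\<Sum>v\<in>V. c v *\<^sub>R pos v)"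
    by (simp add: a_def scaleR_add_left sum.distrib scaleR_sum_right)
  then have eq: "(\<Sum>v\<in>V. a v *\<^sub>R pos v) = (\<Sum>v\<in>V. (1 / k) *\<^sub>R pos v)" using c(2) by simp
  have "coord w (\<Sum>v\<in>V. a v *\<^sub>R pos v) = (if w \<in> V then a w else 0)"
    by (rule coord_sum[OF V]) (use nonneg a1 in auto)
  moreover have "coord w (\<Sum>v\<in>V. (1 / k) *\<^sub>R pos v) = (if w \<in> V then 1 / k else 0)"
    by (rule coord_sum[OF V]) (use k in \<open>auto simp: k_def\<close>)
  ultimately have "a w = 1 / k" using eq w(1) by simp
  then show False using w(2) k M by (simp add: a_def)
qed

lemma corners_hull_of:
  assumes "V \<in> faces"
  shows "corners (hull_of V) = pos ` V"
  unfolding hull_of_def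
  by (rule corners_convex_hull[OF _ independent_pos[OF assms]]) (use face_in_W[OF assms] in blast)

lemma face_of_hull_of:
  assumes "V \<in> faces"
  shows "F face_of hull_of V \<longleftrightarrow> (\<exists>U\<subseteq>V. F = hull_of U)"
proof -
  have "finite (pos ` V)" using face_in_W[OF assms] by blast
  from face_of_simplex_iff[OF this independent_pos[OF assms], of F] show ?thesis
    unfolding hull_of_def by (metis subset_image_iff)
qed

lemma subface: "V \<in> faces \<Longrightarrow> U \<subseteq> V \<Longrightarrow> U \<in> faces"
  unfolding faces_def by blast

text \<open>The coordinates of a common point may be computed in \<open>V\<close> or in
  \<open>W\<close>; hence its weights vanish off the common vertices.\<close>

lemma hull_of_Int:
  assumes V: "V \<in> faces" and W: "W \<in> faces"
  shows "hull_of V \<inter> hull_of W = hull_of (V \<inter> W)"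
proof
  show "hull_of V \<inter> hull_of W \<subseteq> hull_of (V \<inter> W)"
  proof
    fix x assume "x \<in> hull_of V \<inter> hull_of W"
    then have xV: "x \<in> hull_of V" and xW: "x \<in> hull_of W" by simp_all
    obtain a where a: "\<forall>v\<in>V. 0 \<le> a v" "sum a V = 1" "x = (\<Sum>v\<in>V. a v *\<^sub>R pos v)"
      using xV unfolding mem_hull_of[OF V] by auto
    obtain b where b: "\<forall>v\<in>W. 0 \<le> b v" "sum b W = 1" "x = (\<Sum>v\<in>W. b v *\<^sub>R pos v)"
      using xW unfolding mem_hull_of[OF W] by auto
    have ca: "coord w x = (if w \<in> V then a w else 0)" for w
      unfolding a(3) by (rule coord_sum[OF V]) (use a in auto)
    have cb: "coord w x = (if w \<in> W then b w else 0)" for w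
      unfolding b(3) by (rule coord_sum[OF W]) (use b in auto)
    have zero: "a w = 0" if "w \<in> V - V \<inter> W" for w
      using ca[of w] cb[of w] that by simp
    have fin: "finite V" using face_in_W[OF V] by blast
    have "sum a V = sum a (V \<inter> W)" "(\<Sum>v\<in>V. a v *\<^sub>R pos v) = (\<Sum>v\<in>V \<inter> W. a v *\<^sub>R pos v)"
      by (rule sum.mono_neutral_right; use fin zero in auto)+
    then show "x \<in> hull_of (V \<inter> W)"
      unfolding mem_hull_of[OF subface[OF V Int_lower1]] using a by (intro exI[of _ a]) auto
  qed
  show "hull_of (V \<inter> W) \<subseteq> hull_of V \<inter> hull_of W"
    unfolding hull_of_def by (intro Int_greatest hull_mono) auto
qed

lemma geometric_complex: "geometric_complex complex"
  unfolding geometric_complex_def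
proof (intro conjI ballI allI impI)
  have "faces \<subseteq> Pow (\<Union>T)" by (auto simp: faces_def)
  then have "finite faces"
    by (rule finite_subset) (use finite_T finite_T_mem in auto)
  then show "finite complex" by (simp add: complex_def)
  show "\<exists>d. is_simplex d \<sigma>" if \<sigma>: "\<sigma> \<in> complex" for \<sigma>
  proof -
    obtain V where V: "V \<in> faces" "\<sigma> = hull_of V" using \<sigma> by (auto simp: complex_def)
    have "finite (pos ` V)" using face_in_W[OF V(1)] by blast
    from is_simplex_convex_hull[OF this independent_pos[OF V(1)], of "int (card (pos ` V)) - 1"]
    show ?thesis unfolding V(2) hull_of_def by auto
  qed
  show "\<tau> \<in> complex" if \<sigma>\<tau>: "\<sigma> \<in> complex \<and> \<tau> face_of \<sigma>" for \<tau> \<sigma>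
  proof -
    obtain V where V: "V \<in> faces" "\<sigma> = hull_of V" using \<sigma>\<tau> by (auto simp: complex_def)
    then obtain U where "U \<subseteq> V" "\<tau> = hull_of U" using \<sigma>\<tau> face_of_hull_of[OF V(1), of \<tau>] by auto
    then show ?thesis using subface[OF V(1)] by (auto simp: complex_def)
  qed
  show "\<sigma> \<inter> \<tau> face_of \<sigma>" if \<sigma>\<tau>: "\<sigma> \<in> complex \<and> \<tau> \<in> complex" for \<sigma> \<tau>
  proof -
    obtain V W where VW: "V \<in> faces" "\<sigma> = hull_of V" "W \<in> faces" "\<tau> = hull_of W"
      using \<sigma>\<tau> by (auto simp: complex_def)
    have "\<exists>U\<subseteq>V. \<sigma> \<inter> \<tau> = hull_of U"
      unfolding VW(2,4) hull_of_Int[OF VW(1,3)] by blast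
    then show ?thesis unfolding VW(2) face_of_hull_of[OF VW(1)] .
  qed
qed

lemma T_faces: "T \<subseteq> faces"
  unfolding faces_def by blast

lemma card_pos: "V \<in> faces \<Longrightarrow> card (pos ` V) = card V"
  using inj_pos_face by (rule card_image)

lemma triangles_complex: "triangles complex = hull_of ` T"
proof
  show "hull_of ` T \<subseteq> triangles complex"
  proof clarify
    fix V assume V: "V \<in> T"
    then show "hull_of V \<in> triangles complex"
      using triangles_iff_corners[OF geometric_complex, of "hull_of V"] T_faces corners_hull_of[of V]
        card_pos[of V] card_T[OF V] by (auto simp: complex_def)
  qed
  show "triangles complex \<subseteq> hull_of ` T"
  proof
    fix \<sigma> assume "\<sigma> \<in> triangles complex"
    then obtain V where V: "V \<in> faces" "\<sigma> = hull_of V" "card V = 3"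
      using triangles_iff_corners[OF geometric_complex, of \<sigma>] corners_hull_of card_pos
      by (auto simp: complex_def)
    then obtain F where F: "F \<in> T" "V \<subseteq> F" by (auto simp: faces_def)
    then have "V = F" using card_subset_eq[OF finite_T_mem[OF F(1)] F(2)] card_T[OF F(1)] V(3) by simp
    then show "\<sigma> \<in> hull_of ` T" using F V by blast
  qed
qed

lemma triangular_configuration: "triangular_configuration complex"
  unfolding triangular_configuration_def
proof (intro conjI ballI impI)
  show "geometric_complex complex" by (rule geometric_complex)
  show "triangles complex \<noteq> {}" using triangles_complex nonempty_T by simp
  fix \<sigma> assume \<sigma>: "\<sigma> \<in> complex" and max: "\<forall>\<tau>\<in>complex. \<sigma> \<subseteq> \<tau> \<longrightarrow> \<tau> = \<sigma>"
  obtain V F where F: "F \<in> T" "V \<subseteq> F" "\<sigma> = hull_of V" using \<sigma> by (auto simp: complex_def faces_def)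
  have "hull_of F \<in> complex" "\<sigma> \<subseteq> hull_of F"
    using F T_faces by (auto simp: complex_def hull_of_def intro!: hull_mono)
  then have "hull_of F = \<sigma>" using max by simp
  then have "\<sigma> \<in> triangles complex" using F(1) by (auto simp: triangles_complex)
  then show "is_simplex 1 \<sigma> \<or> is_simplex 2 \<sigma>" by (simp add: triangles_def)
qed

lemma abstract_complex_complex: "abstract_complex complex = (`) pos ` faces"
  by (simp add: abstract_complex_corners complex_def image_image corners_hull_of)

lemma corners_triangles: "corners ` triangles complex = (`) pos ` T"
  unfolding triangles_complex image_image
  by (rule image_cong[OF refl]) (rule corners_hull_of[OF subsetD[OF T_faces]])

lemma hull_of_inj: "inj_on hull_of faces"
proof (rule inj_onI)
  fix V W assume VW: "V \<in> faces" "W \<in> faces" "hull_of V = hull_of W"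
  then have "pos ` V = pos ` W" using corners_hull_of by metis
  then show "V = W" using inj_on_image_eq_iff[OF inj_pos, of V W] VW by blast
qed

text \<open>All triangles not chosen by \<open>\<psi>\<close> form the punctured set. By
  \<open>inj\<close>, reading a cycle only at the chosen triangles loses no dimension.\<close>

lemma geometric_representation:
  assumes \<psi>: "\<psi> ` {1..n} \<subseteq> T" "inj_on \<psi> {1..n}"
    and C: "C = pullback {1..n} \<psi> ` mod2_cycles T"
    and inj: "inj_on (pullback {1..n} \<psi>) (mod2_cycles T)"
  shows "geometric_representation n C complex (triangles complex - hull_of ` \<psi> ` {1..n})"
proof -
  let ?\<phi> = "hull_of \<circ> \<psi>" and ?S = "triangles complex - hull_of ` \<psi> ` {1..n}"
  define K where "K = mod2_cycles ((`) pos ` T)"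
  have tri: "hull_of ` \<psi> ` {1..n} \<subseteq> triangles complex"
    using \<psi>(1) by (auto simp: triangles_complex)
  have kernel: "config_kernel complex = pullback (triangles complex) corners ` K"
    using config_kernel_eq_pullback[OF geometric_complex] by (simp add: corners_triangles K_def)
  have cycles: "mod2_cycles T = pullback T ((`) pos) ` K"
    unfolding K_def
    by (rule mod2_cycles_relabel[OF inj_on_subset[OF inj_pos]]) (use T_faces finite_T_mem in auto)
  have comp: "pullback {1..n} ?\<phi> (pullback (triangles complex) corners z) = pullback {1..n} \<psi> (pullback T ((`) pos) z)" for z
  proof -
    have "pullback {1..n} ?\<phi> (pullback (triangles complex) corners z) = pullback {1..n} (corners \<circ> ?\<phi>) z"
      using tri by (intro pullback_comp) auto
    also have "\<dots> = pullback {1..n} ((`) pos \<circ> \<psi>) z"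
    proof -
      have "(corners \<circ> ?\<phi>) i = ((`) pos \<circ> \<psi>) i" if "i \<in> {1..n}" for i
      proof -
        have "\<psi> i \<in> faces" using \<psi>(1) T_faces that by blast
        then show ?thesis by (simp add: corners_hull_of)
      qed
      then show ?thesis by (simp add: pullback_def fun_eq_iff)
    qed
    also have "\<dots> = pullback {1..n} \<psi> (pullback T ((`) pos) z)"
      using \<psi>(1) by (intro pullback_comp[symmetric])
    finally show ?thesis .
  qed
  have C': "C = pullback {1..n} ?\<phi> ` config_kernel complex"
    unfolding C cycles kernel image_image comp ..
  have notS: "?\<phi> i \<notin> ?S" if "i \<in> {1..n}" for i using that by auto
  have "bij_betw ?\<phi> {1..n} (triangles complex - ?S)"
  proof -
    have "inj_on ?\<phi> {1..n}"
      using \<psi> T_faces hull_of_inj by (intro comp_inj_on inj_on_subset[OF hull_of_inj]) auto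
    moreover have "?\<phi> ` {1..n} = triangles complex - ?S"
      using tri by (auto simp: image_comp)
    ultimately show ?thesis by (simp add: bij_betw_def)
  qed
  moreover have "C = (\<lambda>x i. if i \<in> {1..n} then x (?\<phi> i) else 0) ` puncture (config_kernel complex) ?S"
  proof -
    have "(\<lambda>x i. if i \<in> {1..n} then x (?\<phi> i) else 0) ` puncture (config_kernel complex) ?S
      = (\<lambda>x. pullback {1..n} ?\<phi> (\<lambda>i. if i \<in> ?S then 0 else x i)) ` config_kernel complex"
      unfolding puncture_def image_image pullback_def ..
    also have "\<dots> = pullback {1..n} ?\<phi> ` config_kernel complex"
    proof (rule image_cong[OF refl])
      fix x :: "'a set \<Rightarrow> bit"
      show "pullback {1..n} ?\<phi> (\<lambda>i. if i \<in> ?S then 0 else x i) = pullback {1..n} ?\<phi> x"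
        unfolding pullback_def fun_eq_iff using notS by (metis (no_types))
    qed
    finally show ?thesis using C' by simp
  qed
  moreover have "gf2_dim C = gf2_dim (config_kernel complex)"
    unfolding C'
  proof (rule gf2_dim_image[OF gf2_linear_pullback])
    have "gf2_span K = K"
      unfolding gf2.span_eq_iff K_def by (rule mod2_cycles_subspace)
    then have "gf2_span (config_kernel complex) = config_kernel complex"
      by (simp only: kernel gf2_span_image[OF gf2_linear_pullback])
    then show "gf2_subspace (config_kernel complex)" by (simp add: gf2.span_eq_iff)
    show "inj_on (pullback {1..n} ?\<phi>) (config_kernel complex)"
    proof (rule inj_onI)
      fix x y assume x: "x \<in> config_kernel complex" and y: "y \<in> config_kernel complex"
        and eq: "pullback {1..n} ?\<phi> x = pullback {1..n} ?\<phi> y"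
      obtain z where z: "z \<in> K" "x = pullback (triangles complex) corners z"
        using x unfolding kernel by (rule imageE)
      obtain z' where z': "z' \<in> K" "y = pullback (triangles complex) corners z'"
        using y unfolding kernel by (rule imageE)
      have "pullback T ((`) pos) z = pullback T ((`) pos) z'"
      proof (rule inj_onD[OF inj])
        show "pullback {1..n} \<psi> (pullback T ((`) pos) z) = pullback {1..n} \<psi> (pullback T ((`) pos) z')"
          using eq unfolding z(2) z'(2) comp .
      qed (use z(1) z'(1) cycles in simp_all)
      from fun_cong[OF this] have *: "z (pos ` V) = z' (pos ` V)" if "V \<in> T" for V
        using that unfolding pullback_def by meson
      have "z (corners t) = z' (corners t)" if "t \<in> triangles complex" for t
      proof -
        have "corners t \<in> (`) pos ` T" using corners_triangles that by blast
        then obtain V where "corners t = pos ` V" "V \<in> T" by (rule imageE)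
        then show ?thesis using * by simp
      qed
      then show "x = y" unfolding z(2) z'(2) pullback_def by (intro ext) simp
    qed
  qed
  ultimately show ?thesis
    unfolding geometric_representation_def using triangular_configuration by blast
qed

end

text \<open>Each vertex is sent from one position to the other; simplices correspond because both
  complexes have the same abstract faces.\<close>

lemma config_isomorphic_realizations:
  assumes "realization Ws T pos coord" "realization Ws T pos' coord'"
  shows "config_isomorphic (realization.complex T pos) (realization.complex T pos')"
proof -
  interpret r: realization Ws T pos coord by fact
  interpret r': realization Ws T pos' coord' by fact
  define f where "f = pos' \<circ> inv_into (\<Union>r.faces) pos"
  have f: "f (pos v) = pos' v" if "v \<in> \<Union>r.faces" for v
    using that r.inj_pos by (simp add: f_def)
  have fV: "f ` pos ` V = pos' ` V" if "V \<in> r.faces" for V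
    unfolding image_image by (rule image_cong[OF refl]) (rule f, use that in blast)
  have "bij_betw f (pos ` \<Union>r.faces) (pos' ` \<Union>r.faces)"
  proof (rule bij_betwI')
    show "f x = f y \<longleftrightarrow> x = y" if x: "x \<in> pos ` \<Union>r.faces" and y: "y \<in> pos ` \<Union>r.faces" for x y
    proof -
      obtain v where v: "x = pos v" "v \<in> \<Union>r.faces" using x by (rule imageE)
      obtain w where w: "y = pos w" "w \<in> \<Union>r.faces" using y by (rule imageE)
      show ?thesis
        unfolding v(1) w(1) f[OF v(2)] f[OF w(2)] inj_on_eq_iff[OF r.inj_pos v(2) w(2)]
        by (rule inj_on_eq_iff[OF r'.inj_pos v(2) w(2)])
    qed
    show "f x \<in> pos' ` \<Union>r.faces" if "x \<in> pos ` \<Union>r.faces" for x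
      using that f by auto
    show "\<exists>x\<in>pos ` \<Union>r.faces. y = f x" if "y \<in> pos' ` \<Union>r.faces" for y
      using that f by auto
  qed
  moreover have "(`) f ` (`) pos ` r.faces = (`) pos' ` r.faces"
    unfolding image_image[of "(`) f"] by (rule image_cong[OF refl]) (rule fV)
  ultimately show ?thesis
    unfolding config_isomorphic_def r.abstract_complex_complex r'.abstract_complex_complex
    by (intro exI[of _ f]) (simp add: image_Union)
qed


section \<open>Pyramids over the strips of a grid\<close>

text \<open>\<open>Lower j\<close> and \<open>Upper i\<close> are the apices of the pyramids below
  row strip \<open>j\<close> and above column strip \<open>i\<close>.\<close>

datatype vert = Grid nat nat | Lower nat | Upper nat

definition first_half :: "(nat \<Rightarrow> nat \<Rightarrow> 'v) \<Rightarrow> nat \<Rightarrow> nat \<Rightarrow> 'v set" where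
  "first_half g i j = {g i j, g (Suc i) j, g (Suc i) (Suc j)}"

definition second_half :: "(nat \<Rightarrow> nat \<Rightarrow> 'v) \<Rightarrow> nat \<Rightarrow> nat \<Rightarrow> 'v set" where
  "second_half g i j = {g i j, g i (Suc j), g (Suc i) (Suc j)}"

text \<open>The tetrahedra into which the pyramids are cut. Every triangle of the construction is a
  face of one of them, so it suffices to embed these.\<close>

definition cells :: "vert set set" where
  "cells = (\<Union>i j. {insert (Lower j) (first_half Grid i j), insert (Lower j) (second_half Grid i j),
     insert (Upper i) (first_half Grid i j), insert (Upper i) (second_half Grid i j)})"

text \<open>For L = 1 this is the piecewise linear function on the triangulated grid that is 1 at the
  origin and 0 at all other grid points; it is homogenised because the horizontal section of a
  pyramid is a scaled copy of its base.\<close>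

definition hat :: "real \<Rightarrow> real \<Rightarrow> real \<Rightarrow> real" where
  "hat L x y = max 0 (L - max \<bar>x\<bar> (max \<bar>y\<bar> \<bar>x - y\<bar>))"

lemma hat_commute: "hat L x y = hat L y x"
  by (simp add: hat_def max.left_commute max.commute abs_minus_commute)

text \<open>\<open>di\<close> and \<open>dj\<close> locate the cell relative to the grid point, and
  \<open>(a, b)\<close> is a point of the first half of a square of side \<open>L\<close>. The three
  nonzero expressions are its barycentric weights at the corners, scaled to the sum
  \<open>L\<close>.\<close>

lemma hat_first:
  fixes di dj :: int
  assumes "0 \<le> b" "b \<le> a" "a \<le> L"
  shows "hat L (L * di + a) (L * dj + b) =
    (if di = 0 \<and> dj = 0 then L - a else if di = -1 \<and> dj = 0 then a - b
     else if di = -1 \<and> dj = -1 then b else 0)"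
proof -
  have L: "0 \<le> L" using assms by simp
  have up: "L \<le> L * k" if "1 \<le> k" for k :: int
    using mult_left_mono[of 1 "real_of_int k" L] that L by simp
  have down: "L * k \<le> - 2 * L" if "k \<le> -2" for k :: int
  proof -
    have "real_of_int k \<le> -2" using that by linarith
    from mult_left_mono[OF this L] show ?thesis by simp
  qed
  have zero: "hat L x y = 0" if "L \<le> \<bar>x\<bar> \<or> L \<le> \<bar>y\<bar> \<or> L \<le> \<bar>x - y\<bar>" for x y
    using that unfolding hat_def le_max_iff_disj[symmetric] by simp
  have val: "hat L x y = L - m" if "\<bar>x\<bar> \<le> m" "\<bar>y\<bar> \<le> m" "\<bar>x - y\<bar> \<le> m" "m \<le> L"
    "m = \<bar>x\<bar> \<or> m = \<bar>y\<bar> \<or> m = \<bar>x - y\<bar>" for x y m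
  proof -
    have "max \<bar>x\<bar> (max \<bar>y\<bar> \<bar>x - y\<bar>) = m"
      using that(1-3,5) by (intro antisym) (auto simp only: le_max_iff_disj max.bounded_iff)
    then show ?thesis using that(4) by (simp add: hat_def)
  qed
  \<comment> \<open>Only the offsets 0 and -1 keep both coordinates within distance
    \<open>L\<close>. The last case is the corner that belongs to the second half only.\<close>
  consider "1 \<le> di" | "di \<le> -2" | "1 \<le> dj" | "dj \<le> -2" | "di = 0" "dj = 0" | "di = -1" "dj = 0"
    | "di = -1" "dj = -1" | "di = 0" "dj = -1"
    by linarith
  then show ?thesis
  proof cases
    case 1
    then have "hat L (L * di + a) (L * dj + b) = 0" using up[OF 1] assms by (intro zero disjI1) linarith
    then show ?thesis using 1 by simp
  next
    case 2
    then have "hat L (L * di + a) (L * dj + b) = 0" using down[OF 2] assms by (intro zero disjI1) linarith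
    then show ?thesis using 2 by simp
  next
    case 3
    then have "hat L (L * di + a) (L * dj + b) = 0" using up[OF 3] assms by (intro zero disjI2 disjI1) linarith
    then show ?thesis using 3 by simp
  next
    case 4
    then have "hat L (L * di + a) (L * dj + b) = 0" using down[OF 4] assms by (intro zero disjI2 disjI1) linarith
    then show ?thesis using 4 by simp
  next
    case 5
    have "hat L a b = L - a" by (rule val) (use assms in auto)
    then show ?thesis using 5 by simp
  next
    case 6
    have "hat L (a - L) b = L - (L - a + b)" by (rule val) (use assms in auto)
    then show ?thesis using 6 by simp
  next
    case 7
    have "hat L (a - L) (b - L) = L - (L - b)" by (rule val) (use assms in auto)
    then show ?thesis using 7 by simp
  next
    case 8
    have "hat L a (b - L) = 0" by (rule zero) (use assms in auto)
    then show ?thesis using 8 by simp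
  qed
qed

lemma hat_second:
  fixes di dj :: int
  assumes "0 \<le> a" "a \<le> b" "b \<le> L"
  shows "hat L (L * di + a) (L * dj + b) =
    (if di = 0 \<and> dj = 0 then L - b else if di = 0 \<and> dj = -1 then b - a
     else if di = -1 \<and> dj = -1 then a else 0)"
proof -
  have "hat L (L * di + a) (L * dj + b) = hat L (L * dj + b) (L * di + a)" by (rule hat_commute)
  also have "\<dots> = (if dj = 0 \<and> di = 0 then L - b else if dj = -1 \<and> di = 0 then b - a
     else if dj = -1 \<and> di = -1 then a else 0)"
    by (rule hat_first[OF assms])
  finally show ?thesis by (simp only: conj_commute)
qed

section \<open>Embedding the tetrahedra\<close>

locale frame =
  fixes e1 e2 e3 :: "'a::real_vector" and X Y Z :: "'a \<Rightarrow> real"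
  assumes linear_XYZ: "linear X" "linear Y" "linear Z"
    and dual: "X e1 = 1" "X e2 = 0" "X e3 = 0" "Y e1 = 0" "Y e2 = 1" "Y e3 = 0" "Z e1 = 0" "Z e2 = 0" "Z e3 = 1"
begin

text \<open>Each apex is placed over or under the middle of its strip. At distance
  \<open>c > 0\<close> from the grid plane the section of a pyramid thus keeps distance at least
  \<open>c / 2\<close> from the long borders of the strip, and pyramids on the same side meet only
  in the grid plane.\<close>

fun place :: "vert \<Rightarrow> 'a" where
  "place (Grid i j) = real i *\<^sub>R e1 + real j *\<^sub>R e2"
| "place (Lower j) = (real j + 1/2) *\<^sub>R e2 - e3"
| "place (Upper i) = (real i + 1/2) *\<^sub>R e1 + e3"

lemmas coordinates = linear_add[OF linear_XYZ(1)] linear_add[OF linear_XYZ(2)] linear_add[OF linear_XYZ(3)]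
  linear_diff[OF linear_XYZ(1)] linear_diff[OF linear_XYZ(2)] linear_diff[OF linear_XYZ(3)]
  linear_scale[OF linear_XYZ(1)] linear_scale[OF linear_XYZ(2)] linear_scale[OF linear_XYZ(3)] dual

text \<open>Projection from the apex: subtracting the share of the apex leaves the base point scaled
  by \<open>1 - \<bar>Z P\<bar>\<close>. The floor identifies the strip and with it the
  apex.\<close>

definition base_x :: "'a \<Rightarrow> real" where
  "base_x P = (if 0 < Z P then X P - Z P * (of_int \<lfloor>X P\<rfloor> + 1/2) else X P)"

definition base_y :: "'a \<Rightarrow> real" where
  "base_y P = (if Z P < 0 then Y P + Z P * (of_int \<lfloor>Y P\<rfloor> + 1/2) else Y P)"

fun coord :: "vert \<Rightarrow> 'a \<Rightarrow> real" where
  "coord (Grid k l) P = hat (1 - \<bar>Z P\<bar>) (base_x P - (1 - \<bar>Z P\<bar>) * real k) (base_y P - (1 - \<bar>Z P\<bar>) * real l)"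
| "coord (Lower k) P = (if Z P < 0 \<and> \<lfloor>Y P\<rfloor> = int k then - Z P else 0)"
| "coord (Upper k) P = (if 0 < Z P \<and> \<lfloor>X P\<rfloor> = int k then Z P else 0)"

lemma coord_lower_pyramid:
  assumes "0 \<le> c" "c \<le> 1" "0 \<le> b" "b \<le> 1 - c"
    and P: "Z P = - c" "X P = (1 - c) * real i + a" "Y P = real j + c / 2 + b"
  shows "coord (Lower k) P = (if k = j then c else 0)" "coord (Upper k) P = 0"
    "coord (Grid k l) P = hat (1 - c) ((1 - c) * (int i - int k) + a) ((1 - c) * (int j - int l) + b)"
proof -
  \<comment> \<open>Only for \<open>c > 0\<close>: in the grid plane the point may lie on the far
    border of the strip, where the floor is \<open>j + 1\<close>; there the apex has no
    share.\<close>
  have fl: "\<lfloor>Y P\<rfloor> = int j" if "0 < c"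
    unfolding P by (rule floor_unique) (use assms that in auto)
  show "coord (Lower k) P = (if k = j then c else 0)"
    using fl assms(1) by (cases "0 < c") (auto simp: P(1))
  show "coord (Upper k) P = 0" using assms(1) by (simp add: P(1))
  have "base_y P = (1 - c) * real j + b"
  proof (cases "0 < c")
    case True
    have "base_y P = Y P - c * (real j + 1/2)" using fl[OF True] True by (simp add: base_y_def P(1))
    then show ?thesis unfolding P(3) by (simp add: algebra_simps)
  next
    case False
    then have "c = 0" using assms(1) by simp
    then show ?thesis using P by (simp add: base_y_def)
  qed
  moreover have "base_x P = (1 - c) * real i + a" using assms(1) P by (simp add: base_x_def)
  ultimately have "base_x P - (1 - c) * real k = (1 - c) * (int i - int k) + a"
    "base_y P - (1 - c) * real l = (1 - c) * (int j - int l) + b"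
    by (simp_all add: right_diff_distrib)
  moreover have "\<bar>Z P\<bar> = c" using assms(1) P(1) by simp
  ultimately show "coord (Grid k l) P = hat (1 - c) ((1 - c) * (int i - int k) + a) ((1 - c) * (int j - int l) + b)"
    by (simp only: coord.simps)
qed

lemma coord_upper_pyramid:
  assumes "0 \<le> c" "c \<le> 1" "0 \<le> a" "a \<le> 1 - c"
    and P: "Z P = c" "X P = real i + c / 2 + a" "Y P = (1 - c) * real j + b"
  shows "coord (Upper k) P = (if k = i then c else 0)" "coord (Lower k) P = 0"
    "coord (Grid k l) P = hat (1 - c) ((1 - c) * (int i - int k) + a) ((1 - c) * (int j - int l) + b)"
proof -
  have fl: "\<lfloor>X P\<rfloor> = int i" if "0 < c"
    unfolding P by (rule floor_unique) (use assms that in auto)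
  show "coord (Upper k) P = (if k = i then c else 0)"
    using fl assms(1) by (cases "0 < c") (auto simp: P(1))
  show "coord (Lower k) P = 0" using assms(1) by (simp add: P(1))
  have "base_x P = (1 - c) * real i + a"
  proof (cases "0 < c")
    case True
    have "base_x P = X P - c * (real i + 1/2)" using fl[OF True] True by (simp add: base_x_def P(1))
    then show ?thesis unfolding P(2) by (simp add: algebra_simps)
  next
    case False
    then have "c = 0" using assms(1) by simp
    then show ?thesis using P by (simp add: base_x_def)
  qed
  moreover have "base_y P = (1 - c) * real j + b" using assms(1) P by (simp add: base_y_def)
  ultimately have "base_x P - (1 - c) * real k = (1 - c) * (int i - int k) + a"
    "base_y P - (1 - c) * real l = (1 - c) * (int j - int l) + b"
    by (simp_all add: right_diff_distrib)
  moreover have "\<bar>Z P\<bar> = c" using assms(1) P(1) by simp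
  ultimately show "coord (Grid k l) P = hat (1 - c) ((1 - c) * (int i - int k) + a) ((1 - c) * (int j - int l) + b)"
    by (simp only: coord.simps)
qed

text \<open>The same functions recover the barycentric weights in all tetrahedra, so two tetrahedra
  agree on the weights of a common point. This is the embedding.\<close>

lemma coord_cells:
  assumes W: "W \<in> cells" and nonneg: "\<And>v. v \<in> W \<Longrightarrow> 0 \<le> a v" and sum: "sum a W = 1"
  shows "coord w (\<Sum>v\<in>W. a v *\<^sub>R place v) = (if w \<in> W then a w else 0)"
proof -
  define P where "P = (\<Sum>v\<in>W. a v *\<^sub>R place v)"
  obtain i j where "W = insert (Lower j) (first_half Grid i j) \<or> W = insert (Lower j) (second_half Grid i j) \<or>
    W = insert (Upper i) (first_half Grid i j) \<or> W = insert (Upper i) (second_half Grid i j)"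
    using W by (auto simp: cells_def)
  then consider (1) "W = {Lower j, Grid i j, Grid (Suc i) j, Grid (Suc i) (Suc j)}"
    | (2) "W = {Lower j, Grid i j, Grid i (Suc j), Grid (Suc i) (Suc j)}"
    | (3) "W = {Upper i, Grid i j, Grid (Suc i) j, Grid (Suc i) (Suc j)}"
    | (4) "W = {Upper i, Grid i j, Grid i (Suc j), Grid (Suc i) (Suc j)}"
    by (auto simp: first_half_def second_half_def)
  then have "coord w P = (if w \<in> W then a w else 0)"
  proof cases
    case 1
    \<comment> \<open>\<open>c\<close> is the share of the apex; \<open>x\<close> and
      \<open>y\<close> are the offsets in the section of the cell, a square of side
      \<open>1 - c\<close>. The other cases differ in the half of the cell and in the side of the
      plane.\<close>
    define c x y where "c = a (Lower j)" and "x = a (Grid (Suc i) j) + a (Grid (Suc i) (Suc j))"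
      and "y = a (Grid (Suc i) (Suc j))"
    have s: "a (Grid i j) = 1 - c - x" using sum unfolding 1 by (simp add: c_def x_def)
    have nn: "0 \<le> c" "0 \<le> y" "y \<le> x" "x \<le> 1 - c"
      using nonneg[of "Lower j"] nonneg[of "Grid i j"] nonneg[of "Grid (Suc i) j"] nonneg[of "Grid (Suc i) (Suc j)"] s
      unfolding 1 c_def x_def y_def by auto
    have Q: "Z P = - c" "X P = (1 - c) * real i + x" "Y P = real j + c / 2 + y"
      unfolding P_def 1 by (simp_all add: coordinates s c_def x_def y_def algebra_simps)
    have bounds: "c \<le> 1" "0 \<le> y" "y \<le> 1 - c" using nn by simp_all
    note co = coord_lower_pyramid[of c y P i x j, OF nn(1) bounds Q]
    show ?thesis
    proof (cases w)
      case (Grid k l)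
      have eqs: "int i - int k = 0 \<longleftrightarrow> k = i" "int i - int k = -1 \<longleftrightarrow> k = Suc i"
        "int j - int l = 0 \<longleftrightarrow> l = j" "int j - int l = -1 \<longleftrightarrow> l = Suc j" by auto
      have "coord w P = (if k = i \<and> l = j then 1 - c - x else if k = Suc i \<and> l = j then x - y
        else if k = Suc i \<and> l = Suc j then y else 0)"
        unfolding Grid co(3) hat_first[OF nn(2-4)] eqs ..
      also have "\<dots> = (if w \<in> W then a w else 0)"
        unfolding Grid 1 s[symmetric] by (auto simp: x_def y_def)
      finally show ?thesis .
    qed (auto simp: 1 co c_def simp del: coord.simps)
  next
    case 2
    define c y x where "c = a (Lower j)" and "y = a (Grid i (Suc j)) + a (Grid (Suc i) (Suc j))"
      and "x = a (Grid (Suc i) (Suc j))"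
    have s: "a (Grid i j) = 1 - c - y" using sum unfolding 2 by (simp add: c_def y_def)
    have nn: "0 \<le> c" "0 \<le> x" "x \<le> y" "y \<le> 1 - c"
      using nonneg[of "Lower j"] nonneg[of "Grid i j"] nonneg[of "Grid i (Suc j)"] nonneg[of "Grid (Suc i) (Suc j)"] s
      unfolding 2 c_def x_def y_def by auto
    have Q: "Z P = - c" "X P = (1 - c) * real i + x" "Y P = real j + c / 2 + y"
      unfolding P_def 2 by (simp_all add: coordinates s c_def x_def y_def algebra_simps)
    have bounds: "c \<le> 1" "0 \<le> y" "y \<le> 1 - c" using nn by simp_all
    note co = coord_lower_pyramid[of c y P i x j, OF nn(1) bounds Q]
    show ?thesis
    proof (cases w)
      case (Grid k l)
      have eqs: "int i - int k = 0 \<longleftrightarrow> k = i" "int i - int k = -1 \<longleftrightarrow> k = Suc i"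
        "int j - int l = 0 \<longleftrightarrow> l = j" "int j - int l = -1 \<longleftrightarrow> l = Suc j" by auto
      have "coord w P = (if k = i \<and> l = j then 1 - c - y else if k = i \<and> l = Suc j then y - x
        else if k = Suc i \<and> l = Suc j then x else 0)"
        unfolding Grid co(3) hat_second[OF nn(2-4)] eqs ..
      also have "\<dots> = (if w \<in> W then a w else 0)"
        unfolding Grid 2 s[symmetric] by (auto simp: x_def y_def)
      finally show ?thesis .
    qed (auto simp: 2 co c_def simp del: coord.simps)
  next
    case 3
    define c x y where "c = a (Upper i)" and "x = a (Grid (Suc i) j) + a (Grid (Suc i) (Suc j))"
      and "y = a (Grid (Suc i) (Suc j))"
    have s: "a (Grid i j) = 1 - c - x" using sum unfolding 3 by (simp add: c_def x_def)
    have nn: "0 \<le> c" "0 \<le> y" "y \<le> x" "x \<le> 1 - c"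
      using nonneg[of "Upper i"] nonneg[of "Grid i j"] nonneg[of "Grid (Suc i) j"] nonneg[of "Grid (Suc i) (Suc j)"] s
      unfolding 3 c_def x_def y_def by auto
    have Q: "Z P = c" "X P = real i + c / 2 + x" "Y P = (1 - c) * real j + y"
      unfolding P_def 3 by (simp_all add: coordinates s c_def x_def y_def algebra_simps)
    have bounds: "c \<le> 1" "0 \<le> x" "x \<le> 1 - c" using nn by simp_all
    note co = coord_upper_pyramid[of c x P i j y, OF nn(1) bounds Q]
    show ?thesis
    proof (cases w)
      case (Grid k l)
      have eqs: "int i - int k = 0 \<longleftrightarrow> k = i" "int i - int k = -1 \<longleftrightarrow> k = Suc i"
        "int j - int l = 0 \<longleftrightarrow> l = j" "int j - int l = -1 \<longleftrightarrow> l = Suc j" by auto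
      have "coord w P = (if k = i \<and> l = j then 1 - c - x else if k = Suc i \<and> l = j then x - y
        else if k = Suc i \<and> l = Suc j then y else 0)"
        unfolding Grid co(3) hat_first[OF nn(2-4)] eqs ..
      also have "\<dots> = (if w \<in> W then a w else 0)"
        unfolding Grid 3 s[symmetric] by (auto simp: x_def y_def)
      finally show ?thesis .
    qed (auto simp: 3 co c_def simp del: coord.simps)
  next
    case 4
    define c y x where "c = a (Upper i)" and "y = a (Grid i (Suc j)) + a (Grid (Suc i) (Suc j))"
      and "x = a (Grid (Suc i) (Suc j))"
    have s: "a (Grid i j) = 1 - c - y" using sum unfolding 4 by (simp add: c_def y_def)
    have nn: "0 \<le> c" "0 \<le> x" "x \<le> y" "y \<le> 1 - c"
      using nonneg[of "Upper i"] nonneg[of "Grid i j"] nonneg[of "Grid i (Suc j)"] nonneg[of "Grid (Suc i) (Suc j)"] s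
      unfolding 4 c_def x_def y_def by auto
    have Q: "Z P = c" "X P = real i + c / 2 + x" "Y P = (1 - c) * real j + y"
      unfolding P_def 4 by (simp_all add: coordinates s c_def x_def y_def algebra_simps)
    have bounds: "c \<le> 1" "0 \<le> x" "x \<le> 1 - c" using nn by simp_all
    note co = coord_upper_pyramid[of c x P i j y, OF nn(1) bounds Q]
    show ?thesis
    proof (cases w)
      case (Grid k l)
      have eqs: "int i - int k = 0 \<longleftrightarrow> k = i" "int i - int k = -1 \<longleftrightarrow> k = Suc i"
        "int j - int l = 0 \<longleftrightarrow> l = j" "int j - int l = -1 \<longleftrightarrow> l = Suc j" by auto
      have "coord w P = (if k = i \<and> l = j then 1 - c - y else if k = i \<and> l = Suc j then y - x
        else if k = Suc i \<and> l = Suc j then x else 0)"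
        unfolding Grid co(3) hat_second[OF nn(2-4)] eqs ..
      also have "\<dots> = (if w \<in> W then a w else 0)"
        unfolding Grid 4 s[symmetric] by (auto simp: x_def y_def)
      finally show ?thesis .
    qed (auto simp: 4 co c_def simp del: coord.simps)
  qed
  then show ?thesis by (simp add: P_def)
qed

lemma realization:
  assumes "finite T" "T \<noteq> {}" "\<And>V. V \<in> T \<Longrightarrow> card V = 3" "\<And>V. V \<in> T \<Longrightarrow> \<exists>W\<in>cells. V \<subseteq> W"
  shows "realization cells T place coord"
proof
  show "finite W" if "W \<in> cells" for W
    using that by (auto simp: cells_def first_half_def second_half_def)
  show "coord w (\<Sum>v\<in>W. a v *\<^sub>R place v) = (if w \<in> W then a w else 0)"
    if "W \<in> cells" "\<And>v. v \<in> W \<Longrightarrow> 0 \<le> a v" "sum a W = 1" for W a w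
    using coord_cells[OF that] .
qed (use assms in auto)

end

lemma frame_vec:
  "frame (axis 1 1) (axis 2 1) (axis 3 1 :: real ^ 3) (\<lambda>p. p $ 1) (\<lambda>p. p $ 2) (\<lambda>p. p $ 3)"
proof -
  have "linear (\<lambda>p :: real ^ 3. p $ k)" for k by (rule linearI) simp_all
  then show ?thesis by unfold_locales (auto simp: axis_def)
qed

lemma lookup_scaleR:
  fixes x :: "nat \<Rightarrow>\<^sub>0 real"
  shows "Poly_Mapping.lookup (r *\<^sub>R x) k = r *\<^sub>R Poly_Mapping.lookup x k"
proof -
  let ?f = "\<lambda>i. r *\<^sub>R Poly_Mapping.lookup x i"
  have "finite {i. ?f i \<noteq> 0}"
    by (rule finite_subset[OF _ finite_lookup[of x]]) auto
  then have "Poly_Mapping.lookup (Abs_poly_mapping ?f) = ?f"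
    by (intro Abs_poly_mapping_inverse CollectI)
  then show ?thesis by (simp only: scaleR_poly_mapping_def)
qed

lemma frame_poly_mapping:
  "frame (Poly_Mapping.single 0 1) (Poly_Mapping.single 1 1) (Poly_Mapping.single 2 1 :: nat \<Rightarrow>\<^sub>0 real)
    (\<lambda>p. Poly_Mapping.lookup p 0) (\<lambda>p. Poly_Mapping.lookup p 1) (\<lambda>p. Poly_Mapping.lookup p 2)"
proof -
  have "linear (\<lambda>p :: nat \<Rightarrow>\<^sub>0 real. Poly_Mapping.lookup p k)" for k
    by (rule linearI) (simp_all add: Poly_Mapping.lookup_add lookup_scaleR)
  note linear = this
  show ?thesis
    by (rule frame.intro; (rule linear)?) (simp_all del: single_one add: Poly_Mapping.lookup_single when_def)
qed


section \<open>Cycles of the pyramids\<close>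

text \<open>The support of the boundary of the chain \<open>D\<close> over GF(2);
  \<open>pyramid\<close> closes \<open>D\<close> by a cone over it.\<close>

definition odd_edges :: "'v set set \<Rightarrow> 'v set set" where
  "odd_edges D = {E. card E = 2 \<and> (\<Sum>V\<in>{V \<in> D. E \<subseteq> V}. 1 :: bit) = 1}"

definition pyramid :: "'v \<Rightarrow> 'v set set \<Rightarrow> 'v set set" where
  "pyramid a D = D \<union> insert a ` odd_edges D"

lemma odd_edges_subset: "E \<in> odd_edges D \<Longrightarrow> \<exists>V\<in>D. E \<subseteq> V"
proof (rule ccontr)
  assume E: "E \<in> odd_edges D" and "\<not> (\<exists>V\<in>D. E \<subseteq> V)"
  then have "{V \<in> D. E \<subseteq> V} = {}" by blast
  then have "(\<Sum>V\<in>{V \<in> D. E \<subseteq> V}. 1 :: bit) = 0" by (simp only: sum.empty)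
  then show False using E by (simp add: odd_edges_def)
qed

text \<open>Each vertex of a triple lies in exactly two of its pairs; in other words, the boundary
  of a triangle is a cycle.\<close>

lemma two_subsets_of_triple:
  assumes "card V = 3" "x \<in> V"
  shows "(\<Sum>F\<in>{F. card F = 2 \<and> x \<in> F \<and> F \<subseteq> V}. 1 :: bit) = 0"
proof -
  have "finite V" using assms(1) by (metis card.infinite zero_neq_numeral)
  then have "card (V - {x}) = 2" using assms by simp
  then obtain y w where yw: "V - {x} = {y, w}" "y \<noteq> w" by (auto simp: card_2_iff)
  then have V: "V = {x, y, w}" "x \<noteq> y" "x \<noteq> w" using assms(2) by auto
  have "F = {x, y} \<or> F = {x, w}" if F: "card F = 2" "x \<in> F" "F \<subseteq> V" for F
  proof -
    have "card (F - {x}) = 1" using F(1,2) by simp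
    then obtain v where "F - {x} = {v}" by (auto simp: card_1_singleton_iff)
    then have "F = {x, v}" "v \<in> V - {x}" using F by auto
    then show ?thesis using yw(1) by auto
  qed
  then have "{F. card F = 2 \<and> x \<in> F \<and> F \<subseteq> V} = {{x, y}, {x, w}}"
    using V by auto
  moreover have "{x, y} \<noteq> {x, w}" using V yw(2) by (auto simp: doubleton_eq_iff)
  ultimately show ?thesis by simp
qed

text \<open>The pyramid over a chain D is the sum of the boundaries of the tetrahedra spanned by the apex and
  the triangles of D.\<close>

lemma pyramid_cycle:
  assumes fin: "finite D" and card: "\<And>V. V \<in> D \<Longrightarrow> card V = 3" and a: "\<And>V. V \<in> D \<Longrightarrow> a \<notin> V"
    and E: "card E = 2"
  shows "(\<Sum>V\<in>{V \<in> pyramid a D. E \<subseteq> V}. 1 :: bit) = 0"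
proof -
  have finV: "finite V" if "V \<in> D" for V
    using card[OF that] by (metis card.infinite zero_neq_numeral)
  define R where "R = odd_edges D"
  have finU: "finite (\<Union>D)" using fin finV by auto
  have R_sub: "R \<subseteq> Pow (\<Union>D)" using odd_edges_subset unfolding R_def by fastforce
  have finR: "finite R" using finite_subset[OF R_sub] finU by simp
  have aR: "a \<notin> F" if "F \<in> R" for F using R_sub a that by blast
  have finE: "finite E" using E by (metis card.infinite zero_neq_numeral)
  show ?thesis
  proof (cases "a \<in> E")
    case False
    \<comment> \<open>Away from the apex, the triangles at \<open>E\<close> are those of
      \<open>D\<close> and, precisely when their number is odd, the cone triangle on
      \<open>E\<close>.\<close>
    have sub: "E \<subseteq> insert a F \<longleftrightarrow> E = F" if F: "F \<in> R" for F
    proof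
      assume "E \<subseteq> insert a F"
      then have "E \<subseteq> F" using False by blast
      moreover have "card F = 2" using F by (simp add: R_def odd_edges_def)
      moreover from this have "finite F" by (metis card.infinite zero_neq_numeral)
      ultimately show "E = F" using card_subset_eq E by metis
    qed blast
    have split: "{V \<in> pyramid a D. E \<subseteq> V} = {V \<in> D. E \<subseteq> V} \<union> insert a ` {F \<in> R. E = F}"
      using sub by (auto simp: pyramid_def R_def[symmetric])
    have "{V \<in> D. E \<subseteq> V} \<inter> insert a ` {F \<in> R. E = F} = {}" using a by blast
    then have "(\<Sum>V\<in>{V \<in> pyramid a D. E \<subseteq> V}. 1 :: bit)
      = (\<Sum>V\<in>{V \<in> D. E \<subseteq> V}. 1) + (\<Sum>V\<in>insert a ` {F \<in> R. E = F}. 1)"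
      unfolding split using fin finR by (intro sum.union_disjoint) auto
    also have "(\<Sum>V\<in>insert a ` {F \<in> R. E = F}. 1 :: bit) = (\<Sum>V\<in>{V \<in> D. E \<subseteq> V}. 1)"
    proof (cases "E \<in> R")
      case True
      then have "{F \<in> R. E = F} = {E}" by blast
      then show ?thesis using True by (simp add: R_def odd_edges_def)
    next
      case notin: False
      then have "{F \<in> R. E = F} = {}" by blast
      moreover have "(\<Sum>V\<in>{V \<in> D. E \<subseteq> V}. 1 :: bit) = 0"
        using notin E unfolding R_def odd_edges_def mem_Collect_eq bit_not_one_iff[symmetric] by blast
      ultimately show ?thesis by (simp only: image_empty sum.empty)
    qed
    finally show ?thesis by (simp only: bit_add_self)
  next
    case True
    \<comment> \<open>At an edge \<open>{a, x}\<close> the cone triangles correspond to the odd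
      edges at \<open>x\<close>. Double counting reduces their parity to
      \<open>two_subsets_of_triple\<close>.\<close>
    have "card (E - {a}) = 1" using True E by simp
    then obtain x where "E - {a} = {x}" by (auto simp: card_1_singleton_iff)
    then have x: "E = {a, x}" "x \<noteq> a" using True by auto
    define P where "P = {F. F \<subseteq> \<Union>D \<and> card F = 2 \<and> x \<in> F}"
    have finP: "finite P" using finU by (simp add: P_def)
    have eq: "{V \<in> pyramid a D. E \<subseteq> V} = insert a ` {F \<in> P. F \<in> R}"
    proof -
      have "\<not> E \<subseteq> V" if "V \<in> D" for V using a[OF that] x(1) by blast
      then have "{V \<in> pyramid a D. E \<subseteq> V} = insert a ` {F \<in> R. E \<subseteq> insert a F}"
        unfolding pyramid_def R_def[symmetric] by blast
      also have "{F \<in> R. E \<subseteq> insert a F} = {F \<in> P. F \<in> R}"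
      proof -
        have "E \<subseteq> insert a F \<longleftrightarrow> F \<in> P" if F: "F \<in> R" for F
        proof -
          have "card F = 2" "F \<subseteq> \<Union>D" using F R_sub by (auto simp: R_def odd_edges_def)
          then show ?thesis using x by (simp add: P_def)
        qed
        then show ?thesis by blast
      qed
      finally show ?thesis .
    qed
    have "inj_on (insert a) {F \<in> P. F \<in> R}" 
      by (rule inj_onI) (use insert_ident[OF aR aR] in simp)
    then have "(\<Sum>V\<in>{V \<in> pyramid a D. E \<subseteq> V}. 1 :: bit) = (\<Sum>F\<in>{F \<in> P. F \<in> R}. 1)"
      unfolding eq by (subst sum.reindex) simp_all
    also have "\<dots> = (\<Sum>F\<in>P. if F \<in> R then 1 else 0)"
      using finP by (rule sum.inter_filter)
    also have "\<dots> = (\<Sum>F\<in>P. \<Sum>V\<in>{V \<in> D. F \<subseteq> V}. 1)"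
    proof (rule sum.cong[OF refl])
      fix F assume "F \<in> P"
      then have "card F = 2" by (simp add: P_def)
      define t where "t = (\<Sum>V\<in>{V \<in> D. F \<subseteq> V}. 1 :: bit)"
      have "F \<in> R \<longleftrightarrow> t = 1"
        unfolding R_def odd_edges_def t_def using \<open>card F = 2\<close> by (intro iffI CollectI conjI) (drule CollectD, erule conjunct2)
      then show "(if F \<in> R then 1 else 0 :: bit) = (\<Sum>V\<in>{V \<in> D. F \<subseteq> V}. 1)"
        unfolding t_def[symmetric] by (cases t) simp_all
    qed
    also have "\<dots> = (\<Sum>V\<in>D. \<Sum>F\<in>{F \<in> P. F \<subseteq> V}. 1)"
      by (rule sum.swap_restrict[OF finP fin])
    also have "\<dots> = 0"
    proof (rule sum.neutral, rule ballI)
      fix V assume V: "V \<in> D"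
      show "(\<Sum>F\<in>{F \<in> P. F \<subseteq> V}. 1 :: bit) = 0"
      proof (cases "x \<in> V")
        case True
        have "{F \<in> P. F \<subseteq> V} = {F. card F = 2 \<and> x \<in> F \<and> F \<subseteq> V}"
          using V by (auto simp: P_def)
        then show ?thesis using two_subsets_of_triple[OF card[OF V] True] by (simp only:)
      next
        case False
        then have "{F \<in> P. F \<subseteq> V} = {}" by (auto simp: P_def)
        then show ?thesis by (simp only: sum.empty)
      qed
    qed
    finally show ?thesis .
  qed
qed

section \<open>Strips of cells and their boundaries\<close>

definition strip :: "(nat \<Rightarrow> nat \<Rightarrow> 'v) \<Rightarrow> nat \<Rightarrow> nat \<Rightarrow> 'v set set" where
  "strip g k L = (\<Union>i<L. {first_half g i k, second_half g i k})"

definition strip_boundary :: "(nat \<Rightarrow> nat \<Rightarrow> 'v) \<Rightarrow> nat \<Rightarrow> nat \<Rightarrow> 'v set set" where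
  "strip_boundary g k L = (\<Union>i<L. {{g i k, g (Suc i) k}, {g i (Suc k), g (Suc i) (Suc k)}})
    \<union> {{g 0 k, g 0 (Suc k)}, {g L k, g L (Suc k)}}"

text \<open>The results apply to row strips through \<open>Grid\<close> and to column strips through
  \<open>transposed\<close>.\<close>

locale grid =
  fixes g :: "nat \<Rightarrow> nat \<Rightarrow> 'v"
  assumes g_eq [simp]: "g x y = g x' y' \<longleftrightarrow> x = x' \<and> y = y'"
begin

lemma finite_strip: "finite (strip g k L)"
  by (simp add: strip_def)

lemma card_strip: "V \<in> strip g k L \<Longrightarrow> card V = 3"
  by (auto simp: strip_def first_half_def second_half_def)

text \<open>Induction on the length: a new cell adds two long edges, its diagonal cancels, and it
  replaces the old end by a new one. The two ends are added, not joined by a disjunction, so that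
  they cancel for \<open>L = 0\<close>.\<close>

lemma strip_parity:
  assumes E: "card E = 2"
  shows "(\<Sum>V\<in>{V \<in> strip g k L. E \<subseteq> V}. 1 :: bit) =
    of_bool (\<exists>i<L. E = {g i k, g (Suc i) k} \<or> E = {g i (Suc k), g (Suc i) (Suc k)})
    + (of_bool (E = {g 0 k, g 0 (Suc k)}) + of_bool (E = {g L k, g L (Suc k)}))"
proof (induction L)
  case 0
  have "{V \<in> strip g k 0. E \<subseteq> V} = {}" by (simp add: strip_def)
  then show ?case by (simp only: sum.empty) simp
next
  case (Suc L)
  have sub: "E \<subseteq> {p, q, r} \<longleftrightarrow> E = {p, q} \<or> E = {q, r} \<or> E = {p, r}" if "p \<noteq> q" "q \<noteq> r" "p \<noteq> r" for p q r
  proof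
    assume "E \<subseteq> {p, q, r}"
    moreover obtain s t where "E = {s, t}" "s \<noteq> t" using E by (auto simp: card_2_iff)
    ultimately show "E = {p, q} \<or> E = {q, r} \<or> E = {p, r}" by auto
  qed auto
  define A B where "A = first_half g L k" and "B = second_half g L k"
  have new: "A \<notin> strip g k L" "B \<notin> strip g k L" "A \<noteq> B"
  proof -
    have "g (Suc L) (Suc k) \<notin> V" if "V \<in> strip g k L" for V
      using that by (auto simp: strip_def first_half_def second_half_def)
    then show "A \<notin> strip g k L" "B \<notin> strip g k L" by (auto simp: A_def B_def first_half_def second_half_def)
    have "g (Suc L) k \<in> A" "g (Suc L) k \<notin> B" by (auto simp: A_def B_def first_half_def second_half_def)
    then show "A \<noteq> B" by blast
  qed
  have S: "strip g k (Suc L) = insert A (insert B (strip g k L))"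
    by (auto simp: strip_def A_def B_def lessThan_Suc)
  have filter: "(\<Sum>V\<in>{V \<in> strip g k l. E \<subseteq> V}. 1 :: bit) = (\<Sum>V\<in>strip g k l. if E \<subseteq> V then 1 else 0)" for l
    using finite_strip by (rule sum.inter_filter)
  have step: "(\<Sum>V\<in>{V \<in> strip g k (Suc L). E \<subseteq> V}. 1 :: bit) =
    (if E \<subseteq> A then 1 else 0) + ((if E \<subseteq> B then 1 else 0) + (\<Sum>V\<in>{V \<in> strip g k L. E \<subseteq> V}. 1))"
  proof -
    have "A \<notin> insert B (strip g k L)" using new by blast
    then show ?thesis
      unfolding filter unfolding S using new(2) finite_strip[of k L] by (simp only: sum.insert finite_insert not_False_eq_True)
  qed
  define h h' v v' d where "h = {g L k, g (Suc L) k}" and "h' = {g L (Suc k), g (Suc L) (Suc k)}"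
    and "v = {g L k, g L (Suc k)}" and "v' = {g (Suc L) k, g (Suc L) (Suc k)}"
    and "d = {g L k, g (Suc L) (Suc k)}"
  have A: "E \<subseteq> A \<longleftrightarrow> E = h \<or> E = v' \<or> E = d"
    unfolding A_def first_half_def h_def v'_def d_def by (rule sub) simp_all
  have B: "E \<subseteq> B \<longleftrightarrow> E = v \<or> E = h' \<or> E = d"
    unfolding B_def second_half_def h'_def v_def d_def by (rule sub) simp_all
  have distinct: "h \<noteq> v'" "h \<noteq> d" "v' \<noteq> d" "v \<noteq> h'" "v \<noteq> d" "h' \<noteq> d" "h \<noteq> h'" "h \<noteq> v" "v' \<noteq> v" "h' \<noteq> v'"
    by (auto simp: h_def h'_def v_def v'_def d_def doubleton_eq_iff)
  define Q where "Q = (\<lambda>L. \<exists>i<L. E = {g i k, g (Suc i) k} \<or> E = {g i (Suc k), g (Suc i) (Suc k)})"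
  have Qx: "(\<exists>i<l. E = {g i k, g (Suc i) k} \<or> E = {g i (Suc k), g (Suc i) (Suc k)}) \<longleftrightarrow> Q l" for l
    by (simp add: Q_def)
  have Q: "Q (Suc L) \<longleftrightarrow> Q L \<or> E = h \<or> E = h'" unfolding Q_def h_def h'_def less_Suc_eq by blast
  have old: "\<not> Q L" if "E = h \<or> E = h'"
  proof
    assume "Q L"
    then have "g (Suc L) k \<notin> E \<and> g (Suc L) (Suc k) \<notin> E" by (auto simp: Q_def)
    then show False using that by (auto simp: h_def h'_def)
  qed
  show ?case
    unfolding step Suc.IH Qx v_def[symmetric] v'_def[symmetric] A B Q
    using distinct old
    by (cases "E = h"; cases "E = h'"; cases "E = v"; cases "E = v'"; cases "E = d"; cases "Q L";
        cases "E = {g 0 k, g 0 (Suc k)}") simp_all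
qed

lemma odd_edges_strip:
  assumes "0 < L"
  shows "odd_edges (strip g k L) = strip_boundary g k L"
proof (rule set_eqI)
  fix E
  show "E \<in> odd_edges (strip g k L) \<longleftrightarrow> E \<in> strip_boundary g k L"
  proof (cases "card E = 2")
    case True
    define Q where "Q \<longleftrightarrow> (\<exists>i<L. E = {g i k, g (Suc i) k} \<or> E = {g i (Suc k), g (Suc i) (Suc k)})"
    have mem: "E \<in> strip_boundary g k L \<longleftrightarrow> Q \<or> E = {g 0 k, g 0 (Suc k)} \<or> E = {g L k, g L (Suc k)}"
      by (auto simp: strip_boundary_def Q_def)
    have "{g 0 k, g 0 (Suc k)} \<noteq> {g L k, g L (Suc k)}" using assms by (auto simp: doubleton_eq_iff)
    moreover have "\<not> Q" if "E = {g x k, g x (Suc k)}" for x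
      using that by (auto simp: Q_def doubleton_eq_iff)
    ultimately show ?thesis
      unfolding mem odd_edges_def mem_Collect_eq strip_parity[OF True] Q_def[symmetric] using True
      by (cases Q; cases "E = {g 0 k, g 0 (Suc k)}"; cases "E = {g L k, g L (Suc k)}") simp_all
  next
    case False
    have "card E = 2" if "E \<in> strip_boundary g k L" using that by (auto simp: strip_boundary_def)
    then show ?thesis using False by (auto simp: odd_edges_def)
  qed
qed

text \<open>The boundary is a closed polygon and each of its vertices lies on exactly two edges, so
  the vanishing sums carry the value from edge to edge.\<close>

lemma constant_on_boundary:
  fixes e :: "'v set \<Rightarrow> bit"
  assumes L: "0 < L" and e: "\<And>x. (\<Sum>E\<in>{E \<in> strip_boundary g k L. x \<in> E}. e E) = 0"
    and E: "E \<in> strip_boundary g k L"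
  shows "e E = e {g 0 k, g 0 (Suc k)}"
proof -
  define H where "H = (\<lambda>y i. {g i y, g (Suc i) y})"
  define v0 vL where "v0 = {g 0 k, g 0 (Suc k)}" and "vL = {g L k, g L (Suc k)}"
  have pair: "e F = e F'" if "{E \<in> strip_boundary g k L. x \<in> E} = {F, F'}" "F \<noteq> F'" for x F F'
    using e[of x] that by (simp add: bit_add_eq_0_iff)
  have start: "e (H y 0) = e v0" if "y = k \<or> y = Suc k" for y
  proof (rule pair)
    show "{E \<in> strip_boundary g k L. g 0 y \<in> E} = {H y 0, v0}"
      using that L by (auto simp: strip_boundary_def H_def v0_def)
    show "H y 0 \<noteq> v0" using that by (auto simp: H_def v0_def doubleton_eq_iff)
  qed
  have step: "e (H y (Suc i)) = e (H y i)" if "y = k \<or> y = Suc k" "Suc i < L" for y i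
  proof (rule pair)
    show "{E \<in> strip_boundary g k L. g (Suc i) y \<in> E} = {H y (Suc i), H y i}"
      using that by (auto simp: strip_boundary_def H_def)
    show "H y (Suc i) \<noteq> H y i" by (auto simp: H_def doubleton_eq_iff)
  qed
  have all: "e (H y i) = e v0" if "y = k \<or> y = Suc k" "i < L" for y i
    using that(2) by (induction i) (use start[OF that(1)] step[OF that(1)] in auto)
  have last: "e vL = e (H k (L - 1))"
  proof (rule pair)
    obtain l where l: "L = Suc l" using L by (cases L) auto
    show "{E \<in> strip_boundary g k L. g L k \<in> E} = {vL, H k (L - 1)}"
      by (auto simp: strip_boundary_def H_def vL_def l)
    show "vL \<noteq> H k (L - 1)" by (auto simp: H_def vL_def doubleton_eq_iff)
  qed
  have "E = v0 \<or> E = vL \<or> (\<exists>i<L. \<exists>y. (y = k \<or> y = Suc k) \<and> E = H y i)"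
    using E by (auto simp: strip_boundary_def v0_def vL_def H_def)
  then show ?thesis
    using all last L unfolding v0_def[symmetric] by auto
qed

end


section \<open>The complex of all pyramids\<close>

abbreviation transposed :: "nat \<Rightarrow> nat \<Rightarrow> vert" where
  "transposed x y \<equiv> Grid y x"

interpretation row: grid Grid
  by unfold_locales simp

interpretation column: grid transposed
  by unfold_locales auto

definition lower_pyramid :: "nat \<Rightarrow> nat \<Rightarrow> vert set set" where
  "lower_pyramid N j = pyramid (Lower j) (strip Grid j N)"

definition upper_pyramid :: "nat \<Rightarrow> nat \<Rightarrow> vert set set" where
  "upper_pyramid M i = pyramid (Upper i) (strip transposed i M)"

definition all_pyramids :: "nat \<Rightarrow> nat \<Rightarrow> vert set set" where
  "all_pyramids N M = (\<Union>j<M. lower_pyramid N j) \<union> (\<Union>i<N. upper_pyramid M i)"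

text \<open>The general combination of the pyramids, regarded as cycles, with coefficients
  \<open>\<zeta>\<close> below and \<open>\<xi>\<close> above the grid. Both halves of the cell
  \<open>(i, j)\<close> receive \<open>\<zeta> j + \<xi> i\<close>.\<close>

definition chain :: "nat \<Rightarrow> nat \<Rightarrow> (nat \<Rightarrow> bit) \<Rightarrow> (nat \<Rightarrow> bit) \<Rightarrow> vert set \<Rightarrow> bit" where
  "chain N M \<zeta> \<xi> V = (\<Sum>j<M. if V \<in> lower_pyramid N j then \<zeta> j else 0)
    + (\<Sum>i<N. if V \<in> upper_pyramid M i then \<xi> i else 0)"

lemma strip_transposed: "strip transposed i M = (\<Union>j<M. {first_half Grid i j, second_half Grid i j})"
  by (auto simp: strip_def first_half_def second_half_def)

lemma half_bounds:
  assumes "V = first_half Grid i j \<or> V = second_half Grid i j"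
  shows "Grid i j \<in> V" "v \<in> V \<Longrightarrow> \<exists>a b. v = Grid a b \<and> i \<le> a \<and> j \<le> b" 
  using assms by (auto simp: first_half_def second_half_def)

text \<open>\<open>Grid i j\<close> is the smallest corner of either half in both coordinates, so a
  half determines its cell.\<close>

lemma half_eq_imp:
  assumes "V = first_half Grid i j \<or> V = second_half Grid i j"
    and "V = first_half Grid i' j' \<or> V = second_half Grid i' j'"
  shows "i = i'" "j = j'"
  using half_bounds(2)[OF assms(1) half_bounds(1)[OF assms(2)]]
    half_bounds(2)[OF assms(2) half_bounds(1)[OF assms(1)]] by auto

lemma first_half_neq_second_half: "first_half Grid i j \<noteq> second_half Grid i' j'"
proof
  assume eq: "first_half Grid i j = second_half Grid i' j'"
  then have "i = i'" "j = j'" using half_eq_imp[of "first_half Grid i j" i j i' j'] by auto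
  moreover have "Grid (Suc i) j \<in> first_half Grid i j" by (simp add: first_half_def)
  ultimately show False using eq by (simp add: second_half_def)
qed

lemma boundary_grid: "E \<in> strip_boundary Grid j N \<or> E \<in> strip_boundary transposed i M \<Longrightarrow> v \<in> E \<Longrightarrow> \<exists>a b. v = Grid a b"
  by (auto simp: strip_boundary_def)

lemma boundary_card:
  "E \<in> strip_boundary Grid j N \<or> E \<in> strip_boundary transposed i M \<Longrightarrow> card E = 2"
  by (auto simp: strip_boundary_def)

text \<open>The link of the apex is the boundary polygon of the strip: the cycle condition at
  \<open>{a, x}\<close> is the hypothesis of \<open>constant_on_boundary\<close> at
  \<open>x\<close>.\<close>

lemma cycle_on_cone:
  assumes z: "z \<in> mod2_cycles T" and g: "grid g" and a: "\<And>x y. a \<noteq> g x y" and L: "0 < L"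
    and sub: "insert a ` strip_boundary g k L \<subseteq> T"
    and only: "\<And>V. V \<in> T \<Longrightarrow> a \<in> V \<Longrightarrow> V \<in> insert a ` strip_boundary g k L"
    and E: "E \<in> strip_boundary g k L"
  shows "z (insert a E) = z (insert a {g 0 k, g 0 (Suc k)})"
proof (rule grid.constant_on_boundary[OF g L _ E])
  fix x
  have aE: "a \<notin> E" if "E \<in> strip_boundary g k L" for E
    using that a by (auto simp: strip_boundary_def)
  show "(\<Sum>E\<in>{E \<in> strip_boundary g k L. x \<in> E}. z (insert a E)) = 0"
  proof (cases "x = a")
    case True
    then have "{E \<in> strip_boundary g k L. x \<in> E} = {}" using aE by blast
    then show ?thesis by (simp only: sum.empty)
  next
    case False
    have eq: "{V \<in> T. {a, x} \<subseteq> V} = insert a ` {E \<in> strip_boundary g k L. x \<in> E}"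
    proof
      show "{V \<in> T. {a, x} \<subseteq> V} \<subseteq> insert a ` {E \<in> strip_boundary g k L. x \<in> E}"
        using only False by blast
      show "insert a ` {E \<in> strip_boundary g k L. x \<in> E} \<subseteq> {V \<in> T. {a, x} \<subseteq> V}"
        using sub by blast
    qed
    have "inj_on (insert a) {E \<in> strip_boundary g k L. x \<in> E}"
      by (rule inj_onI) (use insert_ident[OF aE aE] in simp)
    then have "(\<Sum>E\<in>{E \<in> strip_boundary g k L. x \<in> E}. z (insert a E)) = (\<Sum>V\<in>{V \<in> T. {a, x} \<subseteq> V}. z V)"
      unfolding eq by (simp add: sum.reindex)
    also have "\<dots> = 0" by (rule mod2_cyclesD[OF z]) (use False in simp)
    finally show ?thesis .
  qed
qed

context
  fixes N M :: nat
  assumes N: "0 < N" and M: "0 < M"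
begin

lemma lower_pyramid_eq: "lower_pyramid N j =
  (\<Union>i<N. {first_half Grid i j, second_half Grid i j}) \<union> insert (Lower j) ` strip_boundary Grid j N"
  unfolding lower_pyramid_def pyramid_def row.odd_edges_strip[OF N] by (simp only: strip_def)

lemma upper_pyramid_eq: "upper_pyramid M i =
  (\<Union>j<M. {first_half Grid i j, second_half Grid i j}) \<union> insert (Upper i) ` strip_boundary transposed i M"
  unfolding upper_pyramid_def pyramid_def column.odd_edges_strip[OF M] by (simp only: strip_transposed)

lemma mem_lower_pyramid:
  "V = first_half Grid i j \<or> V = second_half Grid i j \<Longrightarrow> V \<in> lower_pyramid N j' \<longleftrightarrow> i < N \<and> j' = j"
  "E \<in> strip_boundary Grid j N \<Longrightarrow> insert (Lower j) E \<in> lower_pyramid N j' \<longleftrightarrow> j' = j"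
  "insert (Upper i) E \<notin> lower_pyramid N j'"
proof -
  show "V \<in> lower_pyramid N j' \<longleftrightarrow> i < N \<and> j' = j" if V: "V = first_half Grid i j \<or> V = second_half Grid i j"
  proof
    assume "V \<in> lower_pyramid N j'"
    moreover have "Lower j' \<notin> V" using half_bounds(2)[OF V, of "Lower j'"] by blast
    ultimately obtain i' where "i' < N" "V = first_half Grid i' j' \<or> V = second_half Grid i' j'"
      unfolding lower_pyramid_eq by blast
    then show "i < N \<and> j' = j" using half_eq_imp[OF V] by blast
  next
    assume "i < N \<and> j' = j"
    then show "V \<in> lower_pyramid N j'" unfolding lower_pyramid_eq using V by blast
  qed
  show "insert (Lower j) E \<in> lower_pyramid N j' \<longleftrightarrow> j' = j" if E: "E \<in> strip_boundary Grid j N"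
  proof
    assume "insert (Lower j) E \<in> lower_pyramid N j'"
    moreover have "insert (Lower j) E \<noteq> V" if "V = first_half Grid i j' \<or> V = second_half Grid i j'" for V i
      using half_bounds(2)[OF that, of "Lower j"] by blast
    ultimately obtain E' where E': "E' \<in> strip_boundary Grid j' N" "insert (Lower j) E = insert (Lower j') E'"
      unfolding lower_pyramid_eq by blast
    have "Lower j \<in> insert (Lower j') E'" using E'(2) by blast
    moreover have "Lower j \<notin> E'" using boundary_grid[of E' j' N, OF disjI1[OF E'(1)], of "Lower j"] by blast
    ultimately show "j' = j" by simp
  qed (use E lower_pyramid_eq in blast)
  show "insert (Upper i) E \<notin> lower_pyramid N j'"
  proof
    assume "insert (Upper i) E \<in> lower_pyramid N j'"
    moreover have "insert (Upper i) E \<noteq> V" if "V = first_half Grid i' j' \<or> V = second_half Grid i' j'" for V i'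
      using half_bounds(2)[OF that, of "Upper i"] by blast
    ultimately obtain E' where E': "E' \<in> strip_boundary Grid j' N" "insert (Upper i) E = insert (Lower j') E'"
      unfolding lower_pyramid_eq by blast
    have "Upper i \<in> insert (Lower j') E'" using E'(2) by blast
    then show False using boundary_grid[of E' j' N, OF disjI1[OF E'(1)], of "Upper i"] by blast
  qed
qed

lemma mem_upper_pyramid:
  "V = first_half Grid i j \<or> V = second_half Grid i j \<Longrightarrow> V \<in> upper_pyramid M i' \<longleftrightarrow> j < M \<and> i' = i"
  "E \<in> strip_boundary transposed i M \<Longrightarrow> insert (Upper i) E \<in> upper_pyramid M i' \<longleftrightarrow> i' = i"
  "insert (Lower j) E \<notin> upper_pyramid M i'"
proof -
  show "V \<in> upper_pyramid M i' \<longleftrightarrow> j < M \<and> i' = i" if V: "V = first_half Grid i j \<or> V = second_half Grid i j"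
  proof
    assume "V \<in> upper_pyramid M i'"
    moreover have "Upper i' \<notin> V" using half_bounds(2)[OF V, of "Upper i'"] by blast
    ultimately obtain j' where "j' < M" "V = first_half Grid i' j' \<or> V = second_half Grid i' j'"
      unfolding upper_pyramid_eq by blast
    then show "j < M \<and> i' = i" using half_eq_imp[OF V] by blast
  next
    assume "j < M \<and> i' = i"
    then show "V \<in> upper_pyramid M i'" unfolding upper_pyramid_eq using V by blast
  qed
  show "insert (Upper i) E \<in> upper_pyramid M i' \<longleftrightarrow> i' = i" if E: "E \<in> strip_boundary transposed i M"
  proof
    assume "insert (Upper i) E \<in> upper_pyramid M i'"
    moreover have "insert (Upper i) E \<noteq> V" if "V = first_half Grid i' j \<or> V = second_half Grid i' j" for V j
      using half_bounds(2)[OF that, of "Upper i"] by blast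
    ultimately obtain E' where E': "E' \<in> strip_boundary transposed i' M" "insert (Upper i) E = insert (Upper i') E'"
      unfolding upper_pyramid_eq by blast
    have "Upper i \<in> insert (Upper i') E'" using E'(2) by blast
    moreover have "Upper i \<notin> E'" using boundary_grid[of E' _ _ i' M, OF disjI2[OF E'(1)], of "Upper i"] by blast
    ultimately show "i' = i" by simp
  qed (use E upper_pyramid_eq in blast)
  show "insert (Lower j) E \<notin> upper_pyramid M i'"
  proof
    assume "insert (Lower j) E \<in> upper_pyramid M i'"
    moreover have "insert (Lower j) E \<noteq> V" if "V = first_half Grid i' j' \<or> V = second_half Grid i' j'" for V j'
      using half_bounds(2)[OF that, of "Lower j"] by blast
    ultimately obtain E' where E': "E' \<in> strip_boundary transposed i' M" "insert (Lower j) E = insert (Upper i') E'"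
      unfolding upper_pyramid_eq by blast
    have "Lower j \<in> insert (Upper i') E'" using E'(2) by blast
    then show False using boundary_grid[of E' _ _ i' M, OF disjI2[OF E'(1)], of "Lower j"] by blast
  qed
qed

lemma chain_half:
  assumes "V = first_half Grid i j \<or> V = second_half Grid i j" "i < N" "j < M"
  shows "chain N M \<zeta> \<xi> V = \<zeta> j + \<xi> i"
  using assms(2,3) by (simp add: chain_def mem_lower_pyramid(1)[OF assms(1)] mem_upper_pyramid(1)[OF assms(1)])

lemma chain_lower:
  assumes "E \<in> strip_boundary Grid j N" "j < M"
  shows "chain N M \<zeta> \<xi> (insert (Lower j) E) = \<zeta> j"
  using assms(2) by (simp add: chain_def mem_lower_pyramid(2)[OF assms(1)] mem_upper_pyramid(3))

lemma chain_upper: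
  assumes "E \<in> strip_boundary transposed i M" "i < N"
  shows "chain N M \<zeta> \<xi> (insert (Upper i) E) = \<xi> i"
  using assms(2) by (simp add: chain_def mem_upper_pyramid(2)[OF assms(1)] mem_lower_pyramid(3))

lemma all_pyramids_cases:
  assumes "V \<in> all_pyramids N M"
  obtains i j where "i < N" "j < M" "V = first_half Grid i j \<or> V = second_half Grid i j"
  | j E where "j < M" "E \<in> strip_boundary Grid j N" "V = insert (Lower j) E"
  | i E where "i < N" "E \<in> strip_boundary transposed i M" "V = insert (Upper i) E"
  using assms unfolding all_pyramids_def lower_pyramid_eq upper_pyramid_eq by blast

lemma finite_all_pyramids: "finite (all_pyramids N M)"
  unfolding all_pyramids_def lower_pyramid_eq upper_pyramid_eq by (auto simp: strip_boundary_def)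

lemma chain_cycle: "chain N M \<zeta> \<xi> \<in> mod2_cycles (all_pyramids N M)"
proof -
  let ?T = "all_pyramids N M"
  have restrict: "(\<Sum>V\<in>{V \<in> ?T. E \<subseteq> V}. if V \<in> S then c else 0) = 0"
    if S: "S \<subseteq> ?T" and cyc: "(\<Sum>V\<in>{V \<in> S. E \<subseteq> V}. 1 :: bit) = 0" for S E and c :: bit
  proof -
    have "{V \<in> ?T. E \<subseteq> V} \<inter> S = {V \<in> S. E \<subseteq> V}" using S by blast
    then have "(\<Sum>V\<in>{V \<in> ?T. E \<subseteq> V}. if V \<in> S then c else 0) = (\<Sum>V\<in>{V \<in> S. E \<subseteq> V}. c)"
      using sum.inter_restrict[of "{V \<in> ?T. E \<subseteq> V}" "\<lambda>_. c" S] finite_all_pyramids by simp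
    also have "\<dots> = c * (\<Sum>V\<in>{V \<in> S. E \<subseteq> V}. 1)" by (simp only: sum_distrib_left mult_1_right)
    finally show ?thesis by (simp only: cyc mult_zero_right)
  qed
  have "(\<Sum>V\<in>{V \<in> ?T. E \<subseteq> V}. chain N M \<zeta> \<xi> V) = 0" if E: "card E = 2" for E
  proof -
    have low: "(\<Sum>V\<in>{V \<in> ?T. E \<subseteq> V}. if V \<in> lower_pyramid N j then \<zeta> j else 0) = 0" if "j < M" for j
    proof (rule restrict)
      show "lower_pyramid N j \<subseteq> ?T" using that by (auto simp: all_pyramids_def)
      show "(\<Sum>V\<in>{V \<in> lower_pyramid N j. E \<subseteq> V}. 1 :: bit) = 0"
        unfolding lower_pyramid_def
        by (rule pyramid_cycle[OF row.finite_strip row.card_strip _ E])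
          (auto simp: strip_def first_half_def second_half_def)
    qed
    have up: "(\<Sum>V\<in>{V \<in> ?T. E \<subseteq> V}. if V \<in> upper_pyramid M i then \<xi> i else 0) = 0" if "i < N" for i
    proof (rule restrict)
      show "upper_pyramid M i \<subseteq> ?T" using that by (auto simp: all_pyramids_def)
      show "(\<Sum>V\<in>{V \<in> upper_pyramid M i. E \<subseteq> V}. 1 :: bit) = 0"
        unfolding upper_pyramid_def
        by (rule pyramid_cycle[OF column.finite_strip column.card_strip _ E])
          (auto simp: strip_def first_half_def second_half_def)
    qed
    have "(\<Sum>V\<in>{V \<in> ?T. E \<subseteq> V}. chain N M \<zeta> \<xi> V) =
      (\<Sum>j<M. \<Sum>V\<in>{V \<in> ?T. E \<subseteq> V}. if V \<in> lower_pyramid N j then \<zeta> j else 0) +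
      (\<Sum>i<N. \<Sum>V\<in>{V \<in> ?T. E \<subseteq> V}. if V \<in> upper_pyramid M i then \<xi> i else 0)"
      unfolding chain_def sum.distrib by (simp only: sum.swap[of _ "{V \<in> ?T. E \<subseteq> V}"])
    also have "\<dots> = 0" using low up by simp
    finally show ?thesis .
  qed
  moreover have "chain N M \<zeta> \<xi> V = 0" if "V \<notin> ?T" for V
  proof -
    have "V \<notin> lower_pyramid N j" if "j < M" for j using \<open>V \<notin> ?T\<close> that by (auto simp: all_pyramids_def)
    moreover have "V \<notin> upper_pyramid M i" if "i < N" for i using \<open>V \<notin> ?T\<close> that by (auto simp: all_pyramids_def)
    ultimately show ?thesis by (simp add: chain_def)
  qed
  ultimately show ?thesis by (simp add: mod2_cycles_def gf2_vectors_def)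
qed

text \<open>The coefficients are read off from one lateral triangle of each pyramid, and
  \<open>cycle_on_cone\<close> extends the agreement to all lateral triangles. The difference is a
  cycle carried by the flat grid, a disc, and has to vanish.\<close>

lemma cycle_is_chain:
  assumes z: "z \<in> mod2_cycles (all_pyramids N M)"
  shows "\<exists>\<zeta> \<xi>. z = chain N M \<zeta> \<xi>"
proof -
  let ?T = "all_pyramids N M"
  define \<zeta> where "\<zeta> = (\<lambda>j. z (insert (Lower j) {Grid 0 j, Grid 0 (Suc j)}))"
  define \<xi> where "\<xi> = (\<lambda>i. z (insert (Upper i) {Grid i 0, Grid (Suc i) 0}))"
  define y where "y = (\<lambda>V. z V + chain N M \<zeta> \<xi> V)"
  have y: "y \<in> mod2_cycles ?T"
    using gf2.subspace_add[OF mod2_cycles_subspace z chain_cycle[of \<zeta> \<xi>]] by (simp add: y_def plus_fun_def)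
  have lower: "z (insert (Lower j) E) = \<zeta> j" if j: "j < M" and E: "E \<in> strip_boundary Grid j N" for j E
    unfolding \<zeta>_def
  proof (rule cycle_on_cone[OF z row.grid_axioms _ N _ _ E])
    show "insert (Lower j) ` strip_boundary Grid j N \<subseteq> ?T"
      using j unfolding all_pyramids_def lower_pyramid_eq by blast
    show "V \<in> insert (Lower j) ` strip_boundary Grid j N" if V: "V \<in> ?T" "Lower j \<in> V" for V
      using V(1)
    proof (cases rule: all_pyramids_cases)
      case (1 i' j')
      then show ?thesis using half_bounds(2)[of V i' j' "Lower j"] V(2) by blast
    next
      case (2 j' E')
      then have "j' = j" using boundary_grid[of E' j' N, OF disjI1[OF 2(2)], of "Lower j"] V(2) by blast
      then show ?thesis using 2 by blast
    next
      case (3 i' E')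
      then show ?thesis using boundary_grid[of E' _ _ i' M, OF disjI2[OF 3(2)], of "Lower j"] V(2) by blast
    qed
  qed simp
  have upper: "z (insert (Upper i) E) = \<xi> i" if i: "i < N" and E: "E \<in> strip_boundary transposed i M" for i E
    unfolding \<xi>_def
  proof (rule cycle_on_cone[OF z column.grid_axioms _ M _ _ E])
    show "insert (Upper i) ` strip_boundary transposed i M \<subseteq> ?T"
      using i unfolding all_pyramids_def upper_pyramid_eq by blast
    show "V \<in> insert (Upper i) ` strip_boundary transposed i M" if V: "V \<in> ?T" "Upper i \<in> V" for V
      using V(1)
    proof (cases rule: all_pyramids_cases)
      case (1 i' j')
      then show ?thesis using half_bounds(2)[of V i' j' "Upper i"] V(2) by blast
    next
      case (2 j' E')
      then show ?thesis using boundary_grid[of E' j' N, OF disjI1[OF 2(2)], of "Upper i"] V(2) by blast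
    next
      case (3 i' E')
      then have "i' = i" using boundary_grid[of E' _ _ i' M, OF disjI2[OF 3(2)], of "Upper i"] V(2) by blast
      then show ?thesis using 3 by blast
    qed
  qed simp
  define base where "base = (\<Union>i<N. \<Union>j<M. {first_half Grid i j, second_half Grid i j})"
  have y0: "y V = 0" if "V \<notin> base" for V
  proof (cases "V \<in> ?T")
    case True
    then show ?thesis
    proof (cases rule: all_pyramids_cases)
      case (1 i j)
      then show ?thesis using that by (auto simp: base_def)
    next
      case (2 j E)
      then show ?thesis using lower chain_lower by (simp add: y_def)
    next
      case (3 i E)
      then show ?thesis using upper chain_upper by (simp add: y_def)
    qed
  next
    case False
    then show ?thesis using y by (simp add: mod2_cycles_def gf2_vectors_def)
  qed
  have base_T: "base \<subseteq> ?T" unfolding base_def all_pyramids_def lower_pyramid_eq by blast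
  have edge: "(\<Sum>V\<in>{V \<in> base. E \<subseteq> V}. y V) = 0" if E: "card E = 2" for E
  proof -
    have "(\<Sum>V\<in>{V \<in> ?T. E \<subseteq> V}. y V) = (\<Sum>V\<in>{V \<in> base. E \<subseteq> V}. y V)"
      by (rule sum.mono_neutral_right) (use finite_all_pyramids base_T y0 in auto)
    then show ?thesis using mod2_cyclesD[OF y E] by simp
  qed
  have select: "{V \<in> base. {p, q} \<subseteq> V} = S"
    if "\<And>i j V. V = first_half Grid i j \<or> V = second_half Grid i j \<Longrightarrow> p \<in> V \<Longrightarrow> q \<in> V \<Longrightarrow> V \<in> S"
      and "\<And>V. V \<in> S \<Longrightarrow> V \<in> base \<and> p \<in> V \<and> q \<in> V" for p q S
  proof
    show "{V \<in> base. {p, q} \<subseteq> V} \<subseteq> S" using that(1) unfolding base_def by blast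
    show "S \<subseteq> {V \<in> base. {p, q} \<subseteq> V}" using that(2) by blast
  qed
  have in_base: "first_half Grid i j \<in> base" "second_half Grid i j \<in> base" if "i < N" "j < M" for i j
    using that unfolding base_def by blast+
  have mem: "Grid a b \<in> first_half Grid i j \<longleftrightarrow> a = i \<and> b = j \<or> a = Suc i \<and> b = j \<or> a = Suc i \<and> b = Suc j"
    "Grid a b \<in> second_half Grid i j \<longleftrightarrow> a = i \<and> b = j \<or> a = i \<and> b = Suc j \<or> a = Suc i \<and> b = Suc j" for a b i j
    by (auto simp: first_half_def second_half_def)
  have diag: "y (first_half Grid i j) = y (second_half Grid i j)" if "i < N" "j < M" for i j
  proof -
    have "{V \<in> base. {Grid i j, Grid (Suc i) (Suc j)} \<subseteq> V} = {first_half Grid i j, second_half Grid i j}"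
      by (rule select; (elim disjE)?) (auto simp: mem in_base that)
    moreover have "(\<Sum>V\<in>{V \<in> base. {Grid i j, Grid (Suc i) (Suc j)} \<subseteq> V}. y V) = 0" by (rule edge) simp
    ultimately have "(\<Sum>V\<in>{first_half Grid i j, second_half Grid i j}. y V) = 0" by (simp only:)
    then show ?thesis
      using first_half_neq_second_half[of i j i j] by (simp add: bit_add_eq_0_iff)
  qed
  \<comment> \<open>A border edge lies in only one grid triangle. From there zero spreads across
    diagonals and horizontal edges through the whole column.\<close>
  have first: "y (first_half Grid i 0) = 0" if "i < N" for i
  proof -
    have "{V \<in> base. {Grid i 0, Grid (Suc i) 0} \<subseteq> V} = {first_half Grid i 0}"
      by (rule select; (elim disjE)?) (auto simp: mem in_base that M)
    moreover have "(\<Sum>V\<in>{V \<in> base. {Grid i 0, Grid (Suc i) 0} \<subseteq> V}. y V) = 0" by (rule edge) simp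
    ultimately have "(\<Sum>V\<in>{first_half Grid i 0}. y V) = 0" by (simp only:)
    then show ?thesis by simp
  qed
  have next_row: "y (first_half Grid i (Suc j)) = y (second_half Grid i j)" if "i < N" "Suc j < M" for i j
  proof -
    have "{V \<in> base. {Grid i (Suc j), Grid (Suc i) (Suc j)} \<subseteq> V} = {first_half Grid i (Suc j), second_half Grid i j}"
      by (rule select; (elim disjE)?) (auto simp: mem in_base that Suc_lessD[OF that(2)])
    moreover have "(\<Sum>V\<in>{V \<in> base. {Grid i (Suc j), Grid (Suc i) (Suc j)} \<subseteq> V}. y V) = 0" by (rule edge) simp
    ultimately have "(\<Sum>V\<in>{first_half Grid i (Suc j), second_half Grid i j}. y V) = 0" by (simp only:)
    then show ?thesis
      using first_half_neq_second_half[of i "Suc j" i j] by (simp add: bit_add_eq_0_iff)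
  qed
  have zero: "y (first_half Grid i j) = 0" if "i < N" "j < M" for i j
    using that(2)
  proof (induction j)
    case 0
    show ?case by (rule first[OF that(1)])
  next
    case (Suc j)
    then show ?case using next_row[OF that(1) Suc.prems] diag[OF that(1), of j] by simp
  qed
  have "y V = 0" for V
  proof (cases "V \<in> base")
    case True
    then obtain i j where "i < N" "j < M" "V = first_half Grid i j \<or> V = second_half Grid i j"
      by (auto simp: base_def)
    then show ?thesis using zero diag by metis
  qed (rule y0)
  then have "z = chain N M \<zeta> \<xi>" by (simp add: y_def bit_add_eq_0_iff fun_eq_iff)
  then show ?thesis by blast
qed

lemma card_all_pyramids:
  assumes V: "V \<in> all_pyramids N M"
  shows "card V = 3"
  using V
proof (cases rule: all_pyramids_cases)
  case (1 i j)
  then show ?thesis by (auto simp: first_half_def second_half_def)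
next
  case (2 j E)
  moreover from this have "card E = 2" "Lower j \<notin> E" using boundary_card boundary_grid by blast+
  ultimately show ?thesis by (metis card.infinite card_insert_disjoint eval_nat_numeral(3) zero_neq_numeral)
next
  case (3 i E)
  moreover from this have "card E = 2" "Upper i \<notin> E" using boundary_card boundary_grid by blast+
  ultimately show ?thesis by (metis card.infinite card_insert_disjoint eval_nat_numeral(3) zero_neq_numeral)
qed

text \<open>A lateral triangle is the cone over an odd edge; this edge lies in a triangle of the
  strip, and the cone over that triangle belongs to \<open>cells\<close>.\<close>

lemma all_pyramids_cells:
  assumes V: "V \<in> all_pyramids N M"
  shows "\<exists>W\<in>cells. V \<subseteq> W"
  using V
proof (cases rule: all_pyramids_cases)
  case (1 i j)
  then show ?thesis unfolding cells_def by blast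
next
  case (2 j E)
  have "E \<in> odd_edges (strip Grid j N)" using 2 row.odd_edges_strip[OF N] by simp
  then obtain i where "E \<subseteq> first_half Grid i j \<or> E \<subseteq> second_half Grid i j"
    using odd_edges_subset unfolding strip_def by blast
  then have "V \<subseteq> insert (Lower j) (first_half Grid i j) \<or> V \<subseteq> insert (Lower j) (second_half Grid i j)"
    using 2 by blast
  then show ?thesis unfolding cells_def by blast
next
  case (3 i E)
  have "E \<in> odd_edges (strip transposed i M)" using 3 column.odd_edges_strip[OF M] by simp
  then obtain j where "E \<subseteq> first_half Grid i j \<or> E \<subseteq> second_half Grid i j"
    using odd_edges_subset unfolding strip_transposed by blast
  then have "V \<subseteq> insert (Upper i) (first_half Grid i j) \<or> V \<subseteq> insert (Upper i) (second_half Grid i j)"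
    using 3 by blast
  then show ?thesis unfolding cells_def by blast
qed

end


section \<open>Codes with a 2-basis are representable\<close>

text \<open>Leaving out a triangle forces cycles to vanish there, which is an equation between the
  coefficients of the regions on its two sides.\<close>

lemma mod2_cycles_Diff:
  assumes "finite T"
  shows "mod2_cycles (T - X) = {z \<in> mod2_cycles T. \<forall>V\<in>X. z V = 0}"
proof -
  have sums: "(\<Sum>V\<in>{V \<in> T. E \<subseteq> V}. z V) = (\<Sum>V\<in>{V \<in> T - X. E \<subseteq> V}. z V)"
    if "\<And>V. V \<in> X \<Longrightarrow> z V = 0" for z :: "'a set \<Rightarrow> bit" and E
    by (rule sum.mono_neutral_right) (use assms that in auto)
  show ?thesis
  proof (intro set_eqI iffI)
    fix z assume z: "z \<in> mod2_cycles (T - X)"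
    then have X: "z V = 0" if "V \<in> X" for V using that by (simp add: mod2_cycles_def gf2_vectors_def)
    have "z \<in> gf2_vectors T" using z by (simp add: mod2_cycles_def gf2_vectors_def)
    moreover have "(\<Sum>V\<in>{V \<in> T. E \<subseteq> V}. z V) = 0" if "card E = 2" for E
      using sums[of z E, OF X] mod2_cyclesD[OF z that] by (rule trans)
    ultimately show "z \<in> {z \<in> mod2_cycles T. \<forall>V\<in>X. z V = 0}" using X by (simp add: mod2_cycles_def)
  next
    fix z assume "z \<in> {z \<in> mod2_cycles T. \<forall>V\<in>X. z V = 0}"
    then have z: "z \<in> mod2_cycles T" and X: "\<And>V. V \<in> X \<Longrightarrow> z V = 0" by auto
    have "z \<in> gf2_vectors (T - X)" using z X by (auto simp: mod2_cycles_def gf2_vectors_def)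
    moreover have "(\<Sum>V\<in>{V \<in> T - X. E \<subseteq> V}. z V) = 0" if "card E = 2" for E
      using sums[of z E, OF X, symmetric] mod2_cyclesD[OF z that] by (rule trans)
    ultimately show "z \<in> mod2_cycles (T - X)" by (simp add: mod2_cycles_def)
  qed
qed

lemma chain_cong:
  assumes "\<And>j. j < M \<Longrightarrow> \<zeta> j = \<zeta>' j" "\<And>i. i < N \<Longrightarrow> \<xi> i = \<xi>' i"
  shows "chain N M \<zeta> \<xi> = chain N M \<zeta>' \<xi>'"
proof
  fix V
  show "chain N M \<zeta> \<xi> V = chain N M \<zeta>' \<xi>' V"
    unfolding chain_def by (intro arg_cong2[of _ _ _ _ "(+)"] sum.cong) (simp_all add: assms)
qed

lemma finite_gf2_vectors:
  assumes "finite I"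
  shows "finite (gf2_vectors I)"
proof -
  have bit: "(UNIV :: bit set) = {0, 1}" by auto
  have "finite {x. \<forall>i. (i \<in> I \<longrightarrow> x i \<in> (UNIV :: bit set)) \<and> (i \<notin> I \<longrightarrow> x i = 0)}"
    by (rule finite_set_of_finite_funs[OF assms]) (simp add: bit)
  then show ?thesis by (simp add: gf2_vectors_def)
qed

text \<open>Index 0 is outside \<open>{1..m}\<close> and takes the place of missing basis vectors.
  With it every coordinate belongs to a pair of rows, possibly equal ones.\<close>

lemma card_le_2_indices:
  fixes c :: "nat \<Rightarrow> bit"
  assumes "card {k \<in> {1..m}. c k \<noteq> 0} \<le> 2"
  shows "\<exists>p q. p \<le> m \<and> q \<le> m \<and> (\<forall>k\<in>{1..m}. c k = of_bool (k = p) + of_bool (k = q))"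
proof -
  define K where "K = {k \<in> {1..m}. c k \<noteq> 0}"
  have c: "c k = of_bool (k \<in> K)" if "k \<in> {1..m}" for k
    using that by (cases "c k") (simp_all add: K_def)
  have K: "K \<subseteq> {1..m}" by (auto simp: K_def)
  then have fin: "finite K" using finite_subset by blast
  have "card K \<le> 2" using assms by (simp only: K_def)
  then consider "card K = 0" | "card K = 1" | "card K = 2" by linarith
  then show ?thesis
  proof cases
    case 1
    then have "K = {}" using fin by simp
    then have "\<forall>k\<in>{1..m}. c k = of_bool (k = 0) + of_bool (k = 0)" using c by simp
    then show ?thesis by blast
  next
    case 2
    then obtain q where q: "K = {q}" by (auto simp: card_1_singleton_iff)
    then have "q \<le> m" using K by simp
    moreover have "\<forall>k\<in>{1..m}. c k = of_bool (k = 0) + of_bool (k = q)"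
      using c by (simp add: q)
    ultimately show ?thesis by blast
  next
    case 3
    then obtain p q where pq: "K = {p, q}" "p \<noteq> q" by (auto simp: card_2_iff)
    then have "p \<le> m" "q \<le> m" using K by simp_all
    moreover have "\<forall>k\<in>{1..m}. c k = of_bool (k = p) + of_bool (k = q)"
      using c pq(2) by (auto simp: pq(1))
    ultimately show ?thesis by blast
  qed
qed

lemma representation_if_two_basis:
  assumes C: "binary_linear_code n C" and B: "two_basis n C B"
  shows "has_geometric_representation_in TYPE(real ^ 3) n C"
proof -
  have indep: "\<not> gf2_dependent B" and span: "gf2_span B = C"
    and two: "\<And>i. i \<in> {1..n} \<Longrightarrow> card {b \<in> B. b i \<noteq> 0} \<le> 2"
    using B unfolding two_basis_def by blast+
  have BC: "B \<subseteq> C" unfolding span[symmetric] by (rule gf2.span_superset)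
  have Cn: "C \<subseteq> gf2_vectors {1..n}" using C by (simp add: binary_linear_code_def)
  have finB: "finite B" by (rule finite_subset[OF subset_trans[OF BC Cn] finite_gf2_vectors]) simp
  define m where "m = card B"
  obtain b where b: "bij_betw b {1..m} B"
    using ex_bij_betw_nat_finite_1[OF finB] unfolding m_def by blast
  have b_inj: "inj_on b {1..m}" and b_im: "b ` {1..m} = B" using b by (auto simp: bij_betw_def)
  define Q where "Q = (\<lambda>i p q. p \<le> m \<and> q \<le> m \<and> (\<forall>k\<in>{1..m}. b k i = of_bool (k = p) + of_bool (k = q)))"
  have "\<exists>p q. Q i p q" if i: "i \<in> {1..n}" for i
    unfolding Q_def
  proof (rule card_le_2_indices)
    have "b ` {k \<in> {1..m}. b k i \<noteq> 0} = {v \<in> B. v i \<noteq> 0}" unfolding b_im[symmetric] by blast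
    moreover have "card (b ` {k \<in> {1..m}. b k i \<noteq> 0}) = card {k \<in> {1..m}. b k i \<noteq> 0}"
      by (rule card_image, rule inj_on_subset[OF b_inj]) blast
    ultimately show "card {k \<in> {1..m}. b k i \<noteq> 0} \<le> 2" using two[OF i] by (simp only:)
  qed
  then have "\<forall>i\<in>{1..n}. \<exists>p q. Q i p q" by blast
  then obtain p0 q where Q: "\<And>i. i \<in> {1..n} \<Longrightarrow> Q i (p0 i) (q i)"
    by metis
  have p0: "p0 i \<le> m" and q: "q i \<le> m"
    and bpq0: "k \<in> {1..m} \<Longrightarrow> b k i = of_bool (k = p0 i) + of_bool (k = q i)"
    if "i \<in> {1..n}" for i k
    using Q[OF that] unfolding Q_def by blast+
  \<comment> \<open>Column 0 carries no coordinate; the default opens it to row 0.\<close>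
  define p where "p = (\<lambda>i. if i \<in> {1..n} then p0 i else 0)"
  have p: "p i \<le> m" for i using p0 by (simp add: p_def)
  have bpq: "b k i = of_bool (k = p i) + of_bool (k = q i)" if "i \<in> {1..n}" "k \<in> {1..m}" for i k
    using bpq0[OF that] that(1) by (simp add: p_def)
  \<comment> \<open>Rows 1 to \<open>m\<close> belong to the basis vectors and columns 1 to
    \<open>n\<close> to the coordinates; row 0 stands for the exterior, and column 0 keeps the
    numbering.\<close>
  define N M where "N = Suc n" and "M = Suc m"
  have NM: "0 < N" "0 < M" by (simp_all add: N_def M_def)
  define e where "e = {Grid 0 0, Grid 0 (Suc 0)}"
  have e: "e \<in> strip_boundary Grid 0 N" by (simp add: e_def strip_boundary_def)

  txt \<open>Column i is opened to row p i, and row 0 to the exterior. Then the second half of the cell in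
    column i and row q i separates the regions of the rows p i and q i.\<close>

  define X where "X = insert (insert (Lower 0) e) ((\<lambda>i. first_half Grid i (p i)) ` {..<N})"
  define T where "T = all_pyramids N M - X"
  define \<psi> where "\<psi> = (\<lambda>i. second_half Grid i (q i))"
  \<comment> \<open>Vanishing on the opened triangle of column \<open>i\<close> means
    \<open>\<xi> i = \<zeta> (p i)\<close>, so \<open>\<zeta>\<close> determines the cycle. The
    opened lateral triangle of row 0 adds \<open>\<zeta> 0 = 0\<close>.\<close>
  define cyc where "cyc = (\<lambda>\<zeta>. chain N M \<zeta> (\<lambda>i. \<zeta> (p i)))"
  have pM: "p i < M" for i using p[of i] by (simp add: M_def)
  have half_first: "chain N M \<zeta> \<xi> (first_half Grid i (p i)) = \<zeta> (p i) + \<xi> i" if "i < N" for \<zeta> \<xi> i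
    by (rule chain_half[OF NM _ that pM]) simp
  have open_row: "chain N M \<zeta> \<xi> (insert (Lower 0) e) = \<zeta> 0" for \<zeta> \<xi>
    by (rule chain_lower[OF NM e NM(2)])
  have cycles: "mod2_cycles T = cyc ` {\<zeta>. \<zeta> 0 = 0}"
  proof
    show "mod2_cycles T \<subseteq> cyc ` {\<zeta>. \<zeta> 0 = 0}"
    proof
      fix z assume "z \<in> mod2_cycles T"
      then have z: "z \<in> mod2_cycles (all_pyramids N M)" "\<And>V. V \<in> X \<Longrightarrow> z V = 0"
        unfolding T_def mod2_cycles_Diff[OF finite_all_pyramids[OF NM]] by auto
      obtain \<zeta> \<xi> where zc: "z = chain N M \<zeta> \<xi>" using cycle_is_chain[OF NM z(1)] by blast
      have "\<zeta> 0 = 0" using z(2)[of "insert (Lower 0) e"] open_row[of \<zeta> \<xi>] by (simp add: X_def zc)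
      moreover have "\<xi> i = \<zeta> (p i)" if "i < N" for i
        using z(2)[of "first_half Grid i (p i)"] half_first[OF that, of \<zeta> \<xi>] that
        by (simp add: X_def zc bit_add_eq_0_iff)
      then have "z = cyc \<zeta>" unfolding zc cyc_def by (intro chain_cong) simp_all
      ultimately show "z \<in> cyc ` {\<zeta>. \<zeta> 0 = 0}" by blast
    qed
    show "cyc ` {\<zeta>. \<zeta> 0 = 0} \<subseteq> mod2_cycles T"
    proof clarify
      fix \<zeta> :: "nat \<Rightarrow> bit" assume "\<zeta> 0 = 0"
      then have "cyc \<zeta> V = 0" if "V \<in> X" for V
        using that half_first open_row unfolding X_def cyc_def by auto
      then show "cyc \<zeta> \<in> mod2_cycles T"
        unfolding T_def mod2_cycles_Diff[OF finite_all_pyramids[OF NM]]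
        using chain_cycle[OF NM] by (simp add: cyc_def)
    qed
  qed
  have \<psi>T: "\<psi> ` {1..n} \<subseteq> T"
  proof
    fix V assume "V \<in> \<psi> ` {1..n}"
    then obtain i where i: "i \<in> {1..n}" "V = second_half Grid i (q i)" by (auto simp: \<psi>_def)
    have "q i < M" "i < N" using q[OF i(1)] i(1) by (auto simp: M_def N_def)
    then have "V \<in> lower_pyramid N (q i)"
      using mem_lower_pyramid(1)[OF NM, of V i "q i" "q i"] i(2) by simp
    then have "V \<in> all_pyramids N M" using \<open>q i < M\<close> by (auto simp: all_pyramids_def)
    moreover have "V \<noteq> first_half Grid i' (p i')" for i'
      using first_half_neq_second_half[of i' "p i'" i "q i"] i(2) by auto
    moreover have "V \<noteq> insert (Lower 0) e"
      using half_bounds(2)[of V i "q i" "Lower 0"] i(2) by blast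
    ultimately show "V \<in> T" by (auto simp: T_def X_def)
  qed
  have \<psi>_inj: "inj_on \<psi> {1..n}"
  proof (rule inj_onI)
    fix i i' assume "\<psi> i = \<psi> i'"
    then show "i = i'" using half_eq_imp(1)[of "\<psi> i" i "q i" i' "q i'"] by (simp add: \<psi>_def)
  qed
  \<comment> \<open>The entry of the cycle at \<open>\<psi> i\<close> is
    \<open>\<zeta> (q i) + \<zeta> (p i)\<close>. Since \<open>\<zeta> 0 = 0\<close>, this is the
    entry at \<open>i\<close> of the combination of the basis with coefficients
    \<open>\<zeta>\<close>.\<close>
  define comb where "comb = (\<lambda>\<zeta> i. \<Sum>k\<in>{1..m}. \<zeta> k * b k i)"
  have comb: "pullback {1..n} \<psi> (cyc \<zeta>) = comb \<zeta>" if \<zeta>0: "\<zeta> 0 = 0" for \<zeta>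
  proof
    fix i
    show "pullback {1..n} \<psi> (cyc \<zeta>) i = comb \<zeta> i"
    proof (cases "i \<in> {1..n}")
      case True
      have pick: "(\<Sum>k\<in>{1..m}. \<zeta> k * of_bool (k = r)) = \<zeta> r" if "r \<le> m" for r
      proof (cases "r = 0")
        case True
        then show ?thesis using \<zeta>0 by (intro sum.neutral[THEN trans]) auto
      next
        case False
        then have "r \<in> {1..m}" using that by simp
        then have "(\<Sum>k\<in>{1..m}. if k = r then \<zeta> k else 0) = \<zeta> r" by simp
        moreover have "(\<Sum>k\<in>{1..m}. \<zeta> k * of_bool (k = r)) = (\<Sum>k\<in>{1..m}. if k = r then \<zeta> k else 0)"
          by (rule sum.cong) auto
        ultimately show ?thesis by (simp only:)
      qed
      have "comb \<zeta> i = (\<Sum>k\<in>{1..m}. \<zeta> k * of_bool (k = p i)) + (\<Sum>k\<in>{1..m}. \<zeta> k * of_bool (k = q i))"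
        unfolding comb_def sum.distrib[symmetric] distrib_left[symmetric]
        by (rule sum.cong[OF refl]) (simp only: bpq[OF True])
      also have "\<dots> = \<zeta> (q i) + \<zeta> (p i)" using pick p q[OF True] by (simp add: add.commute)
      also have "\<dots> = cyc \<zeta> (\<psi> i)"
        unfolding cyc_def \<psi>_def using True q[OF True]
        by (intro chain_half[OF NM, symmetric]) (auto simp: N_def M_def)
      finally show ?thesis using True by (simp add: pullback_def)
    next
      case False
      have "b k i = 0" if "k \<in> {1..m}" for k
        using that b_im BC Cn False unfolding gf2_vectors_def by blast
      then have "comb \<zeta> i = 0" by (simp add: comb_def)
      moreover have "pullback {1..n} \<psi> (cyc \<zeta>) i = 0" unfolding pullback_def using False by (rule if_not_P)
      ultimately show ?thesis by simp
    qed
  qed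
  have comb_sum: "comb \<zeta> = (\<Sum>v\<in>B. (\<lambda>i. \<zeta> (inv_into {1..m} b v) * v i))" for \<zeta>
  proof
    fix i
    have "(\<Sum>v\<in>B. \<zeta> (inv_into {1..m} b v) * v i) = (\<Sum>k\<in>{1..m}. \<zeta> (inv_into {1..m} b (b k)) * b k i)"
      using sum.reindex_bij_betw[OF b, of "\<lambda>v. \<zeta> (inv_into {1..m} b v) * v i"] by simp
    also have "\<dots> = comb \<zeta> i" unfolding comb_def
      by (rule sum.cong[OF refl]) (simp only: inv_into_f_f[OF b_inj])
    finally show "comb \<zeta> i = (\<Sum>v\<in>B. (\<lambda>i. \<zeta> (inv_into {1..m} b v) * v i)) i"
      by (simp add: gf2_sum_apply)
  qed
  have C_eq: "C = pullback {1..n} \<psi> ` mod2_cycles T"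
  proof -
    have "C = range (\<lambda>u. \<Sum>v\<in>B. (\<lambda>i. u v * v i))"
      unfolding span[symmetric] by (rule gf2.span_finite[OF finB])
    also have "\<dots> = comb ` {\<zeta>. \<zeta> 0 = 0}"
    proof
      show "comb ` {\<zeta>. \<zeta> 0 = 0} \<subseteq> range (\<lambda>u. \<Sum>v\<in>B. (\<lambda>i. u v * v i))"
      proof clarify
        fix \<zeta> :: "nat \<Rightarrow> bit"
        show "comb \<zeta> \<in> range (\<lambda>u. \<Sum>v\<in>B. (\<lambda>i. u v * v i))"
          unfolding comb_sum by (rule range_eqI[of _ _ "\<lambda>v. \<zeta> (inv_into {1..m} b v)"]) simp
      qed
      show "range (\<lambda>u. \<Sum>v\<in>B. (\<lambda>i. u v * v i)) \<subseteq> comb ` {\<zeta>. \<zeta> 0 = 0}"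
      proof clarify
        fix u :: "(nat \<Rightarrow> bit) \<Rightarrow> bit"
        define \<zeta> where "\<zeta> = (\<lambda>k. if k = 0 then 0 else u (b k))"
        have "comb \<zeta> = (\<Sum>v\<in>B. (\<lambda>i. u v * v i))"
        proof
          fix i
          have "comb \<zeta> i = (\<Sum>k\<in>{1..m}. u (b k) * b k i)"
            unfolding comb_def by (rule sum.cong[OF refl]) (simp add: \<zeta>_def)
          also have "\<dots> = (\<Sum>v\<in>B. u v * v i)"
            using sum.reindex_bij_betw[OF b, of "\<lambda>v. u v * v i"] by simp
          finally show "comb \<zeta> i = (\<Sum>v\<in>B. (\<lambda>i. u v * v i)) i" by (simp add: gf2_sum_apply)
        qed
        moreover have "\<zeta> 0 = 0" by (simp add: \<zeta>_def)
        ultimately show "(\<Sum>v\<in>B. (\<lambda>i. u v * v i)) \<in> comb ` {\<zeta>. \<zeta> 0 = 0}"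
          by (intro image_eqI[of _ _ \<zeta>]) simp_all
      qed
    qed
    also have "\<dots> = pullback {1..n} \<psi> ` mod2_cycles T"
      unfolding cycles image_image by (rule image_cong[OF refl], rule comb[symmetric]) (erule CollectD)
    finally show ?thesis .
  qed
  \<comment> \<open>Equal restrictions give equal combinations of the basis, hence by independence
    equal coefficients in rows 1 to \<open>m\<close>; row 0 is fixed at 0, and the columns follow
    through \<open>p\<close>.\<close>
  have inj: "inj_on (pullback {1..n} \<psi>) (mod2_cycles T)"
  proof (rule inj_onI)
    fix z z' assume z: "z \<in> mod2_cycles T" "z' \<in> mod2_cycles T" "pullback {1..n} \<psi> z = pullback {1..n} \<psi> z'"
    obtain \<zeta> where \<zeta>: "z = cyc \<zeta>" "\<zeta> 0 = 0" using z(1) unfolding cycles by blast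
    obtain \<zeta>' where \<zeta>': "z' = cyc \<zeta>'" "\<zeta>' 0 = 0" using z(2) unfolding cycles by blast
    define d where "d = (\<lambda>k. \<zeta> k + \<zeta>' k)"
    have comb_eq: "comb \<zeta> = comb \<zeta>'" using z(3) unfolding \<zeta>(1) \<zeta>'(1) comb[of \<zeta>, OF \<zeta>(2)] comb[of \<zeta>', OF \<zeta>'(2)] .
    have "comb d i = comb \<zeta> i + comb \<zeta>' i" for i
      by (simp add: comb_def d_def distrib_right sum.distrib)
    then have "comb d = 0" using comb_eq by (simp add: fun_eq_iff)
    then have zero: "(\<Sum>v\<in>B. (\<lambda>i. d (inv_into {1..m} b v) * v i)) = 0" unfolding comb_sum .
    have "d (inv_into {1..m} b v) = 0" if "v \<in> B" for v
      using gf2.independentD[OF indep finB subset_refl zero that] .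
    then have "d k = 0" if k: "k \<in> {1..m}" for k
      using inv_into_f_f[OF b_inj k] k b_im by (metis imageI)
    then have "\<zeta> k = \<zeta>' k" if "k < M" for k
      using that \<zeta>(2) \<zeta>'(2) by (cases "k = 0") (auto simp: d_def M_def bit_add_eq_0_iff less_Suc_eq_le)
    then show "z = z'"
      unfolding \<zeta>(1) \<zeta>'(1) cyc_def using pM by (intro chain_cong) simp_all
  qed
  \<comment> \<open>The definition asks for a configuration in the space of finitely supported
    sequences together with an isomorphic copy in three-space. Both are realizations of the same
    abstract complex with respect to different frames.\<close>
  interpret pm: frame "Poly_Mapping.single 0 1" "Poly_Mapping.single 1 1" "Poly_Mapping.single 2 1 :: nat \<Rightarrow>\<^sub>0 real"
    "\<lambda>p. Poly_Mapping.lookup p 0" "\<lambda>p. Poly_Mapping.lookup p 1" "\<lambda>p. Poly_Mapping.lookup p 2"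
    by (rule frame_poly_mapping)
  interpret vec: frame "axis 1 1" "axis 2 1" "axis 3 1 :: real ^ 3" "\<lambda>p. p $ 1" "\<lambda>p. p $ 2" "\<lambda>p. p $ 3"
    by (rule frame_vec)
  have T: "finite T" "T \<noteq> {}" "\<And>V. V \<in> T \<Longrightarrow> card V = 3" "\<And>V. V \<in> T \<Longrightarrow> \<exists>W\<in>cells. V \<subseteq> W"
  proof -
    show "finite T" using finite_all_pyramids[OF NM] by (simp add: T_def)
    \<comment> \<open>Column 0 supplies a triangle even for \<open>n = 0\<close>, as a configuration
      must contain one.\<close>
    have "second_half Grid 0 0 \<in> lower_pyramid N 0"
      using mem_lower_pyramid(1)[OF NM, of "second_half Grid 0 0" 0 0 0] NM by simp
    then have "second_half Grid 0 0 \<in> all_pyramids N M" using NM(2) by (auto simp: all_pyramids_def)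
    moreover have "second_half Grid 0 0 \<notin> X"
    proof
      assume "second_half Grid 0 0 \<in> X"
      moreover have "second_half Grid 0 0 \<noteq> first_half Grid i (p i)" for i
        using first_half_neq_second_half[of i "p i" 0 0] by metis
      moreover have "second_half Grid 0 0 \<noteq> insert (Lower 0) e"
        using half_bounds(2)[of "second_half Grid 0 0" 0 0 "Lower 0"] by blast
      ultimately show False by (auto simp: X_def)
    qed
    ultimately show "T \<noteq> {}" by (auto simp: T_def)
    show "card V = 3" if "V \<in> T" for V
      using card_all_pyramids[OF NM, of V] that by (simp add: T_def)
    show "\<exists>W\<in>cells. V \<subseteq> W" if "V \<in> T" for V
      using all_pyramids_cells[OF NM, of V] that by (simp add: T_def)
  qed
  have real_pm: "realization cells T pm.place pm.coord" by (rule pm.realization) (use T in auto)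
  have real_vec: "realization cells T vec.place vec.coord" by (rule vec.realization) (use T in auto)
  have "geometric_representation n C (realization.complex T pm.place)
    (triangles (realization.complex T pm.place) - realization.hull_of pm.place ` \<psi> ` {1..n})"
    by (rule realization.geometric_representation[OF real_pm \<psi>T \<psi>_inj C_eq inj])
  moreover have "embeddable_into TYPE(real ^ 3) (realization.complex T pm.place)"
    unfolding embeddable_into_def
    using realization.triangular_configuration[OF real_vec] config_isomorphic_realizations[OF real_pm real_vec] by blast
  ultimately show ?thesis unfolding has_geometric_representation_in_def by blast
qed


theorem theorem3:
  fixes n :: nat and C :: "(nat \<Rightarrow> bit) set"
  assumes "binary_linear_code n C"
  shows "has_geometric_representation_in TYPE(real ^ 3) n C \<longleftrightarrow> (\<exists>B. two_basis n C B)"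
  using two_basis_if_representation representation_if_two_basis[OF assms] by blast


end
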